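(* Let $n$ be a positive integer and let $\boldsymbol{X}=(X_{i,j})_{i,j\in[2n]}$ be the matrix with entries $X_{i,j}=E_{i,j}-E_{-j,-i}\in\mathfrak{o}_{2n}\subset U(\mathfrak{o}_{2n})$, where $-i$ stands for the index $2n+1-i$. For $i,j\in[n]$ put $a_{i,j}=X_{i,j}$, $b_{i,j}=X_{i,-j}$, $c_{i,j}=X_{-j,i}$. Then in $U(\mathfrak{o}_{2n})$ $$\operatorname{Pf}(\boldsymbol{X})=\sum_{k=0}^{\lfloor n/2\rfloor}\ \sum_{\substack{I,J\subset[n]\\ |I|=|J|=2k}}\operatorname{sgn}(\bar I,I)\,\operatorname{sgn}(\bar J,J)\,\det\!\left(a^{\bar I}_{\bar J}+\mathbb{1}^{\bar I}_{\bar J}\,\boldsymbol{\rho}(|\bar J|)\right)\operatorname{Pf}(c_J)\,\operatorname{Pf}(b_I),$$ where $\boldsymbol{\rho}(j)$ denotes the diagonal matrix $\operatorname{diag}(j-1,j-2,\dots,1,0)$, $\det$ is the column determinant, and $\bar I,\bar J$ are the complements of $I,J$ in $[n]$.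
   Context: Notation. $[m]=\{1,\dots,m\}$. Row and column indices of $2n\times 2n$ matrices lie in $[2n]$, and $-i$ stands for $2n+1-i$ (so $-(-i)=i$). $E_{i,j}$ is the $2n\times 2n$ matrix unit. $J_{2n}$ is the $2n\times2n$ matrix with $1$'s on the anti-diagonal and $0$'s elsewhere, and $\mathfrak{o}_{2n}=\{X\in\mathrm{Mat}_{2n}(\mathbb{C}) : {}^tX J_{2n}+J_{2n}X=0\}$, a complex Lie algebra with universal enveloping algebra $U(\mathfrak{o}_{2n})$. One has $X_{-j,-i}=-X_{i,j}$, so $b_{j,i}=-b_{i,j}$, $c_{j,i}=-c_{i,j}$; in block form $\boldsymbol{X}=\begin{bmatrix} a&b\\ c&-J_n{}^taJ_n\end{bmatrix}$ with $n\times n$ blocks, where the entry of $b$ in row $i$ and in column $-j$ of $\boldsymbol X$ is $b_{i,j}$, and the entry of $c$ in row $-j$ of $\boldsymbol X$ and column $i$ is $c_{i,j}$. Pfaffian: for an alternating matrix $\boldsymbol A=(A_{i,j})_{i,j\in[2m]}$ ($A_{j,i}=-A_{i,j}$) over an associative $\mathbb{C}$-algebra, $$\operatorname{Pf}(\boldsymbol A)=\frac1{2^m m!}\sum_{\sigma\in\mathfrak S_{2m}}\operatorname{sgn}(\sigma)A_{\sigma(1),\sigma(2)}A_{\sigma(3),\sigma(4)}\cdots A_{\sigma(2m-1),\sigma(2m)}.$$ $\operatorname{Pf}(\boldsymbol X)$ means the Pfaffian of the alternating matrix $\boldsymbol XJ_{2n}$, whose $(i,j)$ entry is $X_{i,-j}$.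 For $I=\{i_1<\dots<i_{2k}\}\subset[n]$, $\operatorname{Pf}(b_I)$ is the Pfaffian of the alternating matrix $(b_{i_s,i_t})_{s,t\in[2k]}$, and similarly $\operatorname{Pf}(c_J)$ for $(c_{j_s,j_t})_{s,t}$ (all $b$'s commute with each other and all $c$'s commute with each other). The empty Pfaffian and empty determinant equal $1$. Column determinant: for a square matrix $\boldsymbol{\Phi}=(\Phi_{i,j})_{i,j\in[m]}$, $\det(\boldsymbol\Phi)=\sum_{\sigma\in\mathfrak S_m}\operatorname{sgn}(\sigma)\Phi_{\sigma(1),1}\Phi_{\sigma(2),2}\cdots\Phi_{\sigma(m),m}$. For equal-size subsets $\bar I,\bar J\subset[n]$, $a^{\bar I}_{\bar J}=(a_{i,j})_{i\in\bar I,j\in\bar J}$ and $\mathbb{1}^{\bar I}_{\bar J}=(\delta_{i,j})_{i\in\bar I,j\in\bar J}$ (submatrix of the $n\times n$ identity), with rows and columns listed in increasing order. Signs: if $[n]=\bar I\sqcup I$ with $\bar I=\{\bar i_1<\dots<\bar i_r\}$ and $I=\{i_1<\dots<i_s\}$, then $\operatorname{sgn}(\bar I,I)$ is the signature of the permutation sending $1,\dots,n$ to $\bar i_1,\dots,\bar i_r,i_1,\dots,i_s$. *)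

theory Defs
  imports
    "HOL-Analysis.Analysis"
    "HOL-Library.Poly_Mapping"
    "HOL-Library.Numeral_Type"
    "HOL-Combinatorics.Permutations"
begin

section \<open>Complex algebras and complex Lie algebras\<close>

class scaleC =
  fixes scaleC :: "complex \<Rightarrow> 'a \<Rightarrow> 'a"  (infixr "*\<^sub>C" 75)

class complex_vector = scaleC + ab_group_add +
  assumes scaleC_add_right: "c *\<^sub>C (x + y) = c *\<^sub>C x + c *\<^sub>C y"
    and scaleC_add_left: "(c + d) *\<^sub>C x = c *\<^sub>C x + d *\<^sub>C x"
    and scaleC_scaleC: "c *\<^sub>C d *\<^sub>C x = (c * d) *\<^sub>C x"
    and scaleC_one: "1 *\<^sub>C x = x"

class complex_algebra_1 = complex_vector + ring_1 +
  assumes mult_scaleC_left: "(c *\<^sub>C x) * y = c *\<^sub>C (x * y)"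
    and mult_scaleC_right: "x * (c *\<^sub>C y) = c *\<^sub>C (x * y)"

class complex_lie_algebra = complex_vector +
  fixes lie_bracket :: "'a \<Rightarrow> 'a \<Rightarrow> 'a"
  assumes lie_bracket_add_left: "lie_bracket (x + y) z = lie_bracket x z + lie_bracket y z"
    and lie_bracket_add_right: "lie_bracket z (x + y) = lie_bracket z x + lie_bracket z y"
    and lie_bracket_scaleC_left: "lie_bracket (c *\<^sub>C x) y = c *\<^sub>C lie_bracket x y"
    and lie_bracket_scaleC_right: "lie_bracket x (c *\<^sub>C y) = c *\<^sub>C lie_bracket x y"
    and lie_bracket_self: "lie_bracket x x = 0"
    and jacobi: "lie_bracket x (lie_bracket y z) + lie_bracket y (lie_bracket z x)
                 + lie_bracket z (lie_bracket x y) = 0"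


section \<open>The universal enveloping algebra\<close>

text \<open>
  The free complex algebra on a type is the monoid algebra over the free monoid, which is
  written additively because \<^typ>\<open>'a \<Rightarrow>\<^sub>0 'b\<close> carries the convolution product for additive
  monoids of exponents.
\<close>

datatype 'g free_monoid = Word "'g list"

instantiation free_monoid :: (type) monoid_add
begin

definition zero_free_monoid :: "'a free_monoid" where
  "0 = Word []"

fun plus_free_monoid :: "'a free_monoid \<Rightarrow> 'a free_monoid \<Rightarrow> 'a free_monoid" where
  "Word u + Word v = Word (u @ v)"

instance
proof
  fix u v w :: "'a free_monoid"
  show "u + v + w = u + (v + w)" by (cases u; cases v; cases w) simp
  show "0 + u = u" by (cases u) (simp add: zero_free_monoid_def)
  show "u + 0 = u" by (cases u) (simp add: zero_free_monoid_def)
qed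

end

lemma free_monoid_add_eq_0_iff: "u + v = 0 \<longleftrightarrow> u = 0 \<and> v = 0" for u v :: "'g free_monoid"
  by (cases u; cases v) (simp add: zero_free_monoid_def)

type_synonym 'g free_algebra = "'g free_monoid \<Rightarrow>\<^sub>0 complex"

definition free_const :: "complex \<Rightarrow> 'g free_algebra" where
  "free_const c = Poly_Mapping.single 0 c"

definition free_gen :: "'g \<Rightarrow> 'g free_algebra" where
  "free_gen x = Poly_Mapping.single (Word [x]) 1"

text \<open>
  The first two kinds of relations turn the free algebra on the underlying set of the Lie
  algebra into its tensor algebra; the third kind then gives the enveloping algebra.
\<close>

inductive_set uea_ideal :: "'g::complex_lie_algebra free_algebra set" where
  rel_add: "free_gen (x + y) - free_gen x - free_gen y \<in> uea_ideal"
| rel_scaleC: "free_gen (c *\<^sub>C x) - free_const c * free_gen x \<in> uea_ideal"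
| rel_bracket:
    "free_gen x * free_gen y - free_gen y * free_gen x - free_gen (lie_bracket x y) \<in> uea_ideal"
| ideal_zero: "0 \<in> uea_ideal"
| ideal_add: "p \<in> uea_ideal \<Longrightarrow> q \<in> uea_ideal \<Longrightarrow> p + q \<in> uea_ideal"
| ideal_mult: "p \<in> uea_ideal \<Longrightarrow> u * p * v \<in> uea_ideal"

lemma ideal_mult_left: "p \<in> uea_ideal \<Longrightarrow> u * p \<in> uea_ideal"
  using ideal_mult[of p u 1] by simp

lemma ideal_mult_right: "p \<in> uea_ideal \<Longrightarrow> p * v \<in> uea_ideal"
  using ideal_mult[of p 1 v] by simp

lemma ideal_uminus: "p \<in> uea_ideal \<Longrightarrow> - p \<in> uea_ideal"
  using ideal_mult_left[of p "-1"] by simp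

lemma ideal_diff: "p \<in> uea_ideal \<Longrightarrow> q \<in> uea_ideal \<Longrightarrow> p - q \<in> uea_ideal"
  using ideal_add[OF _ ideal_uminus, of p q] by simp

quotient_type (overloaded) 'g uea = "'g::complex_lie_algebra free_algebra" / "\<lambda>p q. p - q \<in> uea_ideal"
proof (rule equivpI)
  show "reflp (\<lambda>p q. p - q \<in> (uea_ideal :: 'g free_algebra set))"
    by (rule reflpI) (simp add: ideal_zero)
  show "symp (\<lambda>p q. p - q \<in> (uea_ideal :: 'g free_algebra set))"
    by (rule sympI) (metis ideal_uminus minus_diff_eq)
  show "transp (\<lambda>p q. p - q \<in> (uea_ideal :: 'g free_algebra set))"
    by (rule transpI) (use ideal_add in fastforce)
qed

lemma free_const_add: "free_const (c + d) = free_const c + free_const d"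
  by (simp add: free_const_def single_add)

lemma free_const_mult: "free_const (c * d) = free_const c * free_const d"
  by (simp add: free_const_def mult_single)

lemma free_const_1: "free_const 1 = 1"
  by (simp add: free_const_def)

lemma free_algebra_induct [case_names single add]:
  fixes p :: "'g free_algebra"
  assumes single: "\<And>k v. P (Poly_Mapping.single k v)"
    and add: "\<And>f g. P f \<Longrightarrow> P g \<Longrightarrow> P (f + g)"
  shows "P p"
proof (induction p rule: Poly_Mapping.update_induct)
  case const
  show ?case using single[of 0 0] by simp
next
  case (update f a b)
  then have "Poly_Mapping.update a b f = f + Poly_Mapping.single a b"
    by (intro poly_mapping_eqI)
      (auto simp: lookup_update lookup_add lookup_single when_def in_keys_iff)
  with update show ?case using single add by simp
qed

lemma free_const_commute: "free_const c * p = p * free_const c"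
proof (induction p rule: free_algebra_induct)
  case (single k v)
  then show ?case by (simp add: free_const_def mult_single mult.commute)
next
  case (add f g)
  then show ?case by (simp add: distrib_left distrib_right)
qed

lemma lookup_mult_0: "Poly_Mapping.lookup (p * q) 0 = Poly_Mapping.lookup p 0 * Poly_Mapping.lookup q 0"
  for p q :: "'g free_algebra"
proof (induction p rule: free_algebra_induct)
  case (single k v)
  show ?case
  proof (induction q rule: free_algebra_induct)
    case (single k' v')
    then show ?case
      by (auto simp: mult_single lookup_single when_def free_monoid_add_eq_0_iff)
  next
    case (add f g)
    then show ?case by (simp add: distrib_left lookup_add)
  qed
next
  case (add f g)
  then show ?case by (simp add: distrib_right lookup_add)
qed

lemma lookup_free_gen_0: "Poly_Mapping.lookup (free_gen x) 0 = 0"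
  by (simp add: free_gen_def lookup_single when_def zero_free_monoid_def)

lemma uea_ideal_augmentation: "p \<in> uea_ideal \<Longrightarrow> Poly_Mapping.lookup p 0 = 0"
  by (induction rule: uea_ideal.induct)
    (simp_all add: lookup_mult_0 lookup_add lookup_minus lookup_free_gen_0)

instantiation uea :: (complex_lie_algebra) complex_algebra_1
begin

lift_definition zero_uea :: "'a uea" is 0 .
lift_definition one_uea :: "'a uea" is 1 .
lift_definition plus_uea :: "'a uea \<Rightarrow> 'a uea \<Rightarrow> 'a uea" is "(+)"
  by (metis ideal_add add_diff_add)
lift_definition uminus_uea :: "'a uea \<Rightarrow> 'a uea" is uminus
  by (metis ideal_uminus minus_diff_minus)
lift_definition minus_uea :: "'a uea \<Rightarrow> 'a uea \<Rightarrow> 'a uea" is "(-)"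
proof -
  fix p p' q q' :: "'a free_algebra"
  assume "p - p' \<in> uea_ideal" "q - q' \<in> uea_ideal"
  then have "(p - p') - (q - q') \<in> uea_ideal" by (rule ideal_diff)
  then show "p - q - (p' - q') \<in> uea_ideal" by (simp add: algebra_simps)
qed
lift_definition times_uea :: "'a uea \<Rightarrow> 'a uea \<Rightarrow> 'a uea" is "(*)"
proof -
  fix p p' q q' :: "'a free_algebra"
  assume "p - p' \<in> uea_ideal" "q - q' \<in> uea_ideal"
  then have "(p - p') * q + p' * (q - q') \<in> uea_ideal"
    by (intro ideal_add ideal_mult_left ideal_mult_right)
  then show "p * q - p' * q' \<in> uea_ideal" by (simp add: algebra_simps)
qed
lift_definition scaleC_uea :: "complex \<Rightarrow> 'a uea \<Rightarrow> 'a uea" is "\<lambda>c p. free_const c * p"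
  by (metis ideal_mult_left right_diff_distrib)

instance
proof
  fix x y z :: "'a uea" and c d :: complex
  have eq: "p = q \<Longrightarrow> p - q \<in> uea_ideal" for p q :: "'a free_algebra"
    by (simp add: ideal_zero)
  show "x + y + z = x + (y + z)" by transfer (rule eq, simp add: algebra_simps)
  show "x + y = y + x" by transfer (rule eq, simp add: algebra_simps)
  show "0 + x = x" by transfer (rule eq, simp)
  show "- x + x = 0" by transfer (rule eq, simp)
  show "x - y = x + - y" by transfer (rule eq, simp)
  show "x * y * z = x * (y * z)" by transfer (rule eq, simp add: algebra_simps)
  show "1 * x = x" by transfer (rule eq, simp)
  show "x * 1 = x" by transfer (rule eq, simp)
  show "(x + y) * z = x * z + y * z" by transfer (rule eq, simp add: algebra_simps)
  show "x * (y + z) = x * y + x * z" by transfer (rule eq, simp add: algebra_simps)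
  show "(0 :: 'a uea) \<noteq> 1"
    by transfer (auto dest!: uea_ideal_augmentation simp: lookup_minus lookup_one)
  show "c *\<^sub>C (x + y) = c *\<^sub>C x + c *\<^sub>C y"
    by transfer (rule eq, simp add: algebra_simps)
  show "(c + d) *\<^sub>C x = c *\<^sub>C x + d *\<^sub>C x"
    by transfer (rule eq, simp add: algebra_simps free_const_add)
  show "c *\<^sub>C d *\<^sub>C x = (c * d) *\<^sub>C x"
    by transfer (rule eq, simp add: mult.assoc free_const_mult)
  show "1 *\<^sub>C x = x" by transfer (rule eq, simp add: free_const_1)
  show "c *\<^sub>C x * y = c *\<^sub>C (x * y)" by transfer (rule eq, simp add: mult.assoc)
  show "x * c *\<^sub>C y = c *\<^sub>C (x * y)"
    by transfer (rule eq, metis mult.assoc free_const_commute)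
qed

end

lift_definition uea_incl :: "'g::complex_lie_algebra \<Rightarrow> 'g uea" is free_gen .

lemma uea_incl_add: "uea_incl (x + y) = uea_incl x + uea_incl y"
  by transfer (use rel_add in \<open>simp add: diff_diff_eq\<close>)

lemma uea_incl_scaleC: "uea_incl (c *\<^sub>C x) = c *\<^sub>C uea_incl x"
  by transfer (rule rel_scaleC)

lemma uea_incl_bracket:
  "uea_incl (lie_bracket x y) = uea_incl x * uea_incl y - uea_incl y * uea_incl x"
  by (rule sym) (transfer, rule rel_bracket)


section \<open>The even orthogonal Lie algebra\<close>

text \<open>
  The positive integer \<open>n\<close> is \<open>CARD('n)\<close>, and \<^typ>\<open>'n bit0\<close> is the library's type with
  \<open>2 * n\<close> elements \<open>0, \<dots>, 2 * n - 1\<close>; \<open>pos\<close> numbers them by \<open>1, \<dots>, 2 * n\<close>.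
\<close>

definition pos :: "'n::finite bit0 \<Rightarrow> nat" where
  "pos r = Suc (nat (Rep_bit0 r))"

lemma bij_betw_pos: "bij_betw pos (UNIV :: 'n::finite bit0 set) {1..2 * CARD('n)}"
proof (rule bij_betwI')
  fix r s :: "'n bit0"
  have "Rep_bit0 r \<ge> 0" "Rep_bit0 s \<ge> 0" "Rep_bit0 r < 2 * int CARD('n)"
    using Rep_bit0[of r] Rep_bit0[of s] by auto
  then show "pos r = pos s \<longleftrightarrow> r = s" and "pos r \<in> {1..2 * CARD('n)}"
    by (auto simp: pos_def nat_less_iff eq_nat_nat_iff Rep_bit0_inject)
next
  fix i assume i: "i \<in> {1..2 * CARD('n)}"
  show "\<exists>r\<in>UNIV. i = pos (r :: 'n bit0)"
    using i by (intro bexI[of _ "Abs_bit0 (int i - 1)"]) (auto simp: pos_def Abs_bit0_inverse)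
qed

lemma pos_range: "pos (r :: 'n::finite bit0) \<in> {1..2 * CARD('n)}"
  using bij_betw_pos by (rule bij_betw_apply) simp

text \<open>\<open>neg_index n i\<close> is the index written \<open>-i\<close>.\<close>

definition neg_index :: "nat \<Rightarrow> nat \<Rightarrow> nat" where
  "neg_index n i = 2 * n + 1 - i"

definition matrix_unit :: "nat \<Rightarrow> nat \<Rightarrow> complex^('n::finite bit0)^('n bit0)" where
  "matrix_unit i j = (\<chi> r s. if pos r = i \<and> pos s = j then 1 else 0)"

definition antidiag :: "complex^('n::finite bit0)^('n bit0)" where
  "antidiag = (\<chi> r s. if pos s = neg_index CARD('n) (pos r) then 1 else 0)"

typedef 'n o2n =
  "{A :: complex^('n::finite bit0)^('n bit0). transpose A ** antidiag + antidiag ** A = 0}"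
  by (rule exI[of _ 0]) (simp add: matrix_matrix_mult_def transpose_def vec_eq_iff)

setup_lifting type_definition_o2n

definition cmat_scale :: "complex \<Rightarrow> complex^'m^'k \<Rightarrow> complex^'m^'k" where
  "cmat_scale c A = (\<chi> r s. c * A $ r $ s)"

lemma cmat_scale_mult_left: "cmat_scale c A ** B = cmat_scale c (A ** B)"
  by (simp add: cmat_scale_def matrix_matrix_mult_def vec_eq_iff sum_distrib_left mult.assoc)

lemma cmat_scale_mult_right: "A ** cmat_scale c B = cmat_scale c (A ** B)"
  by (simp add: cmat_scale_def matrix_matrix_mult_def vec_eq_iff sum_distrib_left mult.left_commute)

lemma transpose_cmat_scale: "transpose (cmat_scale c A) = cmat_scale c (transpose A)"
  by (simp add: cmat_scale_def transpose_def vec_eq_iff)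

lemma cmat_scale_add: "cmat_scale c (A + B) = cmat_scale c A + cmat_scale c B"
  by (simp add: cmat_scale_def vec_eq_iff distrib_left)

lemma cmat_scale_diff: "cmat_scale c (A - B) = cmat_scale c A - cmat_scale c B"
  by (simp add: cmat_scale_def vec_eq_iff right_diff_distrib)

lemma transpose_add: "transpose (A + B) = transpose A + transpose (B :: complex^'m^'k)"
  by (simp add: transpose_def vec_eq_iff)

lemma transpose_diff: "transpose (A - B) = transpose A - transpose (B :: complex^'m^'k)"
  by (simp add: transpose_def vec_eq_iff)

lemma cmat_add_mult: "(A + B) ** C = A ** C + B ** (C :: complex^'m::finite^'m)"
  by (simp add: matrix_matrix_mult_def vec_eq_iff sum.distrib distrib_right)

lemma cmat_mult_add: "C ** (A + B) = C ** A + C ** (B :: complex^'m::finite^'m)"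
  by (simp add: matrix_matrix_mult_def vec_eq_iff sum.distrib distrib_left)

lemma cmat_diff_mult: "(A - B) ** C = A ** C - B ** (C :: complex^'m::finite^'m)"
  by (simp add: matrix_matrix_mult_def vec_eq_iff sum_subtractf left_diff_distrib)

lemma cmat_mult_diff: "C ** (A - B) = C ** A - C ** (B :: complex^'m::finite^'m)"
  by (simp add: matrix_matrix_mult_def vec_eq_iff sum_subtractf right_diff_distrib)

lemmas cmat_simps = cmat_scale_mult_left cmat_scale_mult_right transpose_cmat_scale
  cmat_scale_add cmat_scale_diff transpose_add transpose_diff
  cmat_add_mult cmat_mult_add cmat_diff_mult cmat_mult_diff

lemma o2n_add_closed:
  assumes "transpose A ** antidiag + antidiag ** A = 0" "transpose B ** antidiag + antidiag ** B = 0"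
  shows "transpose (A + B) ** antidiag + antidiag ** (A + B) = 0"
proof -
  have "transpose (A + B) ** antidiag + antidiag ** (A + B)
      = (transpose A ** antidiag + antidiag ** A) + (transpose B ** antidiag + antidiag ** B)"
    by (simp only: cmat_simps add_ac)
  with assms show ?thesis by simp
qed

lemma o2n_scale_closed:
  assumes "transpose A ** antidiag + antidiag ** A = 0"
  shows "transpose (cmat_scale c A) ** antidiag + antidiag ** cmat_scale c A = 0"
proof -
  have "transpose (cmat_scale c A) ** antidiag + antidiag ** cmat_scale c A
      = cmat_scale c (transpose A ** antidiag + antidiag ** A)"
    by (simp only: cmat_simps)
  with assms show ?thesis by (simp add: cmat_scale_def vec_eq_iff)
qed

lemma cmat_scale_1: "cmat_scale 1 A = A"
  and cmat_scale_uminus_1: "cmat_scale (- 1) A = - A"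
  by (simp_all add: cmat_scale_def vec_eq_iff)

lemma o2n_uminus_closed:
  assumes "transpose A ** antidiag + antidiag ** A = 0"
  shows "transpose (- A) ** antidiag + antidiag ** (- A) = 0"
  using o2n_scale_closed[OF assms, of "- 1"] by (simp add: cmat_scale_uminus_1)

lemma o2n_bracket_closed:
  assumes A: "transpose A ** antidiag + antidiag ** A = 0"
    and B: "transpose B ** antidiag + antidiag ** B = 0"
  shows "transpose (A ** B - B ** A) ** antidiag + antidiag ** (A ** B - B ** A) = 0"
proof -
  have *: "transpose (C ** D) ** antidiag = antidiag ** (D ** C)"
    if "transpose C ** antidiag + antidiag ** C = 0" "transpose D ** antidiag + antidiag ** D = 0"
    for C D :: "complex^('b::finite bit0)^('b bit0)"
  proof -
    have C: "transpose C ** antidiag = cmat_scale (- 1) (antidiag ** C)"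
      and D: "transpose D ** antidiag = cmat_scale (- 1) (antidiag ** D)"
      using that by (simp_all add: cmat_scale_uminus_1 eq_neg_iff_add_eq_0)
    have "transpose (C ** D) ** antidiag = transpose D ** (transpose C ** antidiag)"
      by (simp add: matrix_transpose_mul matrix_mul_assoc)
    also have "\<dots> = cmat_scale (- 1) ((transpose D ** antidiag) ** C)"
      by (simp only: C cmat_simps matrix_mul_assoc)
    also have "\<dots> = cmat_scale (- 1) (cmat_scale (- 1) (antidiag ** (D ** C)))"
      by (simp only: D cmat_simps matrix_mul_assoc)
    also have "\<dots> = antidiag ** (D ** C)"
      by (simp add: cmat_scale_uminus_1)
    finally show ?thesis .
  qed
  show ?thesis
    by (simp add: cmat_simps *[OF A B] *[OF B A])
qed

instantiation o2n :: (finite) complex_lie_algebra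
begin

lift_definition zero_o2n :: "'a o2n" is 0
  by (simp add: matrix_matrix_mult_def transpose_def vec_eq_iff)
lift_definition plus_o2n :: "'a o2n \<Rightarrow> 'a o2n \<Rightarrow> 'a o2n" is "(+)"
  by (rule o2n_add_closed)
lift_definition uminus_o2n :: "'a o2n \<Rightarrow> 'a o2n" is uminus
  by (rule o2n_uminus_closed)
lift_definition minus_o2n :: "'a o2n \<Rightarrow> 'a o2n \<Rightarrow> 'a o2n" is "(-)"
  by (metis o2n_add_closed o2n_uminus_closed diff_conv_add_uminus)
lift_definition scaleC_o2n :: "complex \<Rightarrow> 'a o2n \<Rightarrow> 'a o2n" is cmat_scale
  by (rule o2n_scale_closed)
lift_definition lie_bracket_o2n :: "'a o2n \<Rightarrow> 'a o2n \<Rightarrow> 'a o2n" is "\<lambda>A B. A ** B - B ** A"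
  by (rule o2n_bracket_closed)

instance
proof
  fix x y z :: "'a o2n" and c d :: complex
  show "x + y + z = x + (y + z)" by transfer (rule add.assoc)
  show "x + y = y + x" by transfer (rule add.commute)
  show "0 + x = x" by transfer simp
  show "- x + x = 0" by transfer simp
  show "x - y = x + - y" by transfer simp
  show "c *\<^sub>C (x + y) = c *\<^sub>C x + c *\<^sub>C y" by transfer (rule cmat_scale_add)
  show "(c + d) *\<^sub>C x = c *\<^sub>C x + d *\<^sub>C x"
    by transfer (simp add: cmat_scale_def vec_eq_iff distrib_right)
  show "c *\<^sub>C d *\<^sub>C x = (c * d) *\<^sub>C x"
    by transfer (simp add: cmat_scale_def vec_eq_iff mult.assoc)
  show "1 *\<^sub>C x = x" by transfer (rule cmat_scale_1)
  show "lie_bracket (x + y) z = lie_bracket x z + lie_bracket y z"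
    by transfer (simp add: cmat_simps)
  show "lie_bracket z (x + y) = lie_bracket z x + lie_bracket z y"
    by transfer (simp add: cmat_simps)
  show "lie_bracket (c *\<^sub>C x) y = c *\<^sub>C lie_bracket x y"
    by transfer (simp add: cmat_simps)
  show "lie_bracket x (c *\<^sub>C y) = c *\<^sub>C lie_bracket x y"
    by transfer (simp add: cmat_simps)
  show "lie_bracket x x = 0" by transfer simp
  show "lie_bracket x (lie_bracket y z) + lie_bracket y (lie_bracket z x)
      + lie_bracket z (lie_bracket x y) = 0"
    by transfer (simp add: cmat_simps matrix_mul_assoc)
qed

end

lemma sum_pos_delta:
  "(\<Sum>r\<in>UNIV. if pos (r :: 'n::finite bit0) = i then f (pos r) else 0) =
    (if i \<in> {1..2 * CARD('n)} then f i else (0 :: 'c::comm_monoid_add))"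
proof -
  have "(\<Sum>r\<in>UNIV. if pos (r :: 'n bit0) = i then f (pos r) else 0)
      = (\<Sum>k\<in>{1..2 * CARD('n)}. if k = i then f k else 0)"
    by (rule sum.reindex_bij_betw[OF bij_betw_pos, of "\<lambda>k. if k = i then f k else 0"])
  then show ?thesis by (simp add: sum.delta)
qed

lift_definition o2n_gen :: "nat \<Rightarrow> nat \<Rightarrow> 'n::finite o2n" is
  "\<lambda>i j. matrix_unit i j - matrix_unit (neg_index CARD('n) j) (neg_index CARD('n) i)"
proof -
  fix i j :: nat
  let ?n = "CARD('n)"
  let ?f = "\<lambda>p q. (if p = i \<and> q = j then 1 else 0)
    - (if p = neg_index ?n j \<and> q = neg_index ?n i then 1 else 0 :: complex)"
  let ?M = "matrix_unit i j - matrix_unit (neg_index ?n j) (neg_index ?n i)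
    :: complex^('n bit0)^('n bit0)"
  have M: "?M $ r $ s = ?f (pos r) (pos s)" for r s
    by (simp add: matrix_unit_def)
  have neg_in: "neg_index ?n p \<in> {1..2 * ?n}" if "p \<in> {1..2 * ?n}" for p
    using that by (auto simp: neg_index_def)
  have flip: "neg_index ?n p = neg_index ?n j \<and> q = neg_index ?n i \<longleftrightarrow> neg_index ?n q = i \<and> p = j"
    if "p \<in> {1..2 * ?n}" "q \<in> {1..2 * ?n}" for p q
    using that unfolding neg_index_def atLeastAtMost_iff by linarith
  have "(transpose ?M ** antidiag + antidiag ** ?M) $ r $ s = 0" for r s
  proof -
    have r: "pos r \<in> {1..2 * ?n}" and s: "pos s \<in> {1..2 * ?n}"
      by (rule pos_range)+
    have iff: "pos s = neg_index ?n (pos k) \<longleftrightarrow> pos k = neg_index ?n (pos s)" for k :: "'n bit0"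
      using s pos_range[of k] by (auto simp: neg_index_def)
    have "(transpose ?M ** antidiag) $ r $ s
        = (\<Sum>k\<in>(UNIV :: 'n bit0 set). if pos k = neg_index ?n (pos s) then ?f (pos k) (pos r) else 0)"
      unfolding matrix_matrix_mult_def transpose_def antidiag_def
      by (simp add: M iff del: vector_minus_component) (rule sum.cong, auto)
    also have "\<dots> = ?f (neg_index ?n (pos s)) (pos r)"
      using sum_pos_delta[where 'n = 'n and f = "\<lambda>k. ?f k (pos r)" and i = "neg_index ?n (pos s)"]
        neg_in[OF s] by (simp only: if_True)
    finally have 1: "(transpose ?M ** antidiag) $ r $ s = ?f (neg_index ?n (pos s)) (pos r)" .
    have "(antidiag ** ?M) $ r $ s
        = (\<Sum>k\<in>(UNIV :: 'n bit0 set). if pos k = neg_index ?n (pos r) then ?f (pos k) (pos s) else 0)"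
      unfolding matrix_matrix_mult_def antidiag_def
      by (auto simp: M simp del: vector_minus_component intro!: sum.cong)
    also have "\<dots> = ?f (neg_index ?n (pos r)) (pos s)"
      using sum_pos_delta[where 'n = 'n and f = "\<lambda>k. ?f k (pos s)" and i = "neg_index ?n (pos r)"]
        neg_in[OF r] by (simp only: if_True)
    finally have 2: "(antidiag ** ?M) $ r $ s = ?f (neg_index ?n (pos r)) (pos s)" .
    show ?thesis
      unfolding vector_add_component 1 2 flip[OF r s] flip[OF s r] by simp
  qed
  then show "transpose ?M ** antidiag + antidiag ** ?M = 0"
    by (simp add: vec_eq_iff)
qed

definition X_entry :: "nat \<Rightarrow> nat \<Rightarrow> 'n::finite o2n uea" where
  "X_entry i j = uea_incl (o2n_gen i j)"

definition a_entry :: "nat \<Rightarrow> nat \<Rightarrow> 'n::finite o2n uea" where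
  "a_entry i j = X_entry i j"

definition b_entry :: "nat \<Rightarrow> nat \<Rightarrow> 'n::finite o2n uea" where
  "b_entry i j = X_entry i (neg_index CARD('n) j)"

definition c_entry :: "nat \<Rightarrow> nat \<Rightarrow> 'n::finite o2n uea" where
  "c_entry i j = X_entry (neg_index CARD('n) j) i"


section \<open>Pfaffians, column determinants and signs\<close>

text \<open>
  A matrix of size \<open>m\<close> is a function of two indices of which only the values on \<open>{1..m}\<close>
  matter.  The products below are ordered from left to right.
\<close>

definition pfaffian :: "nat \<Rightarrow> (nat \<Rightarrow> nat \<Rightarrow> 'a::complex_algebra_1) \<Rightarrow> 'a" where
  "pfaffian m A = (1 / (2 ^ m * fact m)) *\<^sub>C
    (\<Sum>\<sigma> | \<sigma> permutes {1..2 * m}.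
      of_int (sign \<sigma>) * (\<Prod>k\<leftarrow>[1..<Suc m]. A (\<sigma> (2 * k - 1)) (\<sigma> (2 * k))))"

definition col_det :: "nat \<Rightarrow> (nat \<Rightarrow> nat \<Rightarrow> 'a::ring_1) \<Rightarrow> 'a" where
  "col_det m \<Phi> =
    (\<Sum>\<sigma> | \<sigma> permutes {1..m}. of_int (sign \<sigma>) * (\<Prod>j\<leftarrow>[1..<Suc m]. \<Phi> (\<sigma> j) j))"

text \<open>\<open>nth_of S s\<close> is the \<open>s\<close>-th smallest element of \<open>S\<close>, counting from 1.\<close>

definition nth_of :: "nat set \<Rightarrow> nat \<Rightarrow> nat" where
  "nth_of S s = sorted_list_of_set S ! (s - 1)"

definition submat :: "(nat \<Rightarrow> nat \<Rightarrow> 'a) \<Rightarrow> nat set \<Rightarrow> nat set \<Rightarrow> nat \<Rightarrow> nat \<Rightarrow> 'a" where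
  "submat A I J s t = A (nth_of I s) (nth_of J t)"

definition id_mat :: "nat \<Rightarrow> nat \<Rightarrow> 'a::zero_neq_one" where
  "id_mat i j = (if i = j then 1 else 0)"

definition rho_mat :: "nat \<Rightarrow> nat \<Rightarrow> nat \<Rightarrow> 'a::ring_1" where
  "rho_mat m s t = (if s = t then of_nat (m - t) else 0)"

definition mat_prod ::
  "nat \<Rightarrow> (nat \<Rightarrow> nat \<Rightarrow> 'a::ring_1) \<Rightarrow> (nat \<Rightarrow> nat \<Rightarrow> 'a) \<Rightarrow> nat \<Rightarrow> nat \<Rightarrow> 'a" where
  "mat_prod m A B s t = (\<Sum>u = 1..m. A s u * B u t)"

text \<open>
  For complementary subsets \<open>S\<close>, \<open>T\<close> of \<open>{1..n}\<close> this is the sign of the permutation whose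
  one-line notation lists \<open>S\<close> increasingly and then \<open>T\<close> increasingly.
\<close>

definition shuffle_sign :: "nat set \<Rightarrow> nat set \<Rightarrow> int" where
  "shuffle_sign S T = sign (\<lambda>i. if i \<in> {1..card S + card T}
    then (sorted_list_of_set S @ sorted_list_of_set T) ! (i - 1) else i)"

end

theory Submission
  imports Defs
begin

text \<open>
  The Pfaffian is read off in an exterior algebra over \<open>U(\<oo>\<^sub>2\<^sub>n)\<close> whose anticommuting generators
  \<open>e\<^sub>1, \<dots>, e\<^sub>2\<^sub>n\<close> commute with the coefficients: the \<open>n\<close>-th divided power of
  \<open>\<Omega> = 1/2 \<Sum> X\<^bsub>i,-j\<^esub> e\<^sub>i e\<^sub>j\<close> is \<open>Pf(X) e\<^sub>1 \<cdots> e\<^sub>2\<^sub>n\<close>.  Write \<open>f\<^sub>i\<close> for the generator with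
  index \<open>-i\<close>.  The blocks of \<open>X\<close> split \<open>\<Omega>\<close> as \<open>E + H + F\<close> with
  \<open>H = \<Sum> a\<^bsub>i,j\<^esub> e\<^sub>i f\<^sub>j\<close>, \<open>F = 1/2 \<Sum> b\<^bsub>i,j\<^esub> e\<^sub>i e\<^sub>j\<close> and \<open>E = -1/2 \<Sum> c\<^bsub>i,j\<^esub> f\<^sub>i f\<^sub>j\<close>.

  The commutation relations of the orthogonal Lie algebra say that, with the central element
  \<open>\<tau> = \<Sum> e\<^sub>i f\<^sub>i\<close>,
  \<open>[H, E] = 2\<tau>E\<close>, \<open>[H, F] = -2\<tau>F\<close> and \<open>[F, E] = \<tau>H\<close>; these are the relations of \<open>\<ss>\<ll>\<^sub>2\<close> rescaled
  by \<open>\<tau>\<close> (lemmas \<open>H_B\<close>, \<open>H_C\<close>, \<open>B_C\<close>).  For any such triple, divided powers of the sum are put in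
  normal order by
  \<open>(E + H + F)\<^sup>m/m! = \<Sum>\<^bsub>l,k\<^esub> (H + (k-l)\<tau>)\<langle>m-l-k\<rangle> E\<^sup>l/l! F\<^sup>k/k!\<close>, where
  \<open>Y\<langle>r\<rangle> = Y (Y + \<tau>) \<cdots> (Y + (r-1)\<tau>) / r!\<close>
  (theorem \<open>dpow_sum\<close>), the algebraic form of a triangular factorisation of \<open>exp (t (E + H + F))\<close>.

  For \<open>m = n\<close> a summand with \<open>l \<noteq> k\<close> would contain more than \<open>n\<close> of the \<open>e\<^sub>i\<close> or more than \<open>n\<close>
  of the \<open>f\<^sub>i\<close> with \<open>i \<le> n\<close>, so it is zero (\<open>normal_term_0\<close>).  In the summands with \<open>l = k\<close>, the
  powers of \<open>E\<close> and \<open>F\<close> expand into the Pfaffians of \<open>c\<^sub>J\<close> and \<open>b\<^sub>I\<close> (\<open>quadratic_form_dpow\<close>).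
  For the remaining factor, \<open>H + u\<tau> = \<Sum> \<eta>\<^sub>j(u) f\<^sub>j\<close> with \<open>\<eta>\<^sub>j(u) = \<Sum>\<^sub>i (a\<^bsub>i,j\<^esub> + u \<delta>\<^bsub>i,j\<^esub>) e\<^sub>i\<close>,
  and \<open>\<eta>\<^sub>i(u+1) \<eta>\<^sub>j(u)\<close> is antisymmetric in \<open>i, j\<close> (\<open>eta_alternate\<close>).  So a product of such linear
  forms with parameters decreasing to \<open>0\<close> is a sum of column determinants with the diagonal shift
  \<open>\<rho>\<close> (\<open>rising_dp_H\<close>).  Reordering the generators contributes the two shuffle signs; all other
  signs cancel (\<open>tri_sign_add_even\<close>).
\<close>

section \<open>Divided powers and normal ordering for rescaled sl2-triples\<close>

interpretation scaleC: vector_space "scaleC :: complex \<Rightarrow> 'a \<Rightarrow> 'a::complex_vector"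
  by unfold_locales (simp_all add: scaleC_add_right scaleC_add_left scaleC_scaleC scaleC_one)

lemma of_nat_eq_scaleC: "(of_nat k :: 'a::complex_algebra_1) = of_nat k *\<^sub>C 1"
  by (induction k) (simp_all add: scaleC_add_left scaleC_one)

lemma of_nat_mult_eq_scaleC: "of_nat k * (x :: 'a::complex_algebra_1) = of_nat k *\<^sub>C x"
  by (simp add: of_nat_eq_scaleC[where 'a='a] mult_scaleC_left)

lemma of_int_eq_scaleC: "(of_int k :: 'a::complex_algebra_1) = of_int k *\<^sub>C 1"
  by (cases k) (simp_all add: of_nat_eq_scaleC[where 'a='a] scaleC_add_left scaleC_one
      scaleC.scale_left_diff_distrib)

lemma of_int_mult_eq_scaleC: "of_int k * (x :: 'a::complex_algebra_1) = of_int k *\<^sub>C x"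
  by (simp add: of_int_eq_scaleC[where 'a='a] mult_scaleC_left)

lemma of_int_mult_left_cancel:
  "k \<noteq> 0 \<Longrightarrow> of_int k * x = of_int k * y \<longleftrightarrow> x = (y :: 'a::complex_algebra_1)"
  by (simp add: of_int_mult_eq_scaleC)

lemma eq_neg_self_imp_0: "x = - x \<Longrightarrow> x = (0 :: 'a::complex_algebra_1)"
  using of_int_mult_left_cancel[of 2 x 0] by (simp add: mult_2 eq_neg_iff_add_eq_0)

lemma of_int_left_commute: "x * (of_int k * y) = of_int k * (x * (y :: 'a::ring_1))"
  by (metis mult.assoc mult_of_int_commute)

lemma of_nat_left_commute: "x * (of_nat k * y) = of_nat k * (x * (y :: 'a::ring_1))"
  using of_int_left_commute[of x "int k" y] by simp

text \<open>
  The divided power \<open>x\<^sup>k / k!\<close>.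
\<close>

definition dpow :: "'a::complex_algebra_1 \<Rightarrow> nat \<Rightarrow> 'a" where
  "dpow x k = (1 / fact k) *\<^sub>C x ^ k"

lemma dpow_0: "dpow x 0 = 1"
  by (simp add: dpow_def)

lemma dpow_mult_self: "dpow x k * x = of_nat (Suc k) * dpow x (Suc k)"
proof -
  have "(of_nat (Suc k) * (1 / fact (Suc k)) :: complex) = 1 / fact k"
    by (simp add: fact_Suc del: of_nat_Suc)
  then show ?thesis
    unfolding dpow_def of_nat_mult_eq_scaleC scaleC.scale_scale mult_scaleC_left
    by (simp add: power_commutes)
qed

lemma dpow_commute: "x * y = y * x \<Longrightarrow> dpow x k * y = y * dpow x k"
  by (simp add: dpow_def mult_scaleC_left mult_scaleC_right power_commuting_commutes)

text \<open>
  The divided rising factorial \<open>Y (Y + \<tau>) \<cdots> (Y + (j-1)\<tau>) / j!\<close> with step \<open>\<tau>\<close>.  The order \<open>j\<close> is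
  an integer and negative orders give \<open>0\<close>, so that the recurrences below hold for all \<open>j\<close>.
\<close>

definition rising_dp :: "'a::complex_algebra_1 \<Rightarrow> 'a \<Rightarrow> int \<Rightarrow> 'a" where
  "rising_dp \<tau> Y j = (if j < 0 then 0
     else (1 / fact (nat j)) *\<^sub>C (\<Prod>i\<leftarrow>[0..<nat j]. Y + of_nat i * \<tau>))"

lemma rising_dp_neg: "j < 0 \<Longrightarrow> rising_dp \<tau> Y j = 0"
  by (simp add: rising_dp_def)

lemma rising_dp_0: "rising_dp \<tau> Y 0 = 1"
  by (simp add: rising_dp_def)

lemma rising_dp_step:
  "of_int (j + 1) * rising_dp \<tau> Y (j + 1) = rising_dp \<tau> Y j * (Y + of_int j * \<tau>)"
proof (cases "j < 0")
  case True
  then show ?thesis by (cases "j = -1") (simp_all add: rising_dp_def)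
next
  case False
  then obtain k where j: "j = int k" by (metis nonneg_int_cases not_less)
  have f: "(of_nat (Suc k) * (1 / fact (Suc k)) :: complex) = 1 / fact k"
    by (simp add: fact_Suc del: of_nat_Suc)
  have n: "nat (int k + 1) = Suc k" by simp
  have "of_int (j + 1) * rising_dp \<tau> Y (j + 1) = of_nat (Suc k) * rising_dp \<tau> Y (j + 1)"
    by (simp add: j add.commute)
  also have "\<dots> = rising_dp \<tau> Y j * (Y + of_int j * \<tau>)"
    unfolding rising_dp_def j n of_nat_mult_eq_scaleC using f
    by (simp add: mult_scaleC_left of_nat_mult_eq_scaleC del: of_nat_Suc)
  finally show ?thesis .
qed

lemma rising_dp_intertwine:
  assumes 1: "E * Y = Z * E" and 2: "E * \<tau> = \<tau> * E"
  shows "E * rising_dp \<tau> Y j = rising_dp \<tau> Z j * E"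
proof -
  have "E * (\<Prod>i\<leftarrow>[0..<k]. Y + of_nat i * \<tau>) = (\<Prod>i\<leftarrow>[0..<k]. Z + of_nat i * \<tau>) * E" for k
  proof (induction k)
    case (Suc k)
    have "E * (Y + of_nat k * \<tau>) = (Z + of_nat k * \<tau>) * E"
      using 1 2 by (simp add: distrib_left distrib_right mult.assoc of_nat_left_commute)
    then show ?case using Suc by (simp add: mult.assoc[symmetric]) (simp add: mult.assoc)
  qed simp
  then show ?thesis
    by (simp add: rising_dp_def mult_scaleC_left mult_scaleC_right)
qed

lemma rising_dp_commute:
  "x * Y = Y * x \<Longrightarrow> x * \<tau> = \<tau> * x \<Longrightarrow> x * rising_dp \<tau> Y j = rising_dp \<tau> Y j * x"
  by (rule rising_dp_intertwine)

lemma rising_dp_step_left: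
  assumes "\<tau> * Y = Y * \<tau>"
  shows "of_int (j + 1) * rising_dp \<tau> Y (j + 1) = Y * rising_dp \<tau> (Y + \<tau>) j"
proof (cases "j < 0")
  case True
  then show ?thesis by (cases "j = -1") (simp_all add: rising_dp_def)
next
  case False
  then have "0 \<le> j" by simp
  then show ?thesis
  proof (induction j rule: int_ge_induct)
    case base
    show ?case using rising_dp_step[of 0 \<tau> Y] by (simp add: rising_dp_0)
  next
    case (step j)
    let ?R = "rising_dp \<tau>"
    have "of_int (j + 1) * (of_int (j + 1 + 1) * ?R Y (j + 1 + 1))
        = (of_int (j + 1) * ?R Y (j + 1)) * (Y + of_int (j + 1) * \<tau>)"
      by (subst rising_dp_step) (simp only: mult.assoc)
    also have "\<dots> = Y * (?R (Y + \<tau>) j * ((Y + \<tau>) + of_int j * \<tau>))"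
      by (simp only: step.IH mult.assoc) (simp add: algebra_simps)
    also have "\<dots> = of_int (j + 1) * (Y * ?R (Y + \<tau>) (j + 1))"
      by (simp only: rising_dp_step[symmetric] of_int_left_commute)
    finally show ?case using step.hyps by (subst (asm) of_int_mult_left_cancel) auto
  qed
qed

lemma rising_dp_shift:
  assumes "\<tau> * Y = Y * \<tau>"
  shows "rising_dp \<tau> (Y + \<tau>) j = rising_dp \<tau> Y j + \<tau> * rising_dp \<tau> (Y + \<tau>) (j - 1)"
proof (cases "j = 0")
  case False
  let ?R = "rising_dp \<tau>"
  have comm: "?R (Y + \<tau>) i * \<tau> = \<tau> * ?R (Y + \<tau>) i" "?R (Y + \<tau>) i * Y = Y * ?R (Y + \<tau>) i" for i
    by (rule rising_dp_commute[symmetric]; simp add: algebra_simps assms)+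
  have "of_int j * ?R (Y + \<tau>) j = ?R (Y + \<tau>) (j - 1) * (Y + of_int j * \<tau>)"
    using rising_dp_step[of "j - 1" \<tau> "Y + \<tau>"] by (simp add: algebra_simps)
  also have "\<dots> = Y * ?R (Y + \<tau>) (j - 1) + of_int j * (\<tau> * ?R (Y + \<tau>) (j - 1))"
    by (simp only: distrib_left comm of_int_left_commute)
  also have "Y * ?R (Y + \<tau>) (j - 1) = of_int j * ?R Y j"
    using rising_dp_step_left[OF assms, of "j - 1"] by simp
  finally show ?thesis
    using False by (simp add: distrib_left[symmetric] of_int_mult_left_cancel)
qed (simp add: rising_dp_0 rising_dp_neg)

text \<open>
  The induction step of the normal ordering theorem for one monomial \<open>E\<^sup>p F\<^sup>q\<close>, with
  \<open>Y = H + (q-p)\<tau>\<close>: the summands on the left come, in this order, from right multiplication by \<open>F\<close>,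
  from right multiplication by \<open>H\<close>, from moving \<open>E\<close> past a power of \<open>F\<close>, and from the commutators
  picked up on the way.
\<close>

lemma rising_dp_recurrence:
  fixes \<tau> Y :: "'a::complex_algebra_1" and N q p :: int
  assumes c: "\<tau> * Y = Y * \<tau>"
  shows "of_int q * rising_dp \<tau> (Y - \<tau>) N + rising_dp \<tau> Y (N - 1) * (Y + of_int (q - p) * \<tau>)
      + of_int p * rising_dp \<tau> (Y + \<tau>) N
      + \<tau> * rising_dp \<tau> (Y + \<tau>) (N - 2) * (Y - of_int p * \<tau>)
    = of_int (N + p + q) * rising_dp \<tau> Y N"
proof -
  let ?R = "rising_dp \<tau>"
  let ?x = "\<tau> * ?R Y (N - 1)"
  have comm: "?R (Y + \<tau>) i * \<tau> = \<tau> * ?R (Y + \<tau>) i" "?R (Y + \<tau>) i * Y = Y * ?R (Y + \<tau>) i" 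
    "?R Y i * \<tau> = \<tau> * ?R Y i" for i
    by (rule rising_dp_commute[symmetric]; simp add: algebra_simps assms)+
  have a: "?R (Y - \<tau>) N = ?R Y N - ?x"
    using rising_dp_shift[of \<tau> "Y - \<tau>" N] c by (simp add: algebra_simps)
  have b: "?R Y (N - 1) * (Y + of_int (q - p) * \<tau>) = of_int N * ?R Y N
      + of_int (q - p - N + 1) * ?x"
  proof -
    have "?R Y (N - 1) * (Y + of_int (q - p) * \<tau>)
        = ?R Y (N - 1) * (Y + of_int (N - 1) * \<tau>) + ?R Y (N - 1) * (of_int (q - p - N + 1) * \<tau>)"
      by (simp add: algebra_simps)
    also have "?R Y (N - 1) * (Y + of_int (N - 1) * \<tau>) = of_int N * ?R Y N"
      using rising_dp_step[of "N - 1" \<tau> Y] by simp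
    also have "?R Y (N - 1) * (of_int (q - p - N + 1) * \<tau>) = of_int (q - p - N + 1) * ?x"
      by (simp only: comm of_int_left_commute)
    finally show ?thesis .
  qed
  have d: "\<tau> * ?R (Y + \<tau>) (N - 2) * (Y - of_int p * \<tau>)
      = of_int (N - 1) * ?x - of_int p * (\<tau> * (\<tau> * ?R (Y + \<tau>) (N - 2)))"
  proof -
    have "\<tau> * ?R (Y + \<tau>) (N - 2) * (Y - of_int p * \<tau>)
      = \<tau> * (Y * ?R (Y + \<tau>) (N - 2)) - \<tau> * (?R (Y + \<tau>) (N - 2) * (of_int p * \<tau>))"
      by (simp add: right_diff_distrib mult.assoc comm)
    also have "Y * ?R (Y + \<tau>) (N - 2) = of_int (N - 1) * ?R Y (N - 1)"
      using rising_dp_step_left[OF c, of "N - 2"] by simp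
    also have "\<tau> * (of_int (N - 1) * ?R Y (N - 1)) = of_int (N - 1) * ?x"
      by (simp only: of_int_left_commute)
    also have "\<tau> * (?R (Y + \<tau>) (N - 2) * (of_int p * \<tau>))
        = of_int p * (\<tau> * (\<tau> * ?R (Y + \<tau>) (N - 2)))"
      by (simp only: comm of_int_left_commute)
    finally show ?thesis .
  qed
  have e1: "?R (Y + \<tau>) N = ?R Y N + \<tau> * ?R (Y + \<tau>) (N - 1)"
    by (rule rising_dp_shift[OF c])
  have e2: "?R (Y + \<tau>) (N - 1) = ?R Y (N - 1) + \<tau> * ?R (Y + \<tau>) (N - 2)"
    using rising_dp_shift[OF c, of "N - 1"] by simp
  have e: "?R (Y + \<tau>) N = ?R Y N + ?x + \<tau> * (\<tau> * ?R (Y + \<tau>) (N - 2))"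
    by (simp add: e1 e2 distrib_left add.assoc)
  show ?thesis
    unfolding a b d e by (simp add: algebra_simps)
qed

lemma sum_atMost_shift:
  "g 0 = (0 :: 'b::comm_monoid_add) \<Longrightarrow> (\<Sum>k\<le>m. g (Suc k)) = (\<Sum>k\<le>Suc m. g k)"
  by (simp only: sum.atMost_Suc_shift) simp

text \<open>
  The relations of \<open>\<ss>\<ll>\<^sub>2\<close> with the structure constants multiplied by a central element \<open>\<tau>\<close>; \<open>\<tau>\<close> may
  be nilpotent, so it cannot be divided out.
\<close>

locale scaled_sl2 =
  fixes E F H \<tau> :: "'a::complex_algebra_1"
  assumes E_H: "E * H = (H - 2 * \<tau>) * E"
    and F_H: "F * H = (H + 2 * \<tau>) * F"
    and F_E: "F * E = E * F + \<tau> * H"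
    and tau_E: "\<tau> * E = E * \<tau>" and tau_F: "\<tau> * F = F * \<tau>" and tau_H: "\<tau> * H = H * \<tau>"
begin

lemma E_weight: "E * (H + of_int c * \<tau>) = (H + of_int (c - 2) * \<tau>) * E"
  by (simp add: E_H tau_E distrib_left distrib_right left_diff_distrib mult.assoc
      of_int_left_commute)

lemma F_weight: "F * (H + of_int c * \<tau>) = (H + of_int (c + 2) * \<tau>) * F"
  by (simp add: F_H tau_F distrib_left distrib_right left_diff_distrib mult.assoc
      of_int_left_commute)

lemma dpow_E_weight: "dpow E l * (H + of_int c * \<tau>) = (H + of_int (c - 2 * int l) * \<tau>) * dpow E l"
proof -
  have "E ^ l * (H + of_int c * \<tau>) = (H + of_int (c - 2 * int l) * \<tau>) * E ^ l" for c
  proof (induction l arbitrary: c)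
    case (Suc l)
    have "E ^ Suc l * (H + of_int c * \<tau>) = E ^ l * (E * (H + of_int c * \<tau>))"
      by (simp only: power_Suc2 mult.assoc)
    also have "\<dots> = (H + of_int (c - 2 - 2 * int l) * \<tau>) * E ^ l * E"
      by (simp only: E_weight mult.assoc[symmetric] Suc)
    finally show ?case by (simp add: power_commutes mult.assoc diff_diff_eq)
  qed simp
  then show ?thesis by (simp add: dpow_def mult_scaleC_left mult_scaleC_right)
qed

lemma dpow_F_weight: "dpow F k * (H + of_int c * \<tau>) = (H + of_int (c + 2 * int k) * \<tau>) * dpow F k"
proof -
  have "F ^ k * (H + of_int c * \<tau>) = (H + of_int (c + 2 * int k) * \<tau>) * F ^ k" for c
  proof (induction k arbitrary: c)
    case (Suc k)
    have "F ^ Suc k * (H + of_int c * \<tau>) = F ^ k * (F * (H + of_int c * \<tau>))"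
      by (simp only: power_Suc2 mult.assoc)
    also have "\<dots> = (H + of_int (c + 2 + 2 * int k) * \<tau>) * F ^ k * F"
      by (simp only: F_weight mult.assoc[symmetric] Suc)
    finally show ?case by (simp add: power_commutes mult.assoc add.assoc)
  qed simp
  then show ?thesis by (simp add: dpow_def mult_scaleC_left mult_scaleC_right)
qed

lemma dpow_F_E: "dpow F (Suc k) * E = E * dpow F (Suc k) + \<tau> * (H + of_int (int k) * \<tau>) * dpow F k"
proof -
  have "F ^ Suc k * E = E * F ^ Suc k + of_int (int k + 1) * (\<tau> * (H + of_int (int k) * \<tau>) * F ^ k)"
      for k
  proof (induction k)
    case (Suc k)
    have 1: "F * (\<tau> * (H + of_int (int k) * \<tau>) * F ^ k) = \<tau> * (H + of_int (int k + 2) * \<tau>)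
        * F ^ Suc k"
    proof -
      have "F * (\<tau> * (H + of_int (int k) * \<tau>) * F ^ k) = \<tau> * (F * (H + of_int (int k) * \<tau>)) * F ^ k"
        by (metis mult.assoc tau_F)
      then show ?thesis by (simp only: F_weight) (simp only: mult.assoc power_Suc)
    qed
    have "F ^ Suc (Suc k) * E = F * (F ^ Suc k * E)" by (simp add: mult.assoc)
    also have "\<dots> = F * E * F ^ Suc k + of_int (int k + 1)
        * (F * (\<tau> * (H + of_int (int k) * \<tau>) * F ^ k))"
      by (simp only: Suc distrib_left of_int_left_commute mult.assoc)
    also have "\<dots> = E * F ^ Suc (Suc k) + (\<tau> * H + of_int (int k + 1)
        * (\<tau> * (H + of_int (int k + 2) * \<tau>))) * F ^ Suc k"
      unfolding 1 F_E by (simp add: distrib_right mult.assoc)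
    also have "\<tau> * H + of_int (int k + 1) * (\<tau> * (H + of_int (int k + 2) * \<tau>))
        = of_int (int k + 2) * (\<tau> * (H + of_int (int k + 1) * \<tau>))"
      unfolding distrib_left[of \<tau>] of_int_left_commute[of \<tau>] by (simp add: algebra_simps mult_2)
    finally show ?case by (simp add: mult.assoc add.commute)
  qed (simp add: F_E)
  note * = this[of k]
  have "of_int (int k + 1) = (of_nat (Suc k) :: complex)" by simp
  then have f: "1 / fact (Suc k) * (of_int (int k + 1) :: complex) = 1 / fact k"
    by (simp only: fact_Suc) (simp del: of_nat_Suc)
  show ?thesis
    unfolding dpow_def mult_scaleC_left mult_scaleC_right * of_int_mult_eq_scaleC[of "int k + 1"]
      scaleC.scale_right_distrib scaleC.scale_scale f ..
qed

text \<open>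
  The normally ordered monomials \<open>E\<^sup>l/l! F\<^sup>k/k!\<close>.
\<close>

definition D :: "nat \<Rightarrow> nat \<Rightarrow> 'a" where "D l k = dpow E l * dpow F k"

lemma D_F: "D l k * F = of_int (int k + 1) * D l (Suc k)"
proof -
  have "D l k * F = dpow E l * (of_nat (Suc k) * dpow F (Suc k))"
    by (simp only: D_def mult.assoc dpow_mult_self)
  moreover have "of_int (int k + 1) = (of_nat (Suc k) :: 'a)" by simp
  ultimately show ?thesis by (simp only: D_def of_nat_left_commute)
qed

lemma D_H: "D l k * H = (H + of_int (2 * (int k - int l)) * \<tau>) * D l k"
proof -
  have "D l k * H = dpow E l * (dpow F k * (H + of_int 0 * \<tau>))"
    by (simp add: D_def mult.assoc)
  also have "\<dots> = (H + of_int (2 * int k - 2 * int l) * \<tau>) * D l k"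
    unfolding dpow_F_weight mult.assoc[symmetric] dpow_E_weight by (simp add: D_def mult.assoc)
  finally show ?thesis by (simp add: right_diff_distrib)
qed

lemma dpow_E_E: "dpow E l * E = of_int (int l + 1) * dpow E (Suc l)"
  by (simp add: dpow_mult_self add.commute)

lemma D_E_0: "D l 0 * E = of_int (int l + 1) * D (Suc l) 0"
  by (simp only: D_def dpow_0 mult_1_right dpow_E_E)

lemma D_E_Suc: "D l (Suc k) * E = of_int (int l + 1) * D (Suc l) (Suc k)
    + \<tau> * (H + of_int (int k - 2 * int l) * \<tau>) * D l k"
proof -
  have t: "dpow E l * \<tau> = \<tau> * dpow E l" by (rule dpow_commute) (simp add: tau_E)
  have "D l (Suc k) * E = dpow E l * E * dpow F (Suc k)
      + dpow E l * \<tau> * (H + of_int (int k) * \<tau>) * dpow F k"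
    unfolding D_def mult.assoc dpow_F_E by (subst distrib_left) (simp only: mult.assoc)
  also have "dpow E l * \<tau> * (H + of_int (int k) * \<tau>) * dpow F k
      = \<tau> * (dpow E l * (H + of_int (int k) * \<tau>)) * dpow F k"
    by (simp only: t mult.assoc)
  finally show ?thesis
    by (simp only: dpow_E_E dpow_E_weight) (simp only: mult.assoc D_def)
qed

abbreviation Ris :: "int \<Rightarrow> int \<Rightarrow> 'a" where
  "Ris j c \<equiv> rising_dp \<tau> (H + of_int c * \<tau>) j"

lemma tau_weight: "\<tau> * (H + of_int c * \<tau>) = (H + of_int c * \<tau>) * \<tau>"
  by (simp add: distrib_left distrib_right tau_H of_int_left_commute mult.assoc)

lemma tau_Ris: "\<tau> * Ris j c = Ris j c * \<tau>"
  by (rule rising_dp_commute) (simp_all add: tau_weight)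

text \<open>
  Normal ordering of the divided powers of \<open>E + H + F\<close>.  The summands with \<open>l + k > m\<close> vanish, as
  \<open>Ris\<close> has negative order there.
\<close>

theorem dpow_sum:
  "dpow (E + H + F) m = (\<Sum>l\<le>m. \<Sum>k\<le>m. Ris (int m - int l - int k) (int k - int l) * D l k)"
proof (induction m)
  case 0
  show ?case by (simp add: dpow_0 rising_dp_0 D_def)
next
  case (Suc m)
  define N where "N p q = int m + 1 - int p - int q" for p q
  \<comment> \<open>\<open>N p q\<close> is the order belonging to \<open>D p q\<close> in degree \<open>m + 1\<close>.  Right multiplication of the
    sum by \<open>F\<close> and \<open>H\<close> produces the coefficients \<open>g1\<close> and \<open>g2\<close>, and multiplication by \<open>E\<close>
    produces \<open>g3\<close> and \<open>g4\<close>.\<close>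
  define g1 where "g1 p q = of_int (int q) * (Ris (N p q) (int q - int p - 1) * D p q)" for p q
  define g2 where "g2 p q = Ris (N p q - 1) (int q - int p)
    * ((H + of_int (2 * (int q - int p)) * \<tau>) * D p q)" for p q
  define g3 where "g3 p q = of_int (int p) * (Ris (N p q) (int q - int p + 1) * D p q)" for p q
  define g4 where "g4 p q = Ris (N p q - 2) (int q - int p + 1)
    * (\<tau> * (H + of_int (int q - 2 * int p) * \<tau>) * D p q)" for p q
  define R where "R l k = Ris (int m - int l - int k) (int k - int l) * D l k" for l k
  have RF: "R l k * F = g1 l (Suc k)" for l k
    unfolding R_def g1_def mult.assoc D_F of_int_left_commute N_def by (simp add: algebra_simps)
  have RH: "R l k * H = g2 l k" for l k
    unfolding R_def g2_def mult.assoc D_H N_def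
      by (simp add: diff_diff_eq add.commute add.left_commute)
  have RE: "R l k * E = g3 (Suc l) k + (case k of 0 \<Rightarrow> 0 | Suc k' \<Rightarrow> g4 l k')" for l k
  proof (cases k)
    case 0
    show ?thesis unfolding 0 R_def g3_def mult.assoc D_E_0 of_int_left_commute N_def
      by (simp add: algebra_simps)
  next
    case (Suc k')
    show ?thesis
      unfolding Suc R_def g3_def g4_def mult.assoc D_E_Suc distrib_left of_int_left_commute N_def
      by (simp add: algebra_simps)
  qed
  have g1_0: "g1 p 0 = 0" for p by (simp add: g1_def)
  have g1_z: "g1 (Suc m) q = 0" for q
    by (cases q) (simp_all add: g1_def N_def rising_dp_neg)
  have g3_0: "g3 0 q = 0" for q by (simp add: g3_def)
  have g3_z: "g3 p (Suc m) = 0" for p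
    by (cases p) (simp_all add: g3_def N_def rising_dp_neg)
  have g2_z: "g2 (Suc m) q = 0" "g2 p (Suc m) = 0" for p q
    by (simp_all add: g2_def N_def rising_dp_neg)
  have g4_z: "g4 (Suc m) q = 0" "g4 p (Suc m) = 0" "g4 p m = 0" for p q
    by (simp_all add: g4_def N_def rising_dp_neg)
  \<comment> \<open>All boundary terms vanish, so each of the four sums runs over the same square.\<close>
  have s1: "(\<Sum>l\<le>m. \<Sum>k\<le>m. R l k * F) = (\<Sum>p\<le>Suc m. \<Sum>q\<le>Suc m. g1 p q)"
    unfolding RF sum_atMost_shift[of "g1 _", OF g1_0] by (simp add: g1_z)
  have s2: "(\<Sum>l\<le>m. \<Sum>k\<le>m. R l k * H) = (\<Sum>p\<le>Suc m. \<Sum>q\<le>Suc m. g2 p q)"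
    unfolding RH by (simp add: g2_z)
  have s3: "(\<Sum>l\<le>m. \<Sum>k\<le>m. g3 (Suc l) k) = (\<Sum>p\<le>Suc m. \<Sum>q\<le>Suc m. g3 p q)"
    using sum_atMost_shift[of "\<lambda>p. \<Sum>q\<le>m. g3 p q" m] by (simp add: g3_0 g3_z)
  have c: "(\<Sum>k\<le>m. case k of 0 \<Rightarrow> 0 | Suc k' \<Rightarrow> g4 l k') = (\<Sum>q\<le>Suc m. g4 l q)" for l
  proof (cases m)
    case 0
    then show ?thesis using g4_z(2,3)[of l] by simp
  next
    case (Suc m')
    have "(\<Sum>k\<le>m. case k of 0 \<Rightarrow> 0 | Suc k' \<Rightarrow> g4 l k') = (\<Sum>k\<le>m'. g4 l k)"
      unfolding Suc by (simp only: sum.atMost_Suc_shift) simp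
    also have "\<dots> = (\<Sum>q\<le>Suc m. g4 l q)"
      using g4_z(2,3)[of l] by (simp add: Suc)
    finally show ?thesis .
  qed
  have s4: "(\<Sum>l\<le>m. \<Sum>k\<le>m. case k of 0 \<Rightarrow> 0 | Suc k' \<Rightarrow> g4 l k') = (\<Sum>p\<le>Suc m. \<Sum>q\<le>Suc m. g4 p q)"
    unfolding c by (simp add: g4_z)
  have point: "g1 p q + g2 p q + g3 p q + g4 p q
      = of_nat (Suc m) * (Ris (int (Suc m) - int p - int q) (int q - int p) * D p q)" for p q
  proof -
    let ?Y = "H + of_int (int q - int p) * \<tau>"
    have y: "?Y - \<tau> = H + of_int (int q - int p - 1) * \<tau>" "?Y + \<tau>
        = H + of_int (int q - int p + 1) * \<tau>"
      "?Y + of_int (int q - int p) * \<tau> = H + of_int (2 * (int q - int p)) * \<tau>"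
      "?Y - of_int (int p) * \<tau> = H + of_int (int q - 2 * int p) * \<tau>"
      by (simp_all add: algebra_simps mult_2)
    have "g1 p q + g2 p q + g3 p q + g4 p q
      = (of_int (int q) * rising_dp \<tau> (?Y - \<tau>) (N p q) + Ris (N p q - 1) (int q - int p)
          * (?Y + of_int (int q - int p) * \<tau>)
      + of_int (int p) * rising_dp \<tau> (?Y + \<tau>) (N p q)
      + \<tau> * rising_dp \<tau> (?Y + \<tau>) (N p q - 2) * (?Y - of_int (int p) * \<tau>)) * D p q"
      unfolding y tau_Ris g1_def g2_def g3_def g4_def by (simp only: distrib_right mult.assoc)
    also have "\<dots> = of_int (N p q + int p + int q) * Ris (N p q) (int q - int p) * D p q"
      by (subst rising_dp_recurrence[OF tau_weight]) (rule refl)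
    finally show ?thesis by (simp add: N_def mult.assoc add.commute)
  qed
  have "of_int (int (Suc m)) * dpow (E + H + F) (Suc m) = dpow (E + H + F) m * (E + H + F)"
    by (simp only: dpow_mult_self of_int_of_nat_eq)
  also have "\<dots> = (\<Sum>l\<le>m. \<Sum>k\<le>m. R l k * (E + H + F))"
    by (simp add: Suc R_def sum_distrib_right)
  also have "\<dots> = (\<Sum>l\<le>m. \<Sum>k\<le>m. R l k * F) + (\<Sum>l\<le>m. \<Sum>k\<le>m. R l k * H)
      + (\<Sum>l\<le>m. \<Sum>k\<le>m. g3 (Suc l) k) + (\<Sum>l\<le>m. \<Sum>k\<le>m. case k of 0 \<Rightarrow> 0 | Suc k' \<Rightarrow> g4 l k')"
    unfolding distrib_left RE by (simp add: sum.distrib add_ac)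
  also have "\<dots> = (\<Sum>p\<le>Suc m. \<Sum>q\<le>Suc m. g1 p q + g2 p q + g3 p q + g4 p q)"
    unfolding s1 s2 s3 s4 by (simp only: sum.distrib)
  also have "\<dots> = of_int (int (Suc m)) * (\<Sum>p\<le>Suc m. \<Sum>q\<le>Suc m. Ris (int (Suc m) - int p - int q)
      (int q - int p) * D p q)"
    unfolding point by (simp only: sum_distrib_left of_int_of_nat_eq)
  finally show ?case
    by (subst (asm) of_int_mult_left_cancel) (simp_all del: sum.atMost_Suc)
qed

end

section \<open>The exterior algebra over a noncommutative algebra\<close>

text \<open>
  The exterior algebra on generators indexed by all natural numbers, with coefficients in a possibly
  noncommutative algebra that commute with the generators.  An element is given by its coefficients
  at the increasing products of the generators with indices in \<open>S\<close>, for finite \<open>S\<close>; infinitely many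
  coefficients may be nonzero, which is harmless because each coefficient of a product is a finite
  sum.
\<close>

typedef (overloaded) 'a exterior = "{f :: nat set \<Rightarrow> 'a::zero. \<forall>S. infinite S \<longrightarrow> f S = 0}"
  morphisms coef Abs_exterior
  by (rule exI[of _ "\<lambda>_. 0"]) simp

setup_lifting type_definition_exterior

lemma coef_infinite: "infinite S \<Longrightarrow> coef f S = 0"
  using coef[of f] by simp

lemma exterior_eqI: "(\<And>S. finite S \<Longrightarrow> coef f S = coef g S) \<Longrightarrow> f = g"
  by (metis coef_inject coef_infinite ext)

text \<open>
  For disjoint \<open>S\<close> and \<open>T\<close>, sorting the product of the increasing products over \<open>S\<close> and over \<open>T\<close>
  takes \<open>crossings S T\<close> interchanges of neighbours, which results in the sign \<open>merge_sign S T\<close>.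
\<close>

definition crossings :: "nat set \<Rightarrow> nat set \<Rightarrow> nat" where
  "crossings S T = card {(s, t). s \<in> S \<and> t \<in> T \<and> t < s}"

definition merge_sign :: "nat set \<Rightarrow> nat set \<Rightarrow> 'a::ring_1" where
  "merge_sign S T = (- 1) ^ crossings S T"

lemma merge_sign_empty: "merge_sign {} T = 1" "merge_sign S {} = 1"
  by (simp_all add: merge_sign_def crossings_def)

lemma finite_crossings: "finite S \<Longrightarrow> finite T \<Longrightarrow> finite {(s, t). s \<in> S \<and> t \<in> T \<and> t < (s :: nat)}"
  by (rule finite_subset[of _ "S \<times> T"]) auto

lemma merge_sign_Un_left:
  assumes "finite S" "finite S'" "finite T" "S \<inter> S' = {}"
  shows "merge_sign (S \<union> S') T = merge_sign S T * merge_sign S' T"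
proof -
  have "{(s, t). s \<in> S \<union> S' \<and> t \<in> T \<and> t < s}
      = {(s, t). s \<in> S \<and> t \<in> T \<and> t < s} \<union> {(s, t). s \<in> S' \<and> t \<in> T \<and> t < s}" by auto
  with assms have "crossings (S \<union> S') T = crossings S T + crossings S' T"
    unfolding crossings_def by (subst card_Un_disjoint[symmetric]) (auto intro: finite_crossings)
  then show ?thesis by (simp add: merge_sign_def power_add)
qed

lemma merge_sign_Un_right:
  assumes "finite S" "finite T" "finite T'" "T \<inter> T' = {}"
  shows "merge_sign S (T \<union> T') = merge_sign S T * merge_sign S T'"
proof -
  have "{(s, t). s \<in> S \<and> t \<in> T \<union> T' \<and> t < s}
      = {(s, t). s \<in> S \<and> t \<in> T \<and> t < s} \<union> {(s, t). s \<in> S \<and> t \<in> T' \<and> t < s}" by auto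
  with assms have "crossings S (T \<union> T') = crossings S T + crossings S T'"
    unfolding crossings_def by (subst card_Un_disjoint[symmetric]) (auto intro: finite_crossings)
  then show ?thesis by (simp add: merge_sign_def power_add)
qed

instantiation exterior :: (complex_algebra_1) complex_algebra_1
begin

lift_definition zero_exterior :: "'a exterior" is "\<lambda>S. 0" by simp
lift_definition one_exterior :: "'a exterior" is "\<lambda>S. if S = {} then 1 else 0" by auto
lift_definition plus_exterior :: "'a exterior \<Rightarrow> 'a exterior \<Rightarrow> 'a exterior" is
  "\<lambda>f g S. f S + g S" by simp
lift_definition uminus_exterior :: "'a exterior \<Rightarrow> 'a exterior" is "\<lambda>f S. - f S" by simp
lift_definition minus_exterior :: "'a exterior \<Rightarrow> 'a exterior \<Rightarrow> 'a exterior" is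
  "\<lambda>f g S. f S - g S" by simp
lift_definition scaleC_exterior :: "complex \<Rightarrow> 'a exterior \<Rightarrow> 'a exterior" is
  "\<lambda>c f S. c *\<^sub>C f S" by simp
lift_definition times_exterior :: "'a exterior \<Rightarrow> 'a exterior \<Rightarrow> 'a exterior" is
  "\<lambda>f g S. \<Sum>T\<in>Pow S. merge_sign T (S - T) * (f T * g (S - T))"
  by (simp add: finite_Pow_iff)

lemma coef_mult: "coef (f * g) S = (\<Sum>T\<in>Pow S. merge_sign T (S - T) * (coef f T * coef g (S - T)))"
  by (simp add: times_exterior.rep_eq)

text \<open>
  Both sides are sums over the ordered partitions of \<open>S\<close> into three parts; the signs agree because
  \<open>merge_sign\<close> is multiplicative in each argument.
\<close>

lemma exterior_mult_assoc: "(f * g) * h = f * (g * h :: 'a exterior)"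
proof (rule exterior_eqI)
  fix S :: "nat set" assume S: "finite S"
  have "coef (f * g * h) S = (\<Sum>U\<in>Pow S. \<Sum>T\<in>Pow U. merge_sign U (S - U)
      * (merge_sign T (U - T) * (coef f T * coef g (U - T)) * coef h (S - U)))"
    by (simp add: coef_mult sum_distrib_left sum_distrib_right)
  also have "\<dots> = (\<Sum>(U, T)\<in>Sigma (Pow S) Pow. merge_sign U (S - U)
      * (merge_sign T (U - T) * (coef f T * coef g (U - T)) * coef h (S - U)))"
    using S by (intro sum.Sigma) (auto intro: finite_subset)
  also have "\<dots> = (\<Sum>(T, V)\<in>Sigma (Pow S) (\<lambda>T. Pow (S - T)). merge_sign (T \<union> V) (S - T - V)
      * (merge_sign T V * (coef f T * coef g V) * coef h (S - T - V)))"
    by (rule sum.reindex_bij_witness[of _ "\<lambda>(T, V). (T \<union> V, T)" "\<lambda>(U, T). (T, U - T)"])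
      (auto intro!: arg_cong2[of _ _ _ _ "(*)"] arg_cong2[of _ _ _ _ merge_sign]
          arg_cong[of _ _ "coef g"] arg_cong[of _ _ "coef h"])
  also have "\<dots> = (\<Sum>(T, V)\<in>Sigma (Pow S) (\<lambda>T. Pow (S - T)). merge_sign T (S - T)
      * (coef f T * (merge_sign V (S - T - V) * (coef g V * coef h (S - T - V)))))"
  proof (rule sum.cong[OF refl], clarify)
    fix T V assume TV: "T \<subseteq> S" "V \<subseteq> S - T"
    have fin: "finite T" "finite V" "finite (S - T - V)"
      using S TV by (auto intro: finite_subset)
    have "merge_sign (T \<union> V) (S - T - V)
        = (merge_sign T (S - T - V) * merge_sign V (S - T - V) :: 'a)"
      using fin TV by (intro merge_sign_Un_left) auto
    moreover have "merge_sign T (S - T) = (merge_sign T V * merge_sign T (S - T - V) :: 'a)"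
      using merge_sign_Un_right[of T V "S - T - V", where 'a='a] fin TV
      by (simp add: Un_absorb1)
    ultimately show "merge_sign (T \<union> V) (S - T - V) * (merge_sign T V * (coef f T * coef g V)
        * coef h (S - T - V))
      = merge_sign T (S - T)
          * (coef f T * (merge_sign V (S - T - V) * (coef g V * coef h (S - T - V))))"
      by (simp add: merge_sign_def minus_one_power_iff mult.assoc)
  qed
  also have "\<dots> = (\<Sum>T\<in>Pow S. \<Sum>V\<in>Pow (S - T). merge_sign T (S - T)
      * (coef f T * (merge_sign V (S - T - V) * (coef g V * coef h (S - T - V)))))"
    using S by (intro sum.Sigma[symmetric]) (auto intro: finite_subset)
  also have "\<dots> = coef (f * (g * h)) S"
    by (simp add: coef_mult sum_distrib_left)
  finally show "coef (f * g * h) S = coef (f * (g * h)) S" .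
qed

instance
proof
  fix f g h :: "'a exterior" and c d :: complex
  show "f + g + h = f + (g + h)" by transfer (simp add: add.assoc)
  show "f + g = g + f" by transfer (simp add: add.commute)
  show "0 + f = f" by transfer simp
  show "- f + f = 0" by transfer simp
  show "f - g = f + - g" by transfer simp
  show "f * g * h = f * (g * h)" by (rule exterior_mult_assoc)
  show "1 * f = f"
  proof (rule exterior_eqI)
    fix S :: "nat set" assume S: "finite S"
    have "coef (1 * f) S = (\<Sum>T\<in>Pow S. if T = {} then coef f S else 0)"
      unfolding coef_mult by (rule sum.cong) (auto simp: one_exterior.rep_eq merge_sign_empty)
    then show "coef (1 * f) S = coef f S" using S by (simp add: sum.delta)
  qed
  show "f * 1 = f"
  proof (rule exterior_eqI)
    fix S :: "nat set" assume S: "finite S"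
    have "coef (f * 1) S = (\<Sum>T\<in>Pow S. if T = S then coef f S else 0)"
      unfolding coef_mult by (rule sum.cong) (auto simp: one_exterior.rep_eq merge_sign_empty)
    then show "coef (f * 1) S = coef f S" using S by (simp add: sum.delta)
  qed
  show "(f + g) * h = f * h + g * h"
    by transfer (simp add: distrib_left distrib_right sum.distrib)
  show "f * (g + h) = f * g + f * h"
    by transfer (simp add: distrib_left distrib_right sum.distrib)
  show "(0 :: 'a exterior) \<noteq> 1" by transfer (metis zero_neq_one)
  show "c *\<^sub>C (f + g) = c *\<^sub>C f + c *\<^sub>C g" by transfer (simp add: scaleC_add_right)
  show "(c + d) *\<^sub>C f = c *\<^sub>C f + d *\<^sub>C f" by transfer (simp add: scaleC_add_left)
  show "c *\<^sub>C d *\<^sub>C f = (c * d) *\<^sub>C f" by transfer (simp add: scaleC_scaleC)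
  show "1 *\<^sub>C f = f" by transfer (simp add: scaleC_one)
  show "c *\<^sub>C f * g = c *\<^sub>C (f * g)"
    by transfer (simp add: mult_scaleC_left mult_scaleC_right scaleC.scale_sum_right)
  show "f * c *\<^sub>C g = c *\<^sub>C (f * g)"
    by transfer (simp add: mult_scaleC_left mult_scaleC_right scaleC.scale_sum_right)
qed

end

text \<open>
  The coefficient \<open>x\<close> times the increasing product over \<open>T\<close>; zero for infinite \<open>T\<close>.
\<close>

lift_definition monomial :: "nat set \<Rightarrow> 'a::complex_algebra_1 \<Rightarrow> 'a exterior" is
  "\<lambda>T x S. if S = T \<and> finite T then x else 0" by auto

lemma coef_monomial: "coef (monomial T x) S = (if S = T \<and> finite T then x else 0)"
  by (simp add: monomial.rep_eq)

lemma monomial_mult: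
  assumes "finite T" "finite U"
  shows "monomial T x * monomial U y
      = (if T \<inter> U = {} then monomial (T \<union> U) (merge_sign T U * (x * y)) else 0)"
proof (rule exterior_eqI)
  fix S :: "nat set" assume S: "finite S"
  have "coef (monomial T x * monomial U y) S
      = (\<Sum>V\<in>Pow S. if V = T then (if S - T = U then merge_sign T U * (x * y) else 0) else 0)"
    unfolding coef_mult by (rule sum.cong) (auto simp: coef_monomial assms)
  also have "\<dots> = (if T \<subseteq> S \<and> S - T = U then merge_sign T U * (x * y) else 0)"
    using S by (simp add: sum.delta)
  also have "\<dots> = coef (if T \<inter> U = {} then monomial (T \<union> U) (merge_sign T U * (x * y)) else 0) S"
    using assms by (auto simp: coef_monomial zero_exterior.rep_eq)
  finally show "coef (monomial T x * monomial U y) S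
      = coef (if T \<inter> U = {} then monomial (T \<union> U) (merge_sign T U * (x * y)) else 0) S" .
qed

text \<open>
  The embedding of the coefficient algebra, and the generators.
\<close>

definition scal :: "'a::complex_algebra_1 \<Rightarrow> 'a exterior" where "scal x = monomial {} x"

definition gen :: "nat \<Rightarrow> 'a::complex_algebra_1 exterior" where "gen i = monomial {i} 1"

lemma scal_add: "scal (x + y) = scal x + scal y"
  unfolding scal_def by transfer auto
lemma scal_diff: "scal (x - y) = scal x - scal y"
  unfolding scal_def by transfer auto
lemma scal_minus: "scal (- x) = - scal x"
  unfolding scal_def by transfer auto
lemma scal_0: "scal 0 = 0"
  unfolding scal_def by transfer auto
lemma scal_1: "scal 1 = 1"
  unfolding scal_def by transfer auto
lemma scal_scaleC: "scal (c *\<^sub>C x) = c *\<^sub>C scal x"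
  unfolding scal_def by transfer auto
lemma scal_mult: "scal (x * y) = scal x * scal y"
  by (simp add: scal_def monomial_mult merge_sign_empty)
lemma scal_sum: "scal (\<Sum>i\<in>A. f i) = (\<Sum>i\<in>A. scal (f i))"
  by (induction A rule: infinite_finite_induct) (simp_all add: scal_0 scal_add)
lemma scal_of_int: "scal (of_int k) = of_int k"
  by (simp add: of_int_eq_scaleC[where 'a='a] of_int_eq_scaleC[where 'a="'a exterior"]
      scal_scaleC scal_1)

lemma gen_scal: "gen i * scal x = scal x * gen i"
  by (simp add: scal_def gen_def monomial_mult merge_sign_empty)

lemma gen_sq: "gen i * gen i = 0"
  by (simp add: gen_def monomial_mult)

lemma gen_anticommute: "gen i * gen j = - (gen j * gen i)"
proof (cases "i = j")
  case False
  have "{(s, t). s \<in> {i} \<and> t \<in> {j} \<and> t < s} = (if j < i then {(i, j)} else {})"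
      for i j :: nat by auto
  then have "crossings {i} {j} = (if j < i then 1 else 0)" for i j by (simp add: crossings_def)
  moreover have "- monomial S x = monomial S (- x)" for S and x :: 'a by transfer auto
  ultimately show ?thesis using False
    by (auto simp: gen_def monomial_mult insert_commute merge_sign_def)
qed (simp add: gen_sq)

section \<open>Alternating sums, column determinants and Pfaffians\<close>

text \<open>
  \<open>G\<close> depends only on the values at \<open>1, \<dots>, m\<close> of its argument, and changes sign when two neighbouring
  values are interchanged.
\<close>

definition alternating :: "nat \<Rightarrow> ((nat \<Rightarrow> nat) \<Rightarrow> 'r::ring_1) \<Rightarrow> bool" where
  "alternating m G \<longleftrightarrow>
    (\<forall>f g. (\<forall>i\<in>{1..m}. f i = g i) \<longrightarrow> G f = G g) \<and>
    (\<forall>f i. 1 \<le> i \<longrightarrow> i < m \<longrightarrow> G (f \<circ> Transposition.transpose i (Suc i)) = - G f)"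

lemma alternating_cong: "alternating m G \<Longrightarrow> (\<And>i. i \<in> {1..m} \<Longrightarrow> f i = g i) \<Longrightarrow> G f = G g"
  by (auto simp: alternating_def)

lemma alternating_transpose:
  assumes G: "alternating m G" and "1 \<le> a" "a < b" "b \<le> m"
  shows "G (f \<circ> Transposition.transpose a b) = - G f"
  using assms(3,4)
proof (induction b arbitrary: f)
  case (Suc b)
  have adj: "G (f \<circ> Transposition.transpose b (Suc b)) = - G f" if "1 \<le> b" for f
    using G Suc.prems that by (auto simp: alternating_def)
  show ?case
  proof (cases "a = b")
    case True
    then show ?thesis using adj[of f] assms(2) by blast
  next
    case False
    then have ab: "a < b" using Suc.prems by simp
    have "f \<circ> Transposition.transpose a (Suc b) = f \<circ> Transposition.transpose b (Suc b) \<circ>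
        Transposition.transpose a b \<circ> Transposition.transpose b (Suc b)"
      using ab by (auto simp: fun_eq_iff Transposition.transpose_def)
    then have "G (f \<circ> Transposition.transpose a (Suc b))
        = - G (f \<circ> Transposition.transpose b (Suc b) \<circ> Transposition.transpose a b)"
      using adj ab assms(2) by simp
    also have "\<dots> = G (f \<circ> Transposition.transpose b (Suc b))"
      using Suc.IH[OF ab, of "f \<circ> Transposition.transpose b (Suc b)"] Suc.prems
        by (metis Suc_leD minus_minus)
    also have "\<dots> = - G f" using adj ab assms(2) by simp
    finally show ?thesis .
  qed
qed simp

lemma alternating_transpose':
  assumes G: "alternating m G" and ab: "a \<in> {1..m}" "b \<in> {1..m}" "a \<noteq> b"
  shows "G (f \<circ> Transposition.transpose a b) = - G f"
proof (cases "a < b")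
  case True
  then show ?thesis using alternating_transpose[OF G, of a b] ab by simp
next
  case False
  then show ?thesis using alternating_transpose[OF G, of b a] ab by (simp add: transpose_commute)
qed

lemma alternating_permutes:
  assumes G: "alternating m G" and "\<sigma> permutes {1..m}"
  shows "G (f \<circ> \<sigma>) = of_int (sign \<sigma>) * G f"
proof -
  have "\<forall>f. G (f \<circ> \<sigma>) = of_int (sign \<sigma>) * G f"
    using assms(2) finite_atLeastAtMost
  proof (induction rule: permutes_induct)
    case id
    show ?case by simp
  next
    case (swap a b p)
    have s: "sign (Transposition.transpose a b \<circ> p) = - sign p"
    proof -
      have "permutation p" using swap.hyps unfolding permutation_permutes by blast
      then show ?thesis using swap.hyps by (simp add: sign_compose permutation_swap_id sign_swap_id)
    qed
    show ?case
    proof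
      fix f
      have "G (f \<circ> (Transposition.transpose a b \<circ> p))
          = of_int (sign p) * G (f \<circ> Transposition.transpose a b)"
        using swap.IH by (simp only: o_assoc)
      then show "G (f \<circ> (Transposition.transpose a b \<circ> p))
          = of_int (sign (Transposition.transpose a b \<circ> p)) * G f"
        using alternating_transpose'[OF G swap(1-3)] s by simp
    qed
  qed
  then show ?thesis by blast
qed

lemma alternating_eq_0:
  fixes G :: "(nat \<Rightarrow> nat) \<Rightarrow> 'r::complex_algebra_1"
  assumes G: "alternating m G" and "\<not> inj_on f {1..m}"
  shows "G f = 0"
proof -
  obtain a b where ab: "a \<in> {1..m}" "b \<in> {1..m}" "a \<noteq> b" "f a = f b"
    using assms(2) by (auto simp: inj_on_def)
  have "f \<circ> Transposition.transpose a b = f" using ab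
    by (auto simp: fun_eq_iff Transposition.transpose_def)
  then show ?thesis using alternating_transpose'[OF G ab(1-3), of f] eq_neg_self_imp_0 by metis
qed

lemma bij_betw_nth_of:
  assumes "finite K" "card K = m"
  shows "bij_betw (nth_of K) {1..m} K"
proof -
  have "bij_betw (\<lambda>i. sorted_list_of_set K ! i) {..<m} K"
    using assms by (intro bij_betw_nth) auto
  moreover have "bij_betw (\<lambda>i. i - 1) {1..m} {..<m}"
    by (rule bij_betwI[of _ _ _ Suc]) auto
  ultimately have "bij_betw ((\<lambda>i. sorted_list_of_set K ! i) \<circ> (\<lambda>i. i - 1)) {1..m} K"
    by (intro bij_betw_trans)
  then show ?thesis by (simp add: nth_of_def[abs_def] o_def)
qed

lemma permutes_if:
  assumes "bij_betw h A A"
  shows "(\<lambda>i. if i \<in> A then h i else i) permutes A"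
proof (rule bij_imp_permutes)
  show "bij_betw (\<lambda>i. if i \<in> A then h i else i) A A"
    using assms by (rule bij_betw_cong[THEN iffD1, rotated]) simp
qed simp

text \<open>
  In a sum over all words of length \<open>m\<close> in \<open>I\<close> only the injective words matter, and each of these is a
  rearrangement of the increasing enumeration of its image \<open>K\<close>.  Pfaffians and column determinants
  both arise as the inner sum.
\<close>

lemma alternating_sum:
  fixes G :: "(nat \<Rightarrow> nat) \<Rightarrow> 'r::complex_algebra_1"
  assumes G: "alternating m G" and I: "finite I"
    and w: "\<And>f g. (\<And>i. i \<in> {1..m} \<Longrightarrow> f i = g i) \<Longrightarrow> w f = w g"
  shows "(\<Sum>f\<in>PiE {1..m} (\<lambda>_. I). w f * G f)
    = (\<Sum>K | K \<subseteq> I \<and> card K = m. (\<Sum>\<sigma> | \<sigma> permutes {1..m}. of_int (sign \<sigma>) * w (nth_of K \<circ> \<sigma>))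
        * G (nth_of K))"
proof -
  let ?P = "{\<sigma>. \<sigma> permutes {1..m}}"
  have fP: "finite (PiE {1..m} (\<lambda>_. I))" using I by (simp add: finite_PiE)
  have fK: "finite {K. K \<subseteq> I \<and> card K = m}" using I by simp
  have nth: "bij_betw (nth_of K) {1..m} K" if "K \<subseteq> I" "card K = m" for K
    using that I by (intro bij_betw_nth_of) (auto intro: finite_subset)
  have "(\<Sum>f\<in>PiE {1..m} (\<lambda>_. I). w f * G f)
      = (\<Sum>f | f \<in> PiE {1..m} (\<lambda>_. I) \<and> inj_on f {1..m}. w f * G f)"
    using fP by (intro sum.mono_neutral_right) (auto simp: alternating_eq_0[OF G])
  also have "\<dots> = (\<Sum>(K, \<sigma>)\<in>{K. K \<subseteq> I \<and> card K = m} \<times> ?P. of_int (sign \<sigma>) * w (nth_of K \<circ> \<sigma>)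
      * G (nth_of K))"
  proof (rule sum.reindex_bij_witness[of _ "\<lambda>(K, \<sigma>). restrict (nth_of K \<circ> \<sigma>) {1..m}"
        "\<lambda>f. (f ` {1..m}, \<lambda>i. if i \<in> {1..m} then inv_into {1..m} (nth_of (f ` {1..m})) (f i) else
            i)"], goal_cases)
    case (1 f)
    then have f: "f \<in> PiE {1..m} (\<lambda>_. I)" "inj_on f {1..m}" by auto
    have K: "f ` {1..m} \<subseteq> I" "card (f ` {1..m}) = m" using f by (auto simp: card_image)
    from nth[OF K] have n: "nth_of (f ` {1..m}) (inv_into {1..m} (nth_of (f ` {1..m})) (f i))
        = f i" if "i \<in> {1..m}" for i
      using that by (auto simp: bij_betw_def intro!: f_inv_into_f)
    show ?case using f n by (fastforce simp: fun_eq_iff PiE_def extensional_def)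
  next
    case (2 f)
    then have f: "f \<in> PiE {1..m} (\<lambda>_. I)" "inj_on f {1..m}" by auto
    have K: "f ` {1..m} \<subseteq> I" "card (f ` {1..m}) = m" using f by (auto simp: card_image)
    have "bij_betw (inv_into {1..m} (nth_of (f ` {1..m})) \<circ> f) {1..m} {1..m}"
      using f by (intro bij_betw_trans[OF _ bij_betw_inv_into[OF nth[OF K]]])
          (auto simp: bij_betw_def)
    from permutes_if[OF this]
    have "(\<lambda>i. if i \<in> {1..m} then inv_into {1..m} (nth_of (f ` {1..m})) (f i) else i)
        permutes {1..m}"
      by (simp only: o_apply)
    then show ?case using K by simp
  next
    case (3 b)
    obtain K \<sigma> where b: "b = (K, \<sigma>)" "K \<subseteq> I" "card K = m" "\<sigma> permutes {1..m}" using 3 by auto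
    have "bij_betw (nth_of K \<circ> \<sigma>) {1..m} K"
      by (rule bij_betw_trans[OF permutes_imp_bij[OF b(4)] nth[OF b(2,3)]])
    then have im: "restrict (nth_of K \<circ> \<sigma>) {1..m} ` {1..m} = K" by (simp add: bij_betw_def)
    have "(if i \<in> {1..m} then inv_into {1..m} (nth_of K) (restrict (nth_of K \<circ> \<sigma>) {1..m} i) else i)
        = \<sigma> i" for i
    proof (cases "i \<in> {1..m}")
      case True
      then have "\<sigma> i \<in> {1..m}" using b(4) permutes_in_image by metis
      then show ?thesis using True nth[OF b(2,3)] by (simp add: bij_betw_def inv_into_f_f)
    next
      case False
      then show ?thesis by (simp only: if_not_P[OF False] if_False permutes_not_in[OF b(4) False])
    qed
    then show ?case unfolding b(1) prod.case im by blast
  next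
    case (4 b)
    obtain K \<sigma> where b: "b = (K, \<sigma>)" "K \<subseteq> I" "card K = m" "\<sigma> permutes {1..m}" using 4 by auto
    have bij: "bij_betw (nth_of K \<circ> \<sigma>) {1..m} K"
      by (rule bij_betw_trans[OF permutes_imp_bij[OF b(4)] nth[OF b(2,3)]])
    then have "inj_on (restrict (nth_of K \<circ> \<sigma>) {1..m}) {1..m}" 
      by (simp only: bij_betw_def inj_on_restrict_eq)
    moreover have "restrict (nth_of K \<circ> \<sigma>) {1..m} \<in> PiE {1..m} (\<lambda>_. I)"
      using bij b(2) by (auto simp: bij_betw_def)
    ultimately show ?case by (simp add: b(1))
  next
    case (5 f)
    then have f: "f \<in> PiE {1..m} (\<lambda>_. I)" "inj_on f {1..m}" by auto
    let ?K = "f ` {1..m}" 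
    let ?s = "\<lambda>i. if i \<in> {1..m} then inv_into {1..m} (nth_of ?K) (f i) else i"
    have K: "?K \<subseteq> I" "card ?K = m" using f by (auto simp: card_image)
    have "bij_betw (inv_into {1..m} (nth_of ?K) \<circ> f) {1..m} {1..m}"
      using f by (intro bij_betw_trans[OF _ bij_betw_inv_into[OF nth[OF K]]])
          (auto simp: bij_betw_def)
    from permutes_if[OF this] have s: "?s permutes {1..m}" by (simp only: o_apply)
    from nth[OF K] have n: "(nth_of ?K \<circ> ?s) i = f i" if "i \<in> {1..m}" for i
      using that by (auto simp: bij_betw_def intro!: f_inv_into_f)
    have "G f = G (nth_of ?K \<circ> ?s)" by (rule alternating_cong[OF G]) (simp only: n)
    also have "\<dots> = of_int (sign ?s) * G (nth_of ?K)" by (rule alternating_permutes[OF G s])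
    finally have "G f = of_int (sign ?s) * G (nth_of ?K)" .
    moreover have "w f = w (nth_of ?K \<circ> ?s)" by (rule w) (simp only: n)
    ultimately show ?case
      by (simp only: prod.case mult.assoc of_int_left_commute)
  qed
  also have "\<dots>
      = (\<Sum>K | K \<subseteq> I \<and> card K = m. (\<Sum>\<sigma> | \<sigma> permutes {1..m}. of_int (sign \<sigma>) * w (nth_of K \<circ> \<sigma>))
      * G (nth_of K))"
    by (simp add: sum.cartesian_product[symmetric] sum_distrib_right)
  finally show ?thesis .
qed

lemma mult_interchange: "b * c = c * b \<Longrightarrow> (a * b) * (c * d)
    = (a * c) * (b * (d :: 'r::semigroup_mult))"
  by (metis mult.assoc)

text \<open>
  The ordered product \<open>h 1 (f 1) * \<dots> * h m (f m)\<close> of factors that depend on their position.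
\<close>

definition seq_prod :: "(nat \<Rightarrow> 'i \<Rightarrow> 'r::monoid_mult) \<Rightarrow> nat \<Rightarrow> (nat \<Rightarrow> 'i) \<Rightarrow> 'r" where
  "seq_prod h m f = (\<Prod>k\<leftarrow>[1..<Suc m]. h k (f k))"

lemma seq_prod_0: "seq_prod h 0 f = 1"
  by (simp add: seq_prod_def)

lemma seq_prod_Suc: "seq_prod h (Suc m) f = seq_prod h m f * h (Suc m) (f (Suc m))"
  by (simp add: seq_prod_def)

lemma seq_prod_cong:
  "(\<And>k. k \<in> {1..m} \<Longrightarrow> h k (f k) = h' k (g k)) \<Longrightarrow> seq_prod h m f = seq_prod h' m g"
  by (induction m) (simp_all add: seq_prod_0 seq_prod_Suc)

lemma seq_prod_add:
  "seq_prod h (l + m) f = seq_prod h l f * seq_prod (\<lambda>k. h (l + k)) m (\<lambda>k. f (l + k))"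
  by (induction m) (simp_all add: seq_prod_0 seq_prod_Suc mult.assoc)

lemma alternating_seq_prod:
  fixes h :: "nat \<Rightarrow> nat \<Rightarrow> 'r::ring_1"
  assumes h: "\<And>k i j. 1 \<le> k \<Longrightarrow> k < m \<Longrightarrow> h k i * h (Suc k) j = - (h k j * h (Suc k) i)"
  shows "alternating m (seq_prod h m)"
  unfolding alternating_def
proof (intro conjI allI impI)
  fix f g :: "nat \<Rightarrow> nat" assume "\<forall>i\<in>{1..m}. f i = g i"
  then show "seq_prod h m f = seq_prod h m g" by (intro seq_prod_cong) simp
next
  fix f :: "nat \<Rightarrow> nat" and i assume i: "1 \<le> i" "i < m"
  let ?f = "f \<circ> Transposition.transpose i (Suc i)"
  obtain l where l: "i = Suc l" using i by (cases i) auto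
  define d where "d = m - Suc i"
  have m: "m = Suc (Suc l) + d" using i by (simp add: d_def l)
  have 1: "seq_prod h l ?f = seq_prod h l f"
    by (rule seq_prod_cong) (simp add: l Transposition.transpose_def)
  have 2: "seq_prod (\<lambda>k. h (Suc (Suc l) + k)) d (\<lambda>k. ?f (Suc (Suc l) + k))
      = seq_prod (\<lambda>k. h (Suc (Suc l) + k)) d (\<lambda>k. f (Suc (Suc l) + k))"
    by (rule seq_prod_cong) (simp add: l Transposition.transpose_def)
  have "seq_prod h (Suc (Suc l)) ?f = - seq_prod h (Suc (Suc l)) f"
    using h[of i "f (Suc i)" "f i"] i unfolding seq_prod_Suc 1 mult.assoc by (simp add: l)
  then show "seq_prod h m ?f = - seq_prod h m f"
    unfolding m seq_prod_add 2 by simp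
qed

lemma sum_PiE_Suc:
  fixes w :: "(nat \<Rightarrow> 'i) \<Rightarrow> 'r::comm_monoid_add"
  shows "(\<Sum>f\<in>PiE {1..Suc m} (\<lambda>_. I). w f) = (\<Sum>f\<in>PiE {1..m} (\<lambda>_. I). \<Sum>i\<in>I. w (f(Suc m := i)))"
proof -
  have "{1..Suc m} = insert (Suc m) {1..m}" by auto
  then have "(\<Sum>f\<in>PiE {1..Suc m} (\<lambda>_. I). w f)
      = sum w ((\<lambda>(y, g). g(Suc m := y)) ` (I \<times> PiE {1..m} (\<lambda>_. I)))"
    by (simp only: PiE_insert_eq)
  also have "\<dots> = (\<Sum>(i, f)\<in>I \<times> PiE {1..m} (\<lambda>_. I). w (f(Suc m := i)))"
    by (subst sum.reindex) (rule inj_combinator, simp, simp add: case_prod_unfold)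
  also have "\<dots> = (\<Sum>f\<in>PiE {1..m} (\<lambda>_. I). \<Sum>i\<in>I. w (f(Suc m := i)))"
    by (subst sum.cartesian_product[symmetric]) (rule sum.swap)
  finally show ?thesis .
qed

lemma seq_prod_sum:
  fixes t :: "nat \<Rightarrow> 'i \<Rightarrow> 'r::semiring_1"
  shows "seq_prod (\<lambda>k _. \<Sum>i\<in>I. t k i) m u = (\<Sum>f\<in>PiE {1..m} (\<lambda>_. I). seq_prod t m f)"
proof (induction m)
  case (Suc m)
  have "seq_prod t m (f(Suc m := i)) = seq_prod t m f" for f and i :: 'i
    by (rule seq_prod_cong) simp
  then show ?case
    unfolding sum_PiE_Suc seq_prod_Suc Suc sum_product by (simp only: fun_upd_same)
qed (simp add: seq_prod_0)

lemma seq_prod_commute: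
  "(\<And>k. h k (f k) * x = x * h k (f k)) \<Longrightarrow> seq_prod h m f * x = x * seq_prod h m f"
  by (induction m) (simp_all add: seq_prod_0 seq_prod_Suc mult.assoc, metis mult.assoc)

text \<open>
  The case of factors that do not depend on their position.
\<close>

abbreviation odd_prod :: "(nat \<Rightarrow> 'a exterior) \<Rightarrow> nat \<Rightarrow> (nat \<Rightarrow> nat) \<Rightarrow> 'a::complex_algebra_1
    exterior" where
  "odd_prod g \<equiv> seq_prod (\<lambda>_. g)"

text \<open>
  Pairwise anticommuting elements that commute with the coefficients.
\<close>

definition odd_family :: "(nat \<Rightarrow> 'a::complex_algebra_1 exterior) \<Rightarrow> bool" where
  "odd_family g \<longleftrightarrow> (\<forall>i j. g i * g j = - (g j * g i)) \<and> (\<forall>i x. g i * scal x = scal x * g i)"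

lemma odd_familyD:
  assumes "odd_family g"
  shows "g i * g j = - (g j * g i)" "g i * scal x = scal x * g i"
  using assms unfolding odd_family_def by blast+

lemma alternating_odd_prod: "odd_family g \<Longrightarrow> alternating m (odd_prod g m)"
  by (rule alternating_seq_prod) (rule odd_familyD)

lemma odd_prod_scal: "odd_family g \<Longrightarrow> odd_prod g m f * scal x = scal x * odd_prod g m f"
  by (rule seq_prod_commute) (rule odd_familyD)

lemma linear_forms_prod:
  assumes g: "odd_family g" and I: "finite I"
  shows "seq_prod (\<lambda>k _. \<Sum>i\<in>I. scal (\<Phi> i k) * g i) m u
    = (\<Sum>K | K \<subseteq> I \<and> card K = m. scal (col_det m (\<lambda>s t. \<Phi> (nth_of K s) t))
        * odd_prod g m (nth_of K))"
proof -
  have 1: "seq_prod (\<lambda>k i. scal (\<Phi> i k) * g i) m f = scal (seq_prod (\<lambda>k i. \<Phi> i k) m f)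
      * odd_prod g m f" for f
  proof (induction m)
    case (Suc m)
    show ?case 
      unfolding seq_prod_Suc scal_mult Suc by (rule mult_interchange[OF odd_prod_scal[OF g]])
  qed (simp add: seq_prod_0 scal_1)
  have "seq_prod (\<lambda>k _. \<Sum>i\<in>I. scal (\<Phi> i k) * g i) m u
      = (\<Sum>f\<in>PiE {1..m} (\<lambda>_. I). scal (seq_prod (\<lambda>k i. \<Phi> i k) m f) * odd_prod g m f)"
    by (simp only: seq_prod_sum 1)
  also have "\<dots> = (\<Sum>K | K \<subseteq> I \<and> card K = m. (\<Sum>\<sigma> | \<sigma> permutes {1..m}. of_int (sign \<sigma>)
      * scal (seq_prod (\<lambda>k i. \<Phi> i k) m (nth_of K \<circ> \<sigma>))) * odd_prod g m (nth_of K))"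
    by (rule alternating_sum[OF alternating_odd_prod[OF g] I])
        (auto intro!: arg_cong[of _ _ scal] seq_prod_cong)
  finally show ?thesis
    by (simp add: col_det_def scal_sum scal_mult scal_of_int seq_prod_def o_def)
qed

lemma quadratic_form_dpow:
  assumes g: "odd_family g" and I: "finite I"
  shows "dpow ((1 / 2) *\<^sub>C (\<Sum>i\<in>I. \<Sum>j\<in>I. scal (A i j) * g i * g j)) k
    = (\<Sum>K | K \<subseteq> I \<and> card K = 2 * k. scal (pfaffian k (submat A K K))
        * odd_prod g (2 * k) (nth_of K))"
proof -
  let ?W = "\<lambda>k f. \<Prod>s\<leftarrow>[1..<Suc k]. A (f (2 * s - 1)) (f (2 * s))"
  have W: "?W k f = ?W k f'" if "\<And>i. i \<in> {1..2 * k} \<Longrightarrow> f i = f' i" for k and f f' :: "nat \<Rightarrow> nat"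
    by (intro arg_cong[of _ _ prod_list] map_cong) (auto intro!: arg_cong2[of _ _ _ _ A] that)
  have W_Suc: "?W (Suc k) f = ?W k f * A (f (Suc (2 * k))) (f (Suc (Suc (2 * k))))" for k f by simp
  have "(\<Sum>i\<in>I. \<Sum>j\<in>I. scal (A i j) * g i * g j) ^ k
      = (\<Sum>f\<in>PiE {1..2 * k} (\<lambda>_. I). scal (?W k f) * odd_prod g (2 * k) f)" for k
  proof (induction k)
    case (Suc k)
    have t: "scal (?W (Suc k) (f(Suc (2 * k) := i, Suc (Suc (2 * k)) := j)))
          * odd_prod g (2 * Suc k) (f(Suc (2 * k) := i, Suc (Suc (2 * k)) := j))
        = scal (?W k f) * odd_prod g (2 * k) f * (scal (A i j) * g i * g j)" for f i j
    proof -
      let ?f = "f(Suc (2 * k) := i, Suc (Suc (2 * k)) := j)"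
      have "?W (Suc k) ?f = ?W k f * A i j"
        unfolding W_Suc by (subst W[of k _ f]) auto
      moreover have "odd_prod g (2 * Suc k) ?f = odd_prod g (2 * k) f * (g i * g j)"
      proof -
        have "odd_prod g (2 * k) ?f = odd_prod g (2 * k) f" by (rule seq_prod_cong) auto
        then show ?thesis by (simp add: seq_prod_Suc mult.assoc)
      qed
      ultimately show ?thesis
        by (simp only: scal_mult mult.assoc[of "scal (A i j)"]
            mult_interchange[OF odd_prod_scal[OF g]])
    qed
    have "2 * Suc k = Suc (Suc (2 * k))" by simp
    then have "(\<Sum>f\<in>PiE {1..2 * Suc k} (\<lambda>_. I). scal (?W (Suc k) f) * odd_prod g (2 * Suc k) f)
        = (\<Sum>f\<in>PiE {1..2 * k} (\<lambda>_. I). \<Sum>i\<in>I. \<Sum>j\<in>I. scal (?W k f) * odd_prod g (2 * k) f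
            * (scal (A i j) * g i * g j))"
      by (simp only: sum_PiE_Suc t[symmetric])
    also have "\<dots> = (\<Sum>i\<in>I. \<Sum>j\<in>I. scal (A i j) * g i * g j) ^ Suc k"
      by (simp only: Suc[symmetric] sum_distrib_left[symmetric]
          sum_distrib_right[symmetric] power_Suc2)
    finally show ?case by simp
  qed (simp add: seq_prod_0 scal_1)
  note * = this[of k]
  let ?rhs = "\<Sum>K | K \<subseteq> I \<and> card K = 2 * k. scal (\<Sum>\<sigma> | \<sigma> permutes {1..2 * k}. of_int (sign \<sigma>)
      * ?W k (nth_of K \<circ> \<sigma>)) * odd_prod g (2 * k) (nth_of K)"
  have "(\<Sum>i\<in>I. \<Sum>j\<in>I. scal (A i j) * g i * g j) ^ k
      = (\<Sum>f\<in>PiE {1..2 * k} (\<lambda>_. I). scal (?W k f) * odd_prod g (2 * k) f)"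
    by (rule *)
  also have "\<dots> = (\<Sum>K | K \<subseteq> I \<and> card K = 2 * k. (\<Sum>\<sigma> | \<sigma> permutes {1..2 * k}. of_int (sign \<sigma>)
      * scal (?W k (nth_of K \<circ> \<sigma>))) * odd_prod g (2 * k) (nth_of K))"
    by (rule alternating_sum[OF alternating_odd_prod[OF g] I]) (rule arg_cong[of _ _ scal], rule W)
  also have "\<dots> = ?rhs"
    by (simp only: scal_sum scal_mult scal_of_int)
  finally have Q: "(\<Sum>i\<in>I. \<Sum>j\<in>I. scal (A i j) * g i * g j) ^ k = ?rhs" .
  have pow: "((1 / 2) *\<^sub>C x) ^ k = (1 / 2 ^ k) *\<^sub>C x ^ k" for x :: "'a exterior"
    by (induction k) (simp_all add: mult_scaleC_left mult_scaleC_right)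
  have "dpow ((1 / 2) *\<^sub>C x) k = (1 / (2 ^ k * fact k)) *\<^sub>C x ^ k" for x :: "'a exterior"
    unfolding dpow_def pow scaleC.scale_scale by (simp add: mult.commute)
  moreover have "(1 / (2 ^ k * fact k)) *\<^sub>C ?rhs
      = (\<Sum>K | K \<subseteq> I \<and> card K = 2 * k. scal (pfaffian k (submat A K K))
          * odd_prod g (2 * k) (nth_of K))"
    unfolding scaleC.scale_sum_right
    by (rule sum.cong[OF refl]) (simp only: pfaffian_def submat_def o_apply scal_scaleC
        mult_scaleC_left)
  ultimately show ?thesis by (simp only: Q)
qed

text \<open>
  This is where the signs \<open>shuffle_sign\<close> of the normal form come from.
\<close>

lemma shuffle_odd_prod:
  assumes g: "odd_family g" and n: "{1..n} = S \<union> T" "S \<inter> T = {}"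
  shows "odd_prod g (card S) (nth_of S) * odd_prod g (card T) (nth_of T)
    = of_int (shuffle_sign S T) * odd_prod g n (\<lambda>i. i)"
proof -
  let ?L = "sorted_list_of_set S @ sorted_list_of_set T"
  let ?s = "\<lambda>i. if i \<in> {1..card S + card T} then ?L ! (i - 1) else i"
  have fin: "finite S" "finite T" using n by (metis finite_Un finite_atLeastAtMost)+
  have card: "card S + card T = n" using n fin
    by (metis card_Un_disjoint card_atLeastAtMost diff_Suc_1)
  have "bij_betw (\<lambda>i. ?L ! i) {..<n} {1..n}"
    using n fin card by (intro bij_betw_nth) auto
  moreover have "bij_betw (\<lambda>i. i - 1) {1..n} {..<n}"
    by (rule bij_betwI[of _ _ _ Suc]) auto
  ultimately have "bij_betw ((\<lambda>i. ?L ! i) \<circ> (\<lambda>i. i - 1)) {1..n} {1..n}"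
    by (intro bij_betw_trans)
  from permutes_if[OF this] have s: "?s permutes {1..n}" by (simp only: o_apply card)
  have "odd_prod g n ((\<lambda>i. i) \<circ> ?s) = of_int (sign ?s) * odd_prod g n (\<lambda>i. i)"
    by (rule alternating_permutes[OF alternating_odd_prod[OF g] s])
  then have "odd_prod g n ?s = of_int (shuffle_sign S T) * odd_prod g n (\<lambda>i. i)"
    by (simp add: o_def shuffle_sign_def)
  moreover have "odd_prod g n ?s = odd_prod g (card S) (nth_of S) * odd_prod g (card T) (nth_of T)"
    unfolding card[symmetric] seq_prod_add
    by (intro arg_cong2[of _ _ _ _ "(*)"] seq_prod_cong arg_cong[of _ _ g])
        (auto simp: nth_append nth_of_def fin)
  ultimately show ?thesis by simp
qed

section \<open>Commutation relations of the orthogonal Lie algebra\<close>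

lemma neg_index_in: "p \<in> {1..2 * n} \<Longrightarrow> neg_index n p \<in> {1..2 * n}"
  by (auto simp: neg_index_def)

lemma neg_index_neg: "p \<in> {1..2 * n} \<Longrightarrow> neg_index n (neg_index n p) = p"
  by (auto simp: neg_index_def)

lemma matrix_unit_mult:
  assumes j: "j \<in> {1..2 * CARD('n::finite)}"
  shows "(matrix_unit i j :: complex^('n bit0)^('n bit0)) ** matrix_unit k l
    = (if j = k then matrix_unit i l else 0)"
proof -
  have "((matrix_unit i j :: complex^('n bit0)^('n bit0)) ** matrix_unit k l) $ r $ s
      = (if j = k then matrix_unit i l else 0 :: complex^('n bit0)^('n bit0)) $ r $ s" for r s
  proof -
    have "((matrix_unit i j :: complex^('n bit0)^('n bit0)) ** matrix_unit k l) $ r $ s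
        = (\<Sum>q\<in>(UNIV :: 'n bit0 set). if pos q = j then if pos r = i \<and> pos q = k \<and> pos s
            = l then 1 else 0 else 0)"
      unfolding matrix_matrix_mult_def matrix_unit_def by simp (rule sum.cong, auto)
    also have "\<dots> = (if pos r = i \<and> j = k \<and> pos s = l then 1 else 0)"
      using sum_pos_delta[where 'n='n and i=j and f="\<lambda>q. if pos r = i \<and> q = k \<and> pos s
          = l then 1 else 0 :: complex"] j
      by (simp only: if_True)
    finally show ?thesis by (simp add: matrix_unit_def)
  qed
  then show ?thesis by (simp add: vec_eq_iff)
qed

lemma o2n_gen_bracket:
  fixes i j k l :: nat
  defines "neg \<equiv> neg_index CARD('n::finite)"
  assumes r: "i \<in> {1..2 * CARD('n)}" "j \<in> {1..2 * CARD('n)}" "k \<in> {1..2 * CARD('n)}"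
      "l \<in> {1..2 * CARD('n)}"
  shows "lie_bracket (o2n_gen i j) (o2n_gen k l :: 'n o2n)
    = (if j = k then o2n_gen i l else 0) - (if i = l then o2n_gen k j else 0)
      - (if neg i = k then o2n_gen (neg j) l else 0) + (if l = neg j then o2n_gen k (neg i) else 0)"
proof -
  let ?U = "matrix_unit :: nat \<Rightarrow> nat \<Rightarrow> complex^('n bit0)^('n bit0)"
  have neg: "neg i \<in> {1..2 * CARD('n)}" "neg j \<in> {1..2 * CARD('n)}" "neg k \<in> {1..2 * CARD('n)}"
      "neg l \<in> {1..2 * CARD('n)}"
    unfolding neg_def by (intro neg_index_in r)+
  have nn: "neg (neg i) = i" "neg (neg j) = j" "neg (neg k) = k" "neg (neg l) = l"
    unfolding neg_def by (intro neg_index_neg r)+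
  have c: "neg i = neg l \<longleftrightarrow> i = l" "neg k = neg j \<longleftrightarrow> j = k" "j = neg l \<longleftrightarrow> l = neg j" "neg k = i
      \<longleftrightarrow> neg i = k"
     "l = i \<longleftrightarrow> i = l"
    using nn by metis+
  have gen: "Rep_o2n (o2n_gen p q :: 'n o2n) = ?U p q - ?U (neg q) (neg p)" for p q
    by (simp add: o2n_gen.rep_eq neg_def)
  have if_rep: "Rep_o2n (if P then x else 0) = (if P then Rep_o2n x else 0)" for P and x :: "'n o2n"
    by (simp add: zero_o2n.rep_eq)
  show ?thesis
    unfolding Rep_o2n_inject[symmetric] lie_bracket_o2n.rep_eq plus_o2n.rep_eq
        minus_o2n.rep_eq if_rep gen
      cmat_diff_mult cmat_mult_diff matrix_unit_mult[OF r(1)] matrix_unit_mult[OF r(2)]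
          matrix_unit_mult[OF r(3)]
      matrix_unit_mult[OF r(4)] matrix_unit_mult[OF neg(1)] matrix_unit_mult[OF neg(2)]
          matrix_unit_mult[OF neg(3)]
      matrix_unit_mult[OF neg(4)] c nn
    by auto
qed

lemma o2n_gen_neg:
  assumes "i \<in> {1..2 * CARD('n::finite)}" "j \<in> {1..2 * CARD('n)}"
  shows "o2n_gen (neg_index CARD('n) j) (neg_index CARD('n) i) = (- 1) *\<^sub>C (o2n_gen i j :: 'n o2n)"
  unfolding Rep_o2n_inject[symmetric] scaleC_o2n.rep_eq o2n_gen.rep_eq
  using assms by (simp add: neg_index_neg cmat_scale_uminus_1)

lemma uea_incl_0: "uea_incl 0 = 0"
  using uea_incl_add[of 0 0] by simp

lemma uea_incl_minus: "uea_incl (- x) = - uea_incl x"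
  using uea_incl_add[of x "- x"] by (simp add: uea_incl_0 eq_neg_iff_add_eq_0 add.commute)

lemma uea_incl_diff: "uea_incl (x - y) = uea_incl x - uea_incl y"
  using uea_incl_add[of x "- y"] by (simp add: uea_incl_minus)

lemma X_entry_neg:
  assumes "i \<in> {1..2 * CARD('n::finite)}" "j \<in> {1..2 * CARD('n)}"
  shows "X_entry (neg_index CARD('n) j) (neg_index CARD('n) i) = - (X_entry i j :: 'n o2n uea)"
  unfolding X_entry_def o2n_gen_neg[OF assms] uea_incl_scaleC by (simp add: scaleC.scale_minus_left)

lemma X_entry_commutator:
  fixes i j k l :: nat
  defines "neg \<equiv> neg_index CARD('n::finite)"
  assumes "i \<in> {1..2 * CARD('n)}" "j \<in> {1..2 * CARD('n)}" "k \<in> {1..2 * CARD('n)}"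
      "l \<in> {1..2 * CARD('n)}"
  shows "X_entry i j * X_entry k l - X_entry k l * (X_entry i j :: 'n o2n uea)
    = (if j = k then X_entry i l else 0) - (if i = l then X_entry k j else 0)
      - (if neg i = k then X_entry (neg j) l else 0) + (if l = neg j then X_entry k (neg i) else 0)"
proof -
  have "uea_incl (if P then x else 0) = (if P then uea_incl x else 0)" for P and x :: "'n o2n"
    by (simp add: uea_incl_0)
  then show ?thesis
    unfolding X_entry_def uea_incl_bracket[symmetric] o2n_gen_bracket[OF assms(2-)] neg_def
    by (simp only: uea_incl_add uea_incl_diff)
qed

text \<open>
  The commutation relations between the entries of the blocks \<open>a\<close>, \<open>b\<close>, \<open>c\<close>, for indices in
  \<open>{1..n}\<close>.
\<close>

locale orthogonal_relations =
  fixes n :: nat and a b c :: "nat \<Rightarrow> nat \<Rightarrow> 'a::complex_algebra_1"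
  assumes a_a: "\<lbrakk>i \<in> {1..n}; j \<in> {1..n}; k \<in> {1..n}; l \<in> {1..n}\<rbrakk> \<Longrightarrow>
      a i j * a k l - a k l * a i j = (if j = k then a i l else 0) - (if i = l then a k j else 0)"
    and a_b: "\<lbrakk>i \<in> {1..n}; j \<in> {1..n}; k \<in> {1..n}; l \<in> {1..n}\<rbrakk> \<Longrightarrow>
      a i j * b k l - b k l * a i j = (if j = k then b i l else 0) + (if j = l then b k i else 0)"
    and a_c: "\<lbrakk>i \<in> {1..n}; j \<in> {1..n}; k \<in> {1..n}; l \<in> {1..n}\<rbrakk> \<Longrightarrow>
      a i j * c k l - c k l * a i j = - (if i = k then c j l else 0) - (if i = l then c k j else 0)"
    and b_c: "\<lbrakk>i \<in> {1..n}; j \<in> {1..n}; k \<in> {1..n}; l \<in> {1..n}\<rbrakk> \<Longrightarrow>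
      b i j * c k l - c k l * b i j = (if j = l then a i k else 0) + (if i = k then a j l else 0)
        - (if i = l then a j k else 0) - (if j = k then a i l else 0)"

lemma orthogonal_relations_entries:
  "orthogonal_relations CARD('n) a_entry b_entry (c_entry :: nat \<Rightarrow> nat \<Rightarrow> 'n::finite o2n uea)"
proof
  fix i j k l :: nat
  let ?n = "CARD('n)"
  let ?neg = "neg_index ?n"
  assume r: "i \<in> {1..?n}" "j \<in> {1..?n}" "k \<in> {1..?n}" "l \<in> {1..?n}"
  then have r2: "i \<in> {1..2 * ?n}" "j \<in> {1..2 * ?n}" "k \<in> {1..2 * ?n}" "l \<in> {1..2 * ?n}" by auto
  note neg_r = r2[THEN neg_index_in]
  note nn = r2[THEN neg_index_neg]
  have ne: "?neg p \<noteq> q" "q \<noteq> ?neg p" "?neg p = ?neg q \<longleftrightarrow> p = q"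
    if "p \<in> {1..?n}" "q \<in> {1..?n}" for p q
    using that by (auto simp: neg_index_def)
  note ne_r = ne[OF r(1) r(2)] ne[OF r(1) r(3)] ne[OF r(1) r(4)] ne[OF r(2) r(1)] ne[OF r(2) r(3)]
      ne[OF r(2) r(4)]
     ne[OF r(3) r(1)] ne[OF r(3) r(2)] ne[OF r(3) r(4)] ne[OF r(4) r(1)] ne[OF r(4) r(2)]
         ne[OF r(4) r(3)]
  show "a_entry i j * a_entry k l - a_entry k l * (a_entry i j :: 'n o2n uea)
      = (if j = k then a_entry i l else 0) - (if i = l then a_entry k j else 0)"
    using X_entry_commutator[OF r2(1,2,3,4)] by (simp add: a_entry_def ne_r)
  show "a_entry i j * b_entry k l - b_entry k l * (a_entry i j :: 'n o2n uea)
      = (if j = k then b_entry i l else 0) + (if j = l then b_entry k i else 0)"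
    using X_entry_commutator[OF r2(1,2,3) neg_r(4)]
      by (simp add: a_entry_def b_entry_def ne_r eq_commute[of l j])
  show "a_entry i j * c_entry k l - c_entry k l * (a_entry i j :: 'n o2n uea)
      = - (if i = k then c_entry j l else 0) - (if i = l then c_entry k j else 0)"
    using X_entry_commutator[OF r2(1,2) neg_r(4) r2(3)] by (simp add: a_entry_def c_entry_def ne_r)
  show "b_entry i j * c_entry k l - c_entry k l * (b_entry i j :: 'n o2n uea)
      = (if j = l then a_entry i k else 0) + (if i = k then a_entry j l else 0)
        - (if i = l then a_entry j k else 0) - (if j = k then a_entry i l else 0)"
    using X_entry_commutator[OF r2(1) neg_r(2,4) r2(3)]
    unfolding X_entry_neg[OF r2(2,4)] X_entry_neg[OF r2(1,4)]
    by (simp add: a_entry_def b_entry_def c_entry_def ne_r nn eq_commute[of k j])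
qed

section \<open>The rescaled sl2-triple of quadratic elements\<close>

lemma gen_quad_swap:
  fixes i j k l :: nat
  shows "gen i * gen j * (gen k * gen l) = - (gen j * gen i * (gen k * gen l))"
  "gen i * gen j * (gen k * gen l) = - (gen i * gen k * (gen j * gen l))"
  "gen i * gen j * (gen k * gen l) = - (gen i * gen j * (gen l * gen k))"
proof -
  show "gen i * gen j * (gen k * gen l) = - (gen j * gen i * (gen k * gen l))"
    by (simp only: gen_anticommute[of i j] minus_mult_left[symmetric])
  have "gen i * gen j * (gen k * gen l) = gen i * (gen j * gen k) * gen l"
    by (simp only: mult.assoc)
  also have "\<dots> = - (gen i * gen k * (gen j * gen l))"
    unfolding gen_anticommute[of j k] by (simp add: mult.assoc)
  finally show "gen i * gen j * (gen k * gen l) = - (gen i * gen k * (gen j * gen l))" .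
  show "gen i * gen j * (gen k * gen l) = - (gen i * gen j * (gen l * gen k))"
    by (simp only: gen_anticommute[of k l] minus_mult_right[symmetric])
qed

lemma gen_pair_commute: "gen i * gen j * gen k = gen k * (gen i * gen j)"
proof -
  have "gen i * gen j * gen k = - (gen i * gen k * gen j)"
    by (simp only: mult.assoc gen_anticommute[of j k] minus_mult_right[symmetric])
  also have "\<dots> = gen k * (gen i * gen j)"
    by (simp only: gen_anticommute[of i k] minus_mult_left[symmetric] minus_minus mult.assoc)
  finally show ?thesis .
qed

lemma gen_quad_swap13: "gen i * gen j * (gen k * gen l) = - (gen k * gen j * (gen i * gen l))"
  by (simp only: gen_quad_swap(1)[of i j] gen_quad_swap(2)[of j i] gen_quad_swap(1)[of j k]
      minus_minus)

lemma gen_quad_swap24: "gen i * gen j * (gen k * gen l) = - (gen i * gen l * (gen k * gen j))"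
  by (simp only: gen_quad_swap(2)[of i j] gen_quad_swap(3)[of i k j l] gen_quad_swap(2)[of i k l j]
      minus_minus)

lemma gen_quad_swap14: "gen i * gen j * (gen k * gen l) = - (gen l * gen j * (gen k * gen i))"
  by (simp only: gen_quad_swap(3)[of i j k l] gen_quad_swap13[of i j l k]
      gen_quad_swap(3)[of l j i k] minus_minus)

lemma commute_mult: "x * y = y * x \<Longrightarrow> x * z = z * x \<Longrightarrow> x * (y * z)
    = y * z * (x :: 'r::semigroup_mult)"
  by (metis mult.assoc)

lemma commute_left: "x * y = y * x \<Longrightarrow> x * (y * z) = y * (x * (z :: 'r::semigroup_mult))"
  by (metis mult.assoc)

lemma gen_pair_pair_commute: "gen i * gen j * (gen k * gen l) = gen k * gen l * (gen i * gen j)"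
  by (rule commute_mult[OF gen_pair_commute gen_pair_commute])

lemma gen_pair_scal: "gen i * gen j * scal x = scal x * (gen i * gen j)"
  by (rule commute_mult[OF gen_scal[symmetric] gen_scal[symmetric], symmetric])

text \<open>
  The commutator of two sums whose generator parts \<open>u\<close>, \<open>v\<close> commute only involves commutators of
  coefficients.
\<close>

lemma commutator_sum:
  fixes u v :: "nat \<Rightarrow> nat \<Rightarrow> 'a::complex_algebra_1 exterior"
  assumes "\<And>i j k l. u i j * v k l = v k l * u i j"
    and "\<And>i j x. u i j * scal x = scal x * u i j" and "\<And>i j x. v i j * scal x = scal x * v i j"
  shows "(\<Sum>i\<in>S. \<Sum>j\<in>S. scal (x i j) * u i j) * (\<Sum>k\<in>S. \<Sum>l\<in>S. scal (y k l) * v k l)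
      - (\<Sum>k\<in>S. \<Sum>l\<in>S. scal (y k l) * v k l) * (\<Sum>i\<in>S. \<Sum>j\<in>S. scal (x i j) * u i j)
    = (\<Sum>i\<in>S. \<Sum>j\<in>S. \<Sum>k\<in>S. \<Sum>l\<in>S. scal (x i j * y k l - y k l * x i j) * (u i j * v k l))"
proof -
  let ?A = "\<Sum>i\<in>S. \<Sum>j\<in>S. scal (x i j) * u i j"
  let ?B = "\<Sum>k\<in>S. \<Sum>l\<in>S. scal (y k l) * v k l"
  have 1: "scal (x i j) * u i j * (scal (y k l) * v k l) - scal (y k l) * v k l
      * (scal (x i j) * u i j)
      = scal (x i j * y k l - y k l * x i j) * (u i j * v k l)" for i j k l
    unfolding scal_diff scal_mult left_diff_distrib mult_interchange[OF assms(2)]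
        mult_interchange[OF assms(3)]
    by (simp only: assms(1))
  have "?A * ?B = (\<Sum>i\<in>S. \<Sum>j\<in>S. scal (x i j) * u i j * ?B)"
    by (simp only: sum_distrib_right)
  moreover have "?B * ?A = (\<Sum>i\<in>S. \<Sum>j\<in>S. ?B * (scal (x i j) * u i j))"
    by (simp only: sum_distrib_left)
  ultimately have "?A * ?B - ?B * ?A = (\<Sum>i\<in>S. \<Sum>j\<in>S. scal (x i j) * u i j * ?B
      - ?B * (scal (x i j) * u i j))"
    by (simp only: sum_subtractf)
  also have "\<dots> = (\<Sum>i\<in>S. \<Sum>j\<in>S. \<Sum>k\<in>S. \<Sum>l\<in>S.
      scal (x i j) * u i j * (scal (y k l) * v k l) - scal (y k l) * v k l
          * (scal (x i j) * u i j))"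
    by (simp only: sum_distrib_left sum_distrib_right sum_subtractf)
  finally show ?thesis by (simp only: 1)
qed

lemma sum_if_const: "(\<Sum>l\<in>S. if P then t l else 0)
    = (if P then \<Sum>l\<in>S. t l else (0 :: 'b::comm_monoid_add))"
  by simp

lemma sum_if_mem: "(\<Sum>i\<in>S. if i \<in> S then t i else 0) = (\<Sum>i\<in>S. (t i :: 'b::comm_monoid_add))"
  by (rule sum.cong) auto

lemma sum_mult_sum2:
  fixes t :: "nat \<Rightarrow> 'b::semiring_0"
  shows "(\<Sum>j\<in>S. t j) * (\<Sum>i\<in>S. \<Sum>l\<in>S. s i l) = (\<Sum>i\<in>S. \<Sum>j\<in>S. \<Sum>l\<in>S. t j * s i l)"
    and "(\<Sum>j\<in>S. t j) * (\<Sum>i\<in>S. \<Sum>l\<in>S. s i l) = (\<Sum>j\<in>S. \<Sum>i\<in>S. \<Sum>l\<in>S. t j * s i l)"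
    and "(\<Sum>j\<in>S. t j) * (\<Sum>i\<in>S. \<Sum>l\<in>S. s i l) = (\<Sum>j\<in>S. \<Sum>l\<in>S. \<Sum>i\<in>S. t j * s i l)"
    and "(\<Sum>j\<in>S. t j) * (\<Sum>i\<in>S. \<Sum>l\<in>S. s i l) = (\<Sum>l\<in>S. \<Sum>j\<in>S. \<Sum>i\<in>S. t j * s i l)"
proof -
  let ?P = "(\<Sum>j\<in>S. t j) * (\<Sum>i\<in>S. \<Sum>l\<in>S. s i l)"
  have *: "?P = (\<Sum>j\<in>S. \<Sum>i\<in>S. \<Sum>l\<in>S. t j * s i l)"
    by (simp only: sum_distrib_right) (simp only: sum_distrib_left)
  then show "?P = (\<Sum>j\<in>S. \<Sum>i\<in>S. \<Sum>l\<in>S. t j * s i l)" .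
  show "?P = (\<Sum>i\<in>S. \<Sum>j\<in>S. \<Sum>l\<in>S. t j * s i l)"
    unfolding * by (rule sum.swap)
  show "?P = (\<Sum>j\<in>S. \<Sum>l\<in>S. \<Sum>i\<in>S. t j * s i l)"
    unfolding * by (rule sum.cong[OF refl]) (rule sum.swap)
  then show "?P = (\<Sum>l\<in>S. \<Sum>j\<in>S. \<Sum>i\<in>S. t j * s i l)"
    by (rule trans) (rule sum.swap)
qed

context orthogonal_relations
begin

text \<open>\<open>f i\<close> is the generator with index \<open>-i\<close>.\<close>

abbreviation e :: "nat \<Rightarrow> 'a exterior" where "e i \<equiv> gen i"
abbreviation f :: "nat \<Rightarrow> 'a exterior" where "f i \<equiv> gen (neg_index n i)"

text \<open>
  \<open>\<tau>\<close> and \<open>H\<close> belong to the triple; its other members are \<open>E = -1/2 C\<close> and \<open>F = 1/2 B\<close>.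
\<close>

definition \<tau> :: "'a exterior" where "\<tau> = (\<Sum>i\<in>{1..n}. e i * f i)"
definition H :: "'a exterior" where "H = (\<Sum>i\<in>{1..n}. \<Sum>j\<in>{1..n}. scal (a i j) * (e i * f j))"
definition B :: "'a exterior" where "B = (\<Sum>i\<in>{1..n}. \<Sum>j\<in>{1..n}. scal (b i j) * (e i * e j))"
definition C :: "'a exterior" where "C = (\<Sum>i\<in>{1..n}. \<Sum>j\<in>{1..n}. scal (c i j) * (f i * f j))"

lemma tau_scal: "\<tau> * scal x = scal x * \<tau>"
  by (simp add: \<tau>_def sum_distrib_left sum_distrib_right gen_pair_scal)

lemma tau_gen: "\<tau> * gen k = gen k * \<tau>"
  by (simp add: \<tau>_def sum_distrib_left sum_distrib_right gen_pair_commute)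

lemma tau_pair_sum: "\<tau> * (\<Sum>i\<in>S. \<Sum>j\<in>T. scal (x i j) * (gen (p i) * gen (q j)))
    = (\<Sum>i\<in>S. \<Sum>j\<in>T. scal (x i j) * (gen (p i) * gen (q j))) * \<tau>"
proof -
  have "\<tau> * (scal (x i j) * (gen (p i) * gen (q j))) = scal (x i j) * (gen (p i) * gen (q j))
      * \<tau>" for i j
    by (rule commute_mult[OF tau_scal commute_mult[OF tau_gen tau_gen]])
  then show ?thesis by (simp only: sum_distrib_left sum_distrib_right)
qed

lemma tau_H: "\<tau> * H = H * \<tau>" and tau_B: "\<tau> * B = B * \<tau>" and tau_C: "\<tau> * C = C * \<tau>"
  unfolding H_def B_def C_def by (rule tau_pair_sum)+

lemma scal_delta:
  "scal (if P then x else 0) * (y :: 'a exterior) = (if P then scal x * y else 0)"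
  "scal (- (if P then x else 0)) * (y :: 'a exterior) = (if P then - (scal x * y) else 0)"
  by (simp_all add: scal_0 scal_minus)

lemma scal_tau_term: "scal x * - (e j * f j * y) = - (e j * f j * (scal x * y))"
  "scal x * (e j * f j * y) = (e j * f j * (scal x * y))"
  by (simp_all only: mult_minus_right commute_left[OF gen_pair_scal[symmetric]])

lemma H_B: "H * B - B * H = - (2 * (\<tau> * B))"
proof -
  have "H * B - B * H = (\<Sum>i\<in>{1..n}. \<Sum>j\<in>{1..n}. \<Sum>k\<in>{1..n}. \<Sum>l\<in>{1..n}.
      scal (a i j * b k l - b k l * a i j) * (e i * f j * (e k * e l)))"
    unfolding H_def B_def by (rule commutator_sum) (rule gen_pair_pair_commute gen_pair_scal)+
  also have "\<dots> = (\<Sum>i\<in>{1..n}. \<Sum>j\<in>{1..n}. \<Sum>k\<in>{1..n}. \<Sum>l\<in>{1..n}.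
      (if j = k then scal (b i l) * (e i * f j * (e k * e l)) else 0)
      + (if j = l then scal (b k i) * (e i * f j * (e k * e l)) else 0))"
    by (intro sum.cong refl) (simp only: a_b scal_add distrib_right scal_delta)
  also have "\<dots> = (\<Sum>i\<in>{1..n}. \<Sum>j\<in>{1..n}. \<Sum>l\<in>{1..n}. scal (b i l) * (e i * f j * (e j * e l)))
      + (\<Sum>i\<in>{1..n}. \<Sum>j\<in>{1..n}. \<Sum>k\<in>{1..n}. scal (b k i) * (e i * f j * (e k * e j)))"
    by (simp only: sum.distrib sum_if_const sum.delta' sum.delta finite_atLeastAtMost sum_if_mem)
  also have "(\<Sum>i\<in>{1..n}. \<Sum>j\<in>{1..n}. \<Sum>l\<in>{1..n}. scal (b i l) * (e i * f j * (e j * e l)))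
      = - (\<tau> * B)"
    by (subst gen_quad_swap13) (simp only: scal_tau_term \<tau>_def B_def sum_mult_sum2(1) sum_negf)
  also have "(\<Sum>i\<in>{1..n}. \<Sum>j\<in>{1..n}. \<Sum>k\<in>{1..n}. scal (b k i) * (e i * f j * (e k * e j)))
      = - (\<tau> * B)"
    by (subst gen_quad_swap14) (simp only: scal_tau_term \<tau>_def B_def sum_mult_sum2(4) sum_negf)
  finally show ?thesis by (simp add: mult_2)
qed

lemma H_C: "H * C - C * H = 2 * (\<tau> * C)"
proof -
  have "H * C - C * H = (\<Sum>i\<in>{1..n}. \<Sum>j\<in>{1..n}. \<Sum>k\<in>{1..n}. \<Sum>l\<in>{1..n}.
      scal (a i j * c k l - c k l * a i j) * (e i * f j * (f k * f l)))"
    unfolding H_def C_def by (rule commutator_sum) (rule gen_pair_pair_commute gen_pair_scal)+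
  also have "\<dots> = (\<Sum>i\<in>{1..n}. \<Sum>j\<in>{1..n}. \<Sum>k\<in>{1..n}. \<Sum>l\<in>{1..n}.
      (if i = k then - (scal (c j l) * (e i * f j * (f k * f l))) else 0)
      - (if i = l then scal (c k j) * (e i * f j * (f k * f l)) else 0))"
    by (intro sum.cong refl) (simp only: a_c scal_diff left_diff_distrib scal_delta)
  also have "\<dots> = - (\<Sum>i\<in>{1..n}. \<Sum>j\<in>{1..n}. \<Sum>l\<in>{1..n}. scal (c j l) * (e i * f j * (f i * f l)))
      - (\<Sum>i\<in>{1..n}. \<Sum>j\<in>{1..n}. \<Sum>k\<in>{1..n}. scal (c k j) * (e i * f j * (f k * f i)))"
    by (simp only: sum_subtractf sum_negf[symmetric] sum_if_const sum.delta' sum.delta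
        finite_atLeastAtMost sum_if_mem)
  also have "(\<Sum>i\<in>{1..n}. \<Sum>j\<in>{1..n}. \<Sum>l\<in>{1..n}. scal (c j l) * (e i * f j * (f i * f l)))
      = - (\<tau> * C)"
    by (subst gen_quad_swap(2)) (simp only: scal_tau_term \<tau>_def C_def sum_mult_sum2(2) sum_negf)
  also have "(\<Sum>i\<in>{1..n}. \<Sum>j\<in>{1..n}. \<Sum>k\<in>{1..n}. scal (c k j) * (e i * f j * (f k * f i)))
      = - (\<tau> * C)"
    by (subst gen_quad_swap24) (simp only: scal_tau_term \<tau>_def C_def sum_mult_sum2(3) sum_negf)
  finally show ?thesis by (simp add: mult_2)
qed

lemma quad_to_tau1: "e i * e j * (f k * f j) = - (e j * f j * (e i * f k))"
  by (simp only: gen_quad_swap24[of i j "neg_index n k" "neg_index n j"]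
      gen_quad_swap14[of i "neg_index n j" "neg_index n k" j] gen_quad_swap(3)[of j "neg_index n j"
          "neg_index n k" i] minus_minus)

lemma quad_to_tau2: "e i * e j * (f k * f i) = e i * f i * (e j * f k)"
  by (simp only: gen_quad_swap24[of i j "neg_index n k" "neg_index n i"]
      gen_quad_swap(3)[of i "neg_index n i" "neg_index n k" j] minus_minus)

lemma quad_to_tau3: "e i * e j * (f j * f l) = e j * f j * (e i * f l)"
  by (simp only: gen_quad_swap13[of i j "neg_index n j" "neg_index n l"]
      gen_quad_swap(1)[of "neg_index n j" j i "neg_index n l"] minus_minus)

lemma B_C: "B * C - C * B = - (4 * (\<tau> * H))"
proof -
  have "B * C - C * B = (\<Sum>i\<in>{1..n}. \<Sum>j\<in>{1..n}. \<Sum>k\<in>{1..n}. \<Sum>l\<in>{1..n}.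
      scal (b i j * c k l - c k l * b i j) * (e i * e j * (f k * f l)))"
    unfolding B_def C_def by (rule commutator_sum) (rule gen_pair_pair_commute gen_pair_scal)+
  also have "\<dots> = (\<Sum>i\<in>{1..n}. \<Sum>j\<in>{1..n}. \<Sum>k\<in>{1..n}. \<Sum>l\<in>{1..n}.
      (if j = l then scal (a i k) * (e i * e j * (f k * f l)) else 0)
      + (if i = k then scal (a j l) * (e i * e j * (f k * f l)) else 0)
      - (if i = l then scal (a j k) * (e i * e j * (f k * f l)) else 0)
      - (if j = k then scal (a i l) * (e i * e j * (f k * f l)) else 0))"
    by (intro sum.cong refl) (simp only: b_c scal_diff scal_add left_diff_distrib
        distrib_right scal_delta)
  also have "\<dots> = (\<Sum>i\<in>{1..n}. \<Sum>j\<in>{1..n}. \<Sum>k\<in>{1..n}. scal (a i k) * (e i * e j * (f k * f j)))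
      + (\<Sum>i\<in>{1..n}. \<Sum>j\<in>{1..n}. \<Sum>l\<in>{1..n}. scal (a j l) * (e i * e j * (f i * f l)))
      - (\<Sum>i\<in>{1..n}. \<Sum>j\<in>{1..n}. \<Sum>k\<in>{1..n}. scal (a j k) * (e i * e j * (f k * f i)))
      - (\<Sum>i\<in>{1..n}. \<Sum>j\<in>{1..n}. \<Sum>l\<in>{1..n}. scal (a i l) * (e i * e j * (f j * f l)))"
    by (simp only: sum_subtractf sum.distrib sum_if_const sum.delta' sum.delta
        finite_atLeastAtMost sum_if_mem)
  also have "(\<Sum>i\<in>{1..n}. \<Sum>j\<in>{1..n}. \<Sum>k\<in>{1..n}. scal (a i k) * (e i * e j * (f k * f j)))
      = - (\<tau> * H)"
    by (subst quad_to_tau1) (simp only: scal_tau_term \<tau>_def H_def sum_mult_sum2(1) sum_negf)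
  also have "(\<Sum>i\<in>{1..n}. \<Sum>j\<in>{1..n}. \<Sum>l\<in>{1..n}. scal (a j l) * (e i * e j * (f i * f l)))
      = - (\<tau> * H)"
    by (subst gen_quad_swap(2)) (simp only: scal_tau_term \<tau>_def H_def sum_mult_sum2(2) sum_negf)
  also have "(\<Sum>i\<in>{1..n}. \<Sum>j\<in>{1..n}. \<Sum>k\<in>{1..n}. scal (a j k) * (e i * e j * (f k * f i))) = \<tau> * H"
    by (subst quad_to_tau2) (simp only: scal_tau_term \<tau>_def H_def sum_mult_sum2(2))
  also have "(\<Sum>i\<in>{1..n}. \<Sum>j\<in>{1..n}. \<Sum>l\<in>{1..n}. scal (a i l) * (e i * e j * (f j * f l))) = \<tau> * H"
    by (subst quad_to_tau3) (simp only: scal_tau_term \<tau>_def H_def sum_mult_sum2(1))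
  moreover have "4 * x = x + x + x + x" for x :: "'a exterior"
  proof -
    have "4 * x = 2 * (2 * x)" by (simp add: mult.assoc[symmetric])
    then show ?thesis by (simp add: mult_2 add.assoc)
  qed
  ultimately show ?thesis by simp
qed

definition E :: "'a exterior" where "E = (- (1 / 2)) *\<^sub>C C"
definition F :: "'a exterior" where "F = (1 / 2) *\<^sub>C B"

lemma two_eq_scaleC: "2 * x = 2 *\<^sub>C (x :: 'a exterior)" "4 * x = 4 *\<^sub>C (x :: 'a exterior)"
  using of_int_mult_eq_scaleC[of 2 x] of_int_mult_eq_scaleC[of 4 x] by simp_all

sublocale scaled_sl2 E F H \<tau>
proof
  have HC: "C * H = H * C - 2 *\<^sub>C (\<tau> * C)" and HB: "B * H = H * B + 2 *\<^sub>C (\<tau> * B)"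
    and BC: "B * C = C * B - 4 *\<^sub>C (\<tau> * H)"
    using H_C H_B B_C unfolding two_eq_scaleC by (simp_all add: algebra_simps)
  show "E * H = (H - 2 * \<tau>) * E"
    by (simp add: E_def mult_scaleC_left mult_scaleC_right HC left_diff_distrib two_eq_scaleC
        scaleC.scale_right_diff_distrib)
  show "F * H = (H + 2 * \<tau>) * F"
    by (simp add: F_def mult_scaleC_left mult_scaleC_right HB distrib_right two_eq_scaleC
        scaleC.scale_right_distrib)
  show "F * E = E * F + \<tau> * H"
    by (simp add: E_def F_def mult_scaleC_left mult_scaleC_right BC scaleC.scale_right_diff_distrib)
  show "\<tau> * E = E * \<tau>" "\<tau> * F = F * \<tau>"
    by (simp_all add: E_def F_def mult_scaleC_left mult_scaleC_right tau_B tau_C)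
  show "\<tau> * H = H * \<tau>" by (rule tau_H)
qed

end

section \<open>Signs and degrees\<close>

lemma sum_atLeast1_atMost_double:
  "(\<Sum>i\<in>{1..2 * n}. t i) = (\<Sum>i\<in>{1..n}. t i) + (\<Sum>i\<in>{1..n}. t (neg_index n i) :: 'b::comm_monoid_add)"
proof -
  have "{1..2 * n} = {1..n} \<union> {n + 1..2 * n}" by auto
  then have "(\<Sum>i\<in>{1..2 * n}. t i) = (\<Sum>i\<in>{1..n}. t i) + (\<Sum>i\<in>{n + 1..2 * n}. t i)"
    by (simp only:) (rule sum.union_disjoint, auto)
  also have "(\<Sum>i\<in>{n + 1..2 * n}. t i) = (\<Sum>i\<in>{1..n}. t (neg_index n i))"
    by (rule sum.reindex_bij_witness[of _ "neg_index n" "neg_index n"]) (auto simp: neg_index_def)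
  finally show ?thesis .
qed

text \<open>
  The sign \<open>(-1)\<close> to the power \<open>m(m-1)/2\<close> of the reversal of \<open>m\<close> letters.
\<close>

definition tri_sign :: "nat \<Rightarrow> 'b::ring_1" where
  "tri_sign m = (- 1) ^ (\<Sum>k<m. k)"

lemma tri_sign_0: "tri_sign 0 = 1" by (simp add: tri_sign_def)

lemma tri_sign_Suc: "tri_sign (Suc m) = (- 1) ^ m * tri_sign m"
  by (simp add: tri_sign_def power_add) (metis power_add add.commute)

lemma tri_sign_add_even: "tri_sign (m + 2 * k) = (- 1) ^ k * (tri_sign m :: 'b::ring_1)"
proof (induction k)
  case (Suc k)
  have "tri_sign (m + 2 * Suc k) = (- 1) ^ Suc (m + 2 * k)
      * ((- 1) ^ (m + 2 * k) * (tri_sign (m + 2 * k) :: 'b))"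
    by (simp add: tri_sign_Suc)
  also have "\<dots> = - tri_sign (m + 2 * k)"
    by (simp add: minus_one_power_iff)
  finally show ?case by (simp add: Suc)
qed simp

lemma minus_one_power_left_commute: "x * ((- 1) ^ k * y) = (- 1) ^ k * (x * (y :: 'b::ring_1))"
  by (simp add: minus_one_power_iff)

lemma tri_sign_left_commute: "x * (tri_sign m * y) = tri_sign m * (x * (y :: 'b::ring_1))"
  by (simp add: tri_sign_def minus_one_power_left_commute)

lemma odd_prod_anticommute:
  assumes "\<And>i. g i * x = - (x * g i)"
  shows "odd_prod g m \<phi> * x = (- 1) ^ m * (x * odd_prod g m \<phi>)"
proof (induction m)
  case (Suc m)
  have "odd_prod g (Suc m) \<phi> * x = - (odd_prod g m \<phi> * x * g (\<phi> (Suc m)))"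
    by (simp add: seq_prod_Suc mult.assoc assms)
  then show ?case by (simp add: Suc seq_prod_Suc mult.assoc)
qed (simp add: seq_prod_0)

text \<open>
  In \<open>h\<^sub>1 g\<^sub>1 h\<^sub>2 g\<^sub>2 \<cdots>\<close>, all factors \<open>g\<^sub>i\<close> are moved to the right of the factors \<open>h\<^sub>j\<close>, with
  which they anticommute.
\<close>

lemma seq_prod_interleave:
  assumes "\<And>i k j. g i * h k j = - (h k j * g i)"
  shows "seq_prod (\<lambda>k j. h k j * g j) m \<phi> = tri_sign m * (seq_prod h m \<phi> * odd_prod g m \<phi>)"
proof (induction m)
  case (Suc m)
  let ?h = "h (Suc m) (\<phi> (Suc m))" and ?g = "g (\<phi> (Suc m))"
  have "seq_prod (\<lambda>k j. h k j * g j) (Suc m) \<phi> = tri_sign m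
      * (seq_prod h m \<phi> * (odd_prod g m \<phi> * ?h) * ?g)"
    by (simp add: seq_prod_Suc Suc mult.assoc)
  also have "odd_prod g m \<phi> * ?h = (- 1) ^ m * (?h * odd_prod g m \<phi>)"
    by (rule odd_prod_anticommute[OF assms])
  also have "tri_sign m * (seq_prod h m \<phi> * ((- 1) ^ m * (?h * odd_prod g m \<phi>)) * ?g)
      = (- 1) ^ m * tri_sign m * (seq_prod h (Suc m) \<phi> * odd_prod g (Suc m) \<phi>)"
    by (simp only: seq_prod_Suc mult.assoc minus_one_power_left_commute)
  finally show ?case by (simp only: tri_sign_Suc)
qed (simp add: seq_prod_0 tri_sign_0)

lemma odd_prod_reverse:
  assumes g: "odd_family g"
  shows "odd_prod g m (\<lambda>k. m + 1 - k) = tri_sign m * odd_prod g m (\<lambda>k. k)"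
proof (induction m)
  case (Suc m)
  have "odd_prod g (1 + m) (\<lambda>k. Suc m + 1 - k) = g (Suc m) * odd_prod g m (\<lambda>k. m + 1 - k)"
    unfolding seq_prod_add by (simp add: seq_prod_Suc seq_prod_0)
  also have "\<dots> = tri_sign m * (g (Suc m) * odd_prod g m (\<lambda>k. k))"
    by (simp only: Suc tri_sign_left_commute)
  also have "g (Suc m) * odd_prod g m (\<lambda>k. k) = (- 1) ^ m * odd_prod g (Suc m) (\<lambda>k. k)"
  proof -
    have "odd_prod g m (\<lambda>k. k) * g (Suc m) = (- 1) ^ m * (g (Suc m) * odd_prod g m (\<lambda>k. k))"
      by (rule odd_prod_anticommute) (rule odd_familyD(1)[OF g])
    then show ?thesis by (simp add: seq_prod_Suc minus_one_power_iff)
  qed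
  finally show ?case by (simp add: tri_sign_Suc minus_one_power_left_commute)
      (simp only: mult.assoc minus_one_power_left_commute)
qed (simp add: seq_prod_0 tri_sign_0)

lemma odd_prod_commute_even:
  assumes "\<And>i. g i * x = - (x * g i)"
  shows "odd_prod g (2 * k) \<phi> * x = x * odd_prod g (2 * k) \<phi>"
  using odd_prod_anticommute[OF assms, where m = "2 * k"] by simp

lemma odd_prod_complement:
  assumes g: "odd_family g" and I: "I \<subseteq> {1..n}" "I' \<subseteq> {1..n}" "card I' + card I = n"
  shows "odd_prod g (card I') (nth_of I') * odd_prod g (card I) (nth_of I)
    = (if I' = {1..n} - I then of_int (shuffle_sign I' I) * odd_prod g n (\<lambda>i. i) else 0)"
proof (cases "I' = {1..n} - I")
  case True
  then show ?thesis using shuffle_odd_prod[OF g, of n I' I] I by auto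
next
  case False
  have fin: "finite I" "finite I'" using I by (auto intro: finite_subset)
  have ne: "I' \<inter> I \<noteq> {}"
  proof
    assume *: "I' \<inter> I = {}"
    then have "card (I' \<union> I) = n" using fin I by (simp add: card_Un_disjoint)
    then have "I' \<union> I = {1..n}" using I by (intro card_subset_eq) auto
    then show False using * False by auto
  qed
  let ?L = "\<lambda>i. (sorted_list_of_set I' @ sorted_list_of_set I) ! (i - 1)"
  have "\<not> inj_on ?L {1..n}"
  proof
    assume "inj_on ?L {1..n}"
    then have "card (?L ` {1..n}) = n" by (simp add: card_image)
    moreover have "?L ` {1..n} \<subseteq> I' \<union> I"
    proof
      fix x assume "x \<in> ?L ` {1..n}"
      then obtain i where i: "i \<in> {1..n}" "x = ?L i" by blast
      then have "x \<in> set (sorted_list_of_set I' @ sorted_list_of_set I)"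
        using I by (auto intro!: nth_mem simp: fin simp del: set_append)
      then show "x \<in> I' \<union> I" using fin by simp
    qed
    ultimately have "n \<le> card (I' \<union> I)" using fin by (metis card_mono finite_UnI)
    moreover have "card (I' \<union> I) + card (I' \<inter> I) = n" using card_Un_Int[OF fin(2,1)] I by simp
    moreover have "card (I' \<inter> I) \<noteq> 0" using ne fin by simp
    ultimately show False by linarith
  qed
  then have "odd_prod g n ?L = 0" by (rule alternating_eq_0[OF alternating_odd_prod[OF g]])
  moreover have "odd_prod g n ?L = odd_prod g (card I') (nth_of I')
      * odd_prod g (card I) (nth_of I)"
    unfolding I(3)[symmetric] seq_prod_add
    by (intro arg_cong2[of _ _ _ _ "(*)"] seq_prod_cong arg_cong[of _ _ g])
        (auto simp: nth_append nth_of_def fin)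
  ultimately show ?thesis using False by simp
qed

lemma odd_family_gen: "odd_family (\<lambda>i. gen (p i))"
  unfolding odd_family_def using gen_anticommute gen_scal by blast

lemma odd_prod_gen_upto: "odd_prod gen N (\<lambda>i. i) = monomial {1..N} (1 :: 'a::complex_algebra_1)"
proof (induction N)
  case 0
  show ?case by (simp add: seq_prod_0 scal_def[symmetric] scal_1)
next
  case (Suc N)
  have "crossings {1..N} {Suc N} = 0"
    by (auto simp: crossings_def intro!: card_eq_0_iff[THEN iffD2])
  moreover have "{1..N} \<union> {Suc N} = {1..Suc N}" by auto
  moreover have "odd_prod gen (Suc N) (\<lambda>i. i) = monomial {1..N} 1 * monomial {Suc N} (1 :: 'a)"
    unfolding seq_prod_Suc Suc by (simp only: gen_def)
  ultimately show ?case
    by (simp add: monomial_mult merge_sign_def)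
qed

text \<open>
  Identities in the coefficient algebra may be checked on multiples of the top product.
\<close>

lemma scal_mult_top_inject:
  assumes "scal x * odd_prod gen N (\<lambda>i. i) = scal y * odd_prod gen N (\<lambda>i. i)"
  shows "x = (y :: 'a::complex_algebra_1)"
proof -
  have "coef (scal z * odd_prod gen N (\<lambda>i. i)) {1..N} = z" for z :: 'a
    unfolding odd_prod_gen_upto scal_def by (simp add: monomial_mult coef_monomial merge_sign_empty)
  then show ?thesis using assms by metis
qed

text \<open>
  Every monomial of \<open>x\<close> contains exactly \<open>d\<close> generators with index in \<open>A\<close>.
\<close>

definition homogeneous :: "nat set \<Rightarrow> nat \<Rightarrow> 'a::complex_algebra_1 exterior \<Rightarrow> bool" where
  "homogeneous A d x \<longleftrightarrow> (\<forall>S. coef x S \<noteq> 0 \<longrightarrow> card (S \<inter> A) = d)"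

lemma homogeneous_0: "homogeneous A d 0"
  by (simp add: homogeneous_def zero_exterior.rep_eq)

lemma homogeneous_add: "homogeneous A d x \<Longrightarrow> homogeneous A d y \<Longrightarrow> homogeneous A d (x + y)"
  by (auto simp: homogeneous_def plus_exterior.rep_eq) (metis add_0)

lemma homogeneous_scaleC: "homogeneous A d x \<Longrightarrow> homogeneous A d (r *\<^sub>C x)"
  by (auto simp: homogeneous_def scaleC_exterior.rep_eq) 

lemma homogeneous_sum: "(\<And>i. i \<in> S \<Longrightarrow> homogeneous A d (x i)) \<Longrightarrow> homogeneous A d (\<Sum>i\<in>S. x i)"
  by (induction S rule: infinite_finite_induct) (auto intro: homogeneous_0 homogeneous_add)

lemma homogeneous_mult:
  assumes "homogeneous A d x" "homogeneous A d' y"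
  shows "homogeneous A (d + d') (x * y)"
  unfolding homogeneous_def
proof (intro allI impI)
  fix S assume S: "coef (x * y) S \<noteq> 0"
  then have fin: "finite S" using coef_infinite by blast
  obtain T where T: "T \<subseteq> S" "coef x T * coef y (S - T) \<noteq> 0"
  proof -
    from S obtain T where "T \<in> Pow S" "merge_sign T (S - T) * (coef x T * coef y (S - T)) \<noteq> 0"
      unfolding coef_mult by (rule sum.not_neutral_contains_not_neutral)
    then show ?thesis by (intro that[of T]) auto
  qed
  then have "card (T \<inter> A) = d" "card ((S - T) \<inter> A) = d'"
    using assms mult_not_zero[OF T(2)] unfolding homogeneous_def by blast+
  moreover have "S \<inter> A = (T \<inter> A) \<union> ((S - T) \<inter> A)" using T by auto
  ultimately show "card (S \<inter> A) = d + d'"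
    using fin T by (simp only:) (subst card_Un_disjoint, auto intro: finite_subset)
qed

lemma homogeneous_scal: "homogeneous A 0 (scal x)"
  by (auto simp: homogeneous_def scal_def coef_monomial split: if_splits)

lemma homogeneous_gen: "homogeneous A (if i \<in> A then 1 else 0) (gen i)"
  by (auto simp: homogeneous_def gen_def coef_monomial split: if_splits)

lemma homogeneous_pair_sum:
  assumes "\<And>i. i \<in> S \<Longrightarrow> (if p i \<in> A then 1 else 0) = d" "\<And>j. j \<in> S \<Longrightarrow> (if q j \<in> A then 1 else 0) = d'"
  shows "homogeneous A (d + d') (\<Sum>i\<in>S. \<Sum>j\<in>S. scal (x i j) * (gen (p i) * gen (q j)))"
proof (intro homogeneous_sum)
  fix i j assume "i \<in> S" "j \<in> S"
  then show "homogeneous A (d + d') (scal (x i j) * (gen (p i) * gen (q j)))"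
    using homogeneous_mult[OF homogeneous_scal[of A "x i j"]
        homogeneous_mult[OF homogeneous_gen[of A "p i"] homogeneous_gen[of A "q j"]]] assms
    by simp
qed

lemma homogeneous_dpow:
  assumes "homogeneous A d x" shows "homogeneous A (k * d) (dpow x k)"
proof -
  have "homogeneous A (k * d) (x ^ k)"
  proof (induction k)
    case 0
    show ?case using homogeneous_scal[of A 1] by (simp add: scal_1)
  next
    case (Suc k)
    then show ?case using homogeneous_mult[OF assms Suc] by simp
  qed
  then show ?thesis by (simp add: dpow_def homogeneous_scaleC)
qed

lemma homogeneous_rising_dp:
  assumes "homogeneous A d \<tau>" "homogeneous A d Y"
  shows "homogeneous A (nat j * d) (rising_dp \<tau> Y j)"
proof -
  have "homogeneous A (k * d) (\<Prod>i\<leftarrow>[0..<k]. Y + of_nat i * \<tau>)" for k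
  proof (induction k)
    case 0
    show ?case using homogeneous_scal[of A 1] by (simp add: scal_1)
  next
    case (Suc k)
    have "homogeneous A d (Y + of_nat k * \<tau>)"
      unfolding of_nat_mult_eq_scaleC using assms by (intro homogeneous_add homogeneous_scaleC)
    from homogeneous_mult[OF Suc this] show ?case by (simp add: add.commute)
  qed
  then show ?thesis by (simp add: rising_dp_def homogeneous_scaleC homogeneous_0)
qed

lemma homogeneous_degree_bound:
  assumes "homogeneous A d x" "finite A" "card A < d" shows "x = 0"
proof (rule exterior_eqI)
  fix S
  have "card (S \<inter> A) \<le> card A" using assms(2) by (intro card_mono) auto
  then show "coef x S = coef 0 S"
    using assms(1,3) by (auto simp: homogeneous_def zero_exterior.rep_eq)
qed

lemma dpow_minus: "dpow (- x) k = (- 1) ^ k * dpow (x :: 'a::complex_algebra_1) k"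
  unfolding dpow_def power_minus[of x] by (simp add: mult_scaleC_right)

lemma nth_of_upto: "s \<in> {1..N} \<Longrightarrow> nth_of {1..N} s = s"
  unfolding nth_of_def atLeastLessThanSuc_atLeastAtMost[symmetric] sorted_list_of_set_range
  by (simp add: nth_upt del: upt_Suc)

lemma pfaffian_cong:
  assumes "\<And>i j. i \<in> {1..2 * m} \<Longrightarrow> j \<in> {1..2 * m} \<Longrightarrow> A i j = A' i j"
  shows "pfaffian m A = pfaffian m A'"
proof -
  have "A (\<sigma> (2 * k - 1)) (\<sigma> (2 * k)) = A' (\<sigma> (2 * k - 1)) (\<sigma> (2 * k))"
    if "\<sigma> permutes {1..2 * m}" "k \<in> {1..m}" for \<sigma> k
  proof (rule assms)
    show "\<sigma> (2 * k - 1) \<in> {1..2 * m}" "\<sigma> (2 * k) \<in> {1..2 * m}"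
      unfolding permutes_in_image[OF that(1)] using that(2) by auto
  qed
  then show ?thesis
    unfolding pfaffian_def
    by (intro arg_cong[of _ _ "scaleC _"] sum.cong refl arg_cong2[of _ _ _ _ "(*)"]
        arg_cong[of _ _ prod_list] map_cong) auto
qed

lemma col_det_cong:
  assumes "\<And>i j. i \<in> {1..m} \<Longrightarrow> j \<in> {1..m} \<Longrightarrow> \<Phi> i j = \<Phi>' i j"
  shows "col_det m \<Phi> = col_det m \<Phi>'"
proof -
  have "\<Phi> (\<sigma> k) k = \<Phi>' (\<sigma> k) k" if "\<sigma> permutes {1..m}" "k \<in> {1..m}" for \<sigma> k
    using that permutes_in_image[OF that(1)] by (intro assms) auto
  then show ?thesis
    unfolding col_det_def
    by (intro sum.cong refl arg_cong2[of _ _ _ _ "(*)"] arg_cong[of _ _ prod_list] map_cong) auto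
qed

section \<open>The normal form of the Pfaffian\<close>

context orthogonal_relations
begin

text \<open>
  \<open>\<alpha> j\<close> is the linear form given by column \<open>j\<close> of \<open>a\<close>, and \<open>\<eta> u j\<close> by column \<open>j\<close> of \<open>a\<close> plus
  \<open>u\<close> times the identity matrix.  The latter is \<open>0\<close> for indices outside
  \<open>{1..n}\<close>, where no commutation relations are available, so that \<open>eta_alternate\<close>
  holds for all indices.
\<close>

definition \<alpha> :: "nat \<Rightarrow> 'a exterior" where "\<alpha> j = (\<Sum>i\<in>{1..n}. scal (a i j) * e i)"

definition \<eta> :: "nat \<Rightarrow> nat \<Rightarrow> 'a exterior" where
  "\<eta> u j = (if j \<in> {1..n} then \<alpha> j + of_nat u * e j else 0)"

lemma linear_form_anticommute: "gen k * (\<Sum>i\<in>S. scal (x i) * gen i)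
    = - ((\<Sum>i\<in>S. scal (x i) * gen i) * gen k)"
  by (simp add: sum_distrib_left sum_distrib_right sum_negf[symmetric] mult.assoc
      commute_left[OF gen_scal] gen_anticommute[of k])

lemma gen_alpha: "gen k * \<alpha> j = - (\<alpha> j * gen k)"
  unfolding \<alpha>_def by (rule linear_form_anticommute)

lemma gen_eta: "gen k * \<eta> u j = - (\<eta> u j * gen k)"
  by (simp add: \<eta>_def distrib_left distrib_right gen_alpha of_nat_left_commute
      gen_anticommute[of k] mult.assoc)

lemma alpha_anticommutator:
  assumes i: "i \<in> {1..n}" and j: "j \<in> {1..n}"
  shows "\<alpha> i * \<alpha> j + \<alpha> j * \<alpha> i = \<alpha> j * e i + \<alpha> i * e j"
proof -
  have 1: "\<alpha> p * \<alpha> q = (\<Sum>k\<in>{1..n}. \<Sum>l\<in>{1..n}. scal (a k p * a l q) * (e k * e l))" for p q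
    by (simp only: \<alpha>_def sum_product mult_interchange[OF gen_scal] scal_mult)
  have "\<alpha> j * \<alpha> i = (\<Sum>k\<in>{1..n}. \<Sum>l\<in>{1..n}. scal (a l j * a k i) * (e l * e k))"
    unfolding 1 by (rule sum.swap)
  also have "\<dots> = (\<Sum>k\<in>{1..n}. \<Sum>l\<in>{1..n}. - (scal (a l j * a k i) * (e k * e l)))"
    by (intro sum.cong refl) (subst gen_anticommute, simp)
  finally have "\<alpha> i * \<alpha> j + \<alpha> j * \<alpha> i
      = (\<Sum>k\<in>{1..n}. \<Sum>l\<in>{1..n}. scal (a k i * a l j - a l j * a k i) * (e k * e l))"
    unfolding 1[of i j] by (simp add: sum.distrib[symmetric] scal_diff left_diff_distrib)
  also have "\<dots> = (\<Sum>k\<in>{1..n}. \<Sum>l\<in>{1..n}.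
      (if i = l then scal (a k j) * (e k * e l) else 0)
          - (if k = j then scal (a l i) * (e k * e l) else 0))"
    by (intro sum.cong refl) (simp only: a_a i j scal_diff left_diff_distrib scal_delta)
  also have "\<dots> = (\<Sum>k\<in>{1..n}. scal (a k j) * (e k * e i)) - (\<Sum>l\<in>{1..n}. scal (a l i) * (e j * e l))"
    by (simp only: sum_subtractf sum_if_const sum.delta' sum.delta finite_atLeastAtMost i j if_True)
  also have "\<dots> = \<alpha> j * e i - e j * \<alpha> i"
    by (simp only: \<alpha>_def sum_distrib_left sum_distrib_right mult.assoc commute_left[OF gen_scal])
  finally show ?thesis by (simp add: gen_alpha)
qed

text \<open>
  The antisymmetry behind the shift \<open>\<rho>\<close>: it holds because the parameter of the left factor exceeds
  that of the right factor by exactly one.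
\<close>

lemma eta_alternate: "\<eta> (Suc u) i * \<eta> u j = - (\<eta> (Suc u) j * \<eta> u i)"
proof (cases "i \<in> {1..n} \<and> j \<in> {1..n}")
  case True
  have exp: "\<eta> (Suc u) p * \<eta> u q = \<alpha> p * \<alpha> q + of_nat u * (\<alpha> p * e q) - of_nat (Suc u) * (\<alpha> q * e p)
      + of_nat (Suc u) * (of_nat u * (e p * e q))" if "p \<in> {1..n}" "q \<in> {1..n}" for p q
    using that by (simp only: \<eta>_def if_True distrib_left distrib_right of_nat_left_commute[of "\<alpha> p"]
       of_nat_left_commute[of "e p"] mult.assoc gen_alpha) (simp add: algebra_simps)
  have "\<eta> (Suc u) i * \<eta> u j + \<eta> (Suc u) j * \<eta> u i
      = (\<alpha> i * \<alpha> j + \<alpha> j * \<alpha> i) - (\<alpha> j * e i + \<alpha> i * e j)"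
    using True by (simp add: exp gen_anticommute[of j i] algebra_simps)
  then show ?thesis
    using True by (simp add: alpha_anticommutator eq_neg_iff_add_eq_0)
qed (auto simp: \<eta>_def)

lemma H_eq_sum_eta: "H + of_nat u * \<tau> = (\<Sum>j\<in>{1..n}. \<eta> u j * f j)"
proof -
  have "(\<Sum>j\<in>{1..n}. \<eta> u j * f j) = (\<Sum>j\<in>{1..n}. \<alpha> j * f j) + of_nat u * (\<Sum>j\<in>{1..n}. e j * f j)"
    by (simp add: \<eta>_def distrib_right sum.distrib sum_distrib_left mult.assoc)
  also have "(\<Sum>j\<in>{1..n}. \<alpha> j * f j) = H"
    unfolding H_def \<alpha>_def by (subst sum.swap) (simp only: sum_distrib_right mult.assoc)
  finally show ?thesis by (simp add: \<tau>_def)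
qed

lemma rising_product_reversed:
  "seq_prod (\<lambda>k _. H + of_nat (r - k) * \<tau>) r v = (\<Prod>i\<leftarrow>[0..<r]. H + of_nat i * \<tau>)"
proof (induction r)
  case (Suc r)
  have comm: "(H + of_nat i * \<tau>) * (H + of_nat j * \<tau>)
      = (H + of_nat j * \<tau>) * (H + of_nat i * \<tau>)" for i j
    by (simp add: of_nat_mult_eq_scaleC distrib_left distrib_right mult_scaleC_left
        mult_scaleC_right tau_H
        scaleC.scale_right_distrib scaleC.scale_scale add_ac mult.commute)
  have comm': "(\<Prod>i\<leftarrow>[0..<r]. H + of_nat i * \<tau>) * (H + of_nat j * \<tau>)
      = (H + of_nat j * \<tau>) * (\<Prod>i\<leftarrow>[0..<r]. H + of_nat i * \<tau>)" for j r
  proof (induction r)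
    case (Suc r)
    then show ?case by (simp add: commute_mult[OF Suc[symmetric] comm])
  qed simp
  have "seq_prod (\<lambda>k _. H + of_nat (Suc r - k) * \<tau>) (1 + r) v
      = (H + of_nat r * \<tau>) * seq_prod (\<lambda>k _. H + of_nat (r - k) * \<tau>) r v"
    unfolding seq_prod_add by (simp add: seq_prod_Suc seq_prod_0) (simp add: seq_prod_def)
  then show ?case by (simp add: Suc comm')
qed (simp add: seq_prod_0)

text \<open>
  The factors \<open>H + u\<tau>\<close> commute, and are arranged with decreasing parameters \<open>u = r-1, \<dots>, 0\<close>, as in
  \<open>\<rho>(r)\<close>.  Then both \<open>\<eta>\<close>-products and \<open>f\<close>-products alternate, so all \<open>r!\<close> rearrangements of the
  columns in \<open>J\<close> contribute the same.
\<close>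

lemma rising_dp_H:
  "rising_dp \<tau> H (int r) = tri_sign r * (\<Sum>J | J \<subseteq> {1..n} \<and> card J = r. \<Sum>I | I \<subseteq> {1..n} \<and> card I = r.
     scal (col_det r (\<lambda>s t. a (nth_of I s) (nth_of J t) + of_nat (r - t) * (if nth_of I s
         = nth_of J t then 1 else 0)))
     * odd_prod e r (nth_of I) * odd_prod f r (nth_of J))"
proof -
  let ?h = "\<lambda>k. \<eta> (r - k)"
  have alt: "alternating r (seq_prod ?h r)"
  proof (rule alternating_seq_prod)
    fix k i j assume "1 \<le> k" "k < r"
    then have *: "r - k = Suc (r - Suc k)" by simp
    show "\<eta> (r - k) i * \<eta> (r - Suc k) j = - (\<eta> (r - k) j * \<eta> (r - Suc k) i)"
      unfolding * by (rule eta_alternate)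
  qed
  have "rising_dp \<tau> H (int r) = (1 / fact r) *\<^sub>C seq_prod (\<lambda>k _. \<Sum>j\<in>{1..n}. ?h k j * f j) r id"
    unfolding H_eq_sum_eta[symmetric] rising_product_reversed
    by (simp only: rising_dp_def nat_int of_nat_less_0_iff if_False)
  also have "seq_prod (\<lambda>k _. \<Sum>j\<in>{1..n}. ?h k j * f j) r id
      = (\<Sum>\<phi>\<in>PiE {1..r} (\<lambda>_. {1..n}). (tri_sign r * seq_prod ?h r \<phi>) * odd_prod f r \<phi>)"
    by (simp only: seq_prod_sum seq_prod_interleave[of f ?h, OF gen_eta] mult.assoc)
  also have "\<dots> = (\<Sum>J | J \<subseteq> {1..n} \<and> card J = r. (\<Sum>\<sigma> | \<sigma> permutes {1..r}. of_int (sign \<sigma>)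
      * (tri_sign r * seq_prod ?h r (nth_of J \<circ> \<sigma>))) * odd_prod f r (nth_of J))"
    by (rule alternating_sum[OF alternating_odd_prod[OF odd_family_gen] finite_atLeastAtMost])
      (intro arg_cong[of _ _ "(*) (tri_sign r)"] seq_prod_cong, simp)
  also have "\<dots> = (\<Sum>J | J \<subseteq> {1..n} \<and> card J = r. of_nat (fact r)
      * (tri_sign r * seq_prod ?h r (nth_of J)) * odd_prod f r (nth_of J))"
  proof (intro sum.cong refl arg_cong2[of _ _ _ _ "(*)"])
    fix J
    have "of_int (sign \<sigma>) * (tri_sign r * seq_prod ?h r (nth_of J \<circ> \<sigma>))
        = tri_sign r * seq_prod ?h r (nth_of J)"
      if "\<sigma> permutes {1..r}" for \<sigma>
    proof -
      have s: "of_int (sign \<sigma>) * (of_int (sign \<sigma>) * x) = (x :: 'a exterior)" for x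
        by (simp add: sign_def)
      show ?thesis by (simp only: alternating_permutes[OF alt that] tri_sign_left_commute s)
    qed
    then have "(\<Sum>\<sigma> | \<sigma> permutes {1..r}. of_int (sign \<sigma>)
        * (tri_sign r * seq_prod ?h r (nth_of J \<circ> \<sigma>)))
        = of_nat (card {\<sigma>. \<sigma> permutes {1..r}}) * (tri_sign r * seq_prod ?h r (nth_of J))"
      by simp
    also have "card {\<sigma>. \<sigma> permutes {1..r}} = fact r"
      by (rule card_permutations) simp_all
    finally show "(\<Sum>\<sigma> | \<sigma> permutes {1..r}. of_int (sign \<sigma>)
        * (tri_sign r * seq_prod ?h r (nth_of J \<circ> \<sigma>)))
        = of_nat (fact r) * (tri_sign r * seq_prod ?h r (nth_of J))" .
  qed
  also have "(1 / fact r) *\<^sub>C \<dots> = tri_sign r * (\<Sum>J | J \<subseteq> {1..n} \<and> card J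
      = r. seq_prod ?h r (nth_of J) * odd_prod f r (nth_of J))"
    by (simp add: scaleC.scale_sum_right sum_distrib_left of_nat_mult_eq_scaleC
        mult_scaleC_left mult.assoc)
  also have "\<dots> = tri_sign r * (\<Sum>J | J \<subseteq> {1..n} \<and> card J = r. \<Sum>I | I \<subseteq> {1..n} \<and> card I = r.
     scal (col_det r (\<lambda>s t. a (nth_of I s) (nth_of J t) + of_nat (r - t) * (if nth_of I s
         = nth_of J t then 1 else 0)))
     * odd_prod e r (nth_of I) * odd_prod f r (nth_of J))"
  proof (intro arg_cong[of _ _ "(*) (tri_sign r)"] sum.cong refl)
    fix J assume "J \<in> {J. J \<subseteq> {1..n} \<and> card J = r}"
    then have J: "J \<subseteq> {1..n}" "card J = r" by auto
    then have bij: "bij_betw (nth_of J) {1..r} J" by (intro bij_betw_nth_of)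
        (auto intro: finite_subset)
    have nJ: "nth_of J k \<in> {1..n}" if "k \<in> {1..r}" for k
      by (rule subsetD[OF J(1) bij_betw_apply[OF bij that]])
    let ?\<Phi> = "\<lambda>i k. a i (nth_of J k) + of_nat (r - k) * (if i = nth_of J k then 1 else 0)"
    have "seq_prod ?h r (nth_of J) = seq_prod (\<lambda>k _. \<Sum>i\<in>{1..n}. scal (?\<Phi> i k) * e i) r (nth_of J)"
    proof (rule seq_prod_cong)
      fix k assume k: "k \<in> {1..r}"
      have "scal (?\<Phi> i k) * e i = scal (a i (nth_of J k)) * e i
          + (if i = nth_of J k then of_nat (r - k) * e i else 0)" for i
        using scal_of_int[of "int (r - k)", where 'a='a]
          by (simp add: scal_add scal_0 distrib_right)
      then show "?h k (nth_of J k) = (\<Sum>i\<in>{1..n}. scal (?\<Phi> i k) * e i)"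
        using nJ[OF k]
          by (simp only: \<eta>_def \<alpha>_def if_True sum.distrib sum.delta finite_atLeastAtMost)
    qed
    also have "\<dots> = (\<Sum>I | I \<subseteq> {1..n} \<and> card I = r.
        scal (col_det r (\<lambda>s t. ?\<Phi> (nth_of I s) t)) * odd_prod e r (nth_of I))"
      by (rule linear_forms_prod[OF odd_family_gen finite_atLeastAtMost])
    finally show "seq_prod ?h r (nth_of J) * odd_prod f r (nth_of J)
        = (\<Sum>I | I \<subseteq> {1..n} \<and> card I = r.
       scal (col_det r (\<lambda>s t. a (nth_of I s) (nth_of J t) + of_nat (r - t) * (if nth_of I s
           = nth_of J t then 1 else 0)))
       * odd_prod e r (nth_of I) * odd_prod f r (nth_of J))"
      by (simp only: sum_distrib_right)
  qed
  finally show ?thesis .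
qed

lemma dpow_F_eq: "dpow F k = (\<Sum>I | I \<subseteq> {1..n} \<and> card I = 2 * k. scal (pfaffian k (submat b I I))
    * odd_prod e (2 * k) (nth_of I))"
  using quadratic_form_dpow[OF odd_family_gen[of "\<lambda>i. i"], of "{1..n}" b k]
  by (simp add: F_def B_def mult.assoc)

lemma dpow_E_eq: "dpow E k = (- 1) ^ k * (\<Sum>J | J \<subseteq> {1..n} \<and> card J
    = 2 * k. scal (pfaffian k (submat c J J)) * odd_prod f (2 * k) (nth_of J))"
  using quadratic_form_dpow[OF odd_family_gen[of "neg_index n"], of "{1..n}" c k]
  by (simp add: E_def C_def mult.assoc dpow_minus scaleC.scale_minus_left)

text \<open>
  If \<open>l + k > n\<close>, the first factor is \<open>0\<close>.  Otherwise, with \<open>r = n - l - k\<close>, the summand has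
  degree \<open>r + 2k\<close> in \<open>e\<^sub>1, \<dots>, e\<^sub>n\<close> and \<open>r + 2l\<close> in \<open>f\<^sub>1, \<dots>, f\<^sub>n\<close>.  One of these
  numbers exceeds \<open>n\<close> unless \<open>k = l\<close>.
\<close>

lemma normal_term_0:
  assumes "l \<noteq> k"
  shows "Ris (int n - int l - int k) (int k - int l) * D l k = 0"
proof (cases "l + k \<le> n")
  case False
  then show ?thesis by (simp add: rising_dp_neg)
next
  case True
  let ?P = "{1..n}" and ?M = "{n + 1..2 * n}"
  have in_M: "neg_index n i \<in> ?M" "neg_index n i \<notin> ?P" "i \<notin> ?M" if "i \<in> ?P" for i
    using that by (auto simp: neg_index_def)
  have \<tau>: "homogeneous A 1 \<tau>" if "A = ?P \<or> A = ?M" for A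
    unfolding \<tau>_def
  proof (rule homogeneous_sum)
    fix i assume "i \<in> ?P"
    then show "homogeneous A 1 (e i * f i)"
      using homogeneous_mult[OF homogeneous_gen[of A i] homogeneous_gen[of A "neg_index n i"]]
          in_M[of i] that by auto
  qed
  have H: "homogeneous ?P (1 + 0) H" "homogeneous ?M (0 + 1) H"
    unfolding H_def by (rule homogeneous_pair_sum; use in_M in simp)+
  have B: "homogeneous ?P (1 + 1) B" "homogeneous ?M (0 + 0) B"
    unfolding B_def by (rule homogeneous_pair_sum; use in_M in simp)+
  have C: "homogeneous ?P (0 + 0) C" "homogeneous ?M (1 + 1) C"
    unfolding C_def by (rule homogeneous_pair_sum; use in_M in simp)+
  have E: "homogeneous ?P (0 + 0) E" "homogeneous ?M (1 + 1) E"
    unfolding E_def by (rule homogeneous_scaleC, rule C)+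
  have F: "homogeneous ?P (1 + 1) F" "homogeneous ?M (0 + 0) F"
    unfolding F_def by (rule homogeneous_scaleC, rule B)+
  have Y: "homogeneous A 1 (H + of_int (int k - int l) * \<tau>)" if "A = ?P \<or> A = ?M" for A
    unfolding of_int_mult_eq_scaleC using that H \<tau>
    by (intro homogeneous_add homogeneous_scaleC) auto
  have j: "nat (int n - int l - int k) = n - l - k" by simp
  have P: "homogeneous ?P ((n - l - k) * 1 + (l * (0 + 0) + k * (1 + 1)))
      (Ris (int n - int l - int k) (int k - int l) * D l k)"
    unfolding D_def j[symmetric]
    by (intro homogeneous_mult homogeneous_rising_dp homogeneous_dpow \<tau> Y E F) simp_all
  have M: "homogeneous ?M ((n - l - k) * 1 + (l * (1 + 1) + k * (0 + 0)))
      (Ris (int n - int l - int k) (int k - int l) * D l k)"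
    unfolding D_def j[symmetric]
    by (intro homogeneous_mult homogeneous_rising_dp homogeneous_dpow \<tau> Y E F) simp_all
  show ?thesis
  proof (cases "l < k")
    case less: True
    show ?thesis by (rule homogeneous_degree_bound[OF P]) (use less True in auto)
  next
    case False
    show ?thesis by (rule homogeneous_degree_bound[OF M]) (use False True assms in auto)
  qed
qed

text \<open>
  Multiplying out the three expansions, only complementary subsets survive: \<open>I' = {1..n} - I\<close> and
  \<open>J' = {1..n} - J\<close>.
\<close>

lemma top_degree_term:
  assumes k: "2 * k \<le> n"
  shows "Ris (int n - int k - int k) (int k - int k) * D k k
    = tri_sign n * (scal (\<Sum>I | I \<subseteq> {1..n} \<and> card I = 2 * k. \<Sum>J | J \<subseteq> {1..n} \<and> card J = 2 * k.
        of_int (shuffle_sign ({1..n} - I) I) * of_int (shuffle_sign ({1..n} - J) J)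
        * col_det (n - 2 * k) (\<lambda>s t. a (nth_of ({1..n} - I) s) (nth_of ({1..n} - J) t)
            + of_nat (n - 2 * k - t) * (if nth_of ({1..n} - I) s
                = nth_of ({1..n} - J) t then 1 else 0))
        * pfaffian k (submat c J J) * pfaffian k (submat b I I))
      * (odd_prod e n (\<lambda>i. i) * odd_prod f n (\<lambda>i. i)))"
proof -
  define r where "r = n - 2 * k"
  have n: "n = r + 2 * k" using k by (simp add: r_def)
  let ?S = "\<lambda>m. {I. I \<subseteq> {1..n} \<and> card I = m}"
  define d where "d I J = col_det r (\<lambda>s t. a (nth_of I s) (nth_of J t)
            + of_nat (r - t) * (if nth_of I s = nth_of J t then 1 else 0))" for I J
  define sh where "sh I = (of_int (shuffle_sign ({1..n} - I) I) :: 'a)" for I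
  let ?pb = "\<lambda>I. pfaffian k (submat b I I)" and ?pc = "\<lambda>J. pfaffian k (submat c J J)"
  let ?top = "odd_prod e n (\<lambda>i. i) * odd_prod f n (\<lambda>i. i)"
  have fin: "finite (?S m)" for m by simp
  have coll: "(\<Sum>J'\<in>?S r. \<Sum>I'\<in>?S r. scal (d I' J') * odd_prod e r (nth_of I')
      * odd_prod f r (nth_of J')
        * (scal (?pc J) * odd_prod f (2 * k) (nth_of J))
            * (scal (?pb I) * odd_prod e (2 * k) (nth_of I)))
      = scal (sh I * sh J * d ({1..n} - I) ({1..n} - J) * ?pc J * ?pb I) * ?top"
    if I: "I \<in> ?S (2 * k)" and J: "J \<in> ?S (2 * k)" for I J
  proof -
    \<comment> \<open>The product over \<open>I\<close> has even length, hence commutes with all \<open>f i\<close>.\<close>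
    have T: "scal (d I' J') * odd_prod e r (nth_of I') * odd_prod f r (nth_of J')
        * (scal (?pc J) * odd_prod f (2 * k) (nth_of J))
            * (scal (?pb I) * odd_prod e (2 * k) (nth_of I))
        = scal (d I' J' * ?pc J * ?pb I)
            * ((odd_prod e r (nth_of I') * odd_prod e (2 * k) (nth_of I))
          * (odd_prod f r (nth_of J') * odd_prod f (2 * k) (nth_of J)))" for I' J'
    proof -
      let ?e' = "odd_prod e r (nth_of I')" and ?e = "odd_prod e (2 * k) (nth_of I)"
      let ?f' = "odd_prod f r (nth_of J')" and ?f = "odd_prod f (2 * k) (nth_of J)"
      have es: "?e' * scal x = scal x * ?e'" and fs: "?f' * scal x = scal x * ?f'" "?f * scal x
          = scal x * ?f" for x
        by (rule odd_prod_scal[OF odd_family_gen])+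
      have eg: "?e * gen i = gen i * ?e" for i
        by (rule odd_prod_commute_even) (rule gen_anticommute)
      have ef: "?f' * ?e = ?e * ?f'" "?f * ?e = ?e * ?f"
        by (rule seq_prod_commute, rule eg[symmetric])+
      have "scal (d I' J') * ?e' * ?f' * (scal (?pc J) * ?f) * (scal (?pb I) * ?e)
          = scal (d I' J') * (?e' * (?f' * (scal (?pc J) * (scal (?pb I) * (?f * ?e)))))"
        by (simp only: mult.assoc commute_left[OF fs(2)])
      also have "\<dots> = scal (d I' J') * (scal (?pc J) * (scal (?pb I) * (?e' * (?e * (?f' * ?f)))))"
        by (simp only: ef commute_left[OF fs(1)] commute_left[OF es] commute_left[OF ef(1)])
      finally show ?thesis by (simp only: scal_mult mult.assoc)
    qed
    have cI: "odd_prod e r (nth_of I') * odd_prod e (2 * k) (nth_of I)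
        = (if I' = {1..n} - I then scal (sh I) * odd_prod e n (\<lambda>i. i) else 0)" if "I' \<in> ?S r" for I'
    proof -
      have c: "card I' = r" "card I = 2 * k" and "I \<subseteq> {1..n}" "I' \<subseteq> {1..n}" "card I' + card I = n"
        using that I n by auto
      from odd_prod_complement[OF odd_family_gen[of "\<lambda>i. i"] this(3-5)] show ?thesis
        unfolding c sh_def scal_of_int by (cases "I' = {1..n} - I")
            (simp_all only: if_True if_False simp_thms)
    qed
    have cJ: "odd_prod f r (nth_of J') * odd_prod f (2 * k) (nth_of J)
        = (if J' = {1..n} - J then scal (sh J) * odd_prod f n (\<lambda>i. i) else 0)" if "J' \<in> ?S r" for J'
    proof -
      have c: "card J' = r" "card J = 2 * k" and "J \<subseteq> {1..n}" "J' \<subseteq> {1..n}" "card J' + card J = n"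
        using that J n by auto
      from odd_prod_complement[OF odd_family_gen[of "neg_index n"] this(3-5)] show ?thesis
        unfolding c sh_def scal_of_int by (cases "J' = {1..n} - J")
            (simp_all only: if_True if_False simp_thms)
    qed
    have comp: "{1..n} - I \<in> ?S r" "{1..n} - J \<in> ?S r"
      using I J n by (auto simp: card_Diff_subset finite_subset[of _ "{1..n}"])
    have sh: "x * sh K = sh K * x" for x K unfolding sh_def by (rule mult_of_int_commute[symmetric])
    have es: "odd_prod e n (\<lambda>i. i) * scal x = scal x * odd_prod e n (\<lambda>i. i)" for x
      by (rule odd_prod_scal[OF odd_family_gen])
    have "(\<Sum>J'\<in>?S r. \<Sum>I'\<in>?S r. scal (d I' J') * odd_prod e r (nth_of I') * odd_prod f r (nth_of J')
        * (scal (?pc J) * odd_prod f (2 * k) (nth_of J))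
            * (scal (?pb I) * odd_prod e (2 * k) (nth_of I)))
      = (\<Sum>J'\<in>?S r. \<Sum>I'\<in>?S r. if J' = {1..n} - J then (if I' = {1..n} - I then
          scal (d I' J' * ?pc J * ?pb I) * ((scal (sh I) * odd_prod e n (\<lambda>i. i))
              * (scal (sh J) * odd_prod f n (\<lambda>i. i)))
          else 0) else 0)"
      unfolding T by (intro sum.cong refl) (simp add: cI cJ)
    also have "\<dots> = scal (d ({1..n} - I) ({1..n} - J) * ?pc J * ?pb I)
        * ((scal (sh I) * odd_prod e n (\<lambda>i. i)) * (scal (sh J) * odd_prod f n (\<lambda>i. i)))"
      by (simp only: sum_if_const sum.delta fin comp if_True)
    also have "\<dots> = scal (d ({1..n} - I) ({1..n} - J) * ?pc J * ?pb I * (sh I * sh J)) * ?top"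
      by (simp only: commute_left[OF es] scal_mult mult.assoc)
    also have "d ({1..n} - I) ({1..n} - J) * ?pc J * ?pb I * (sh I * sh J)
        = sh I * sh J * d ({1..n} - I) ({1..n} - J) * ?pc J * ?pb I"
    proof -
      have "x * (sh I * sh J) = sh I * sh J * x" for x
        by (rule commute_mult[OF sh sh])
      then show ?thesis by (simp only: mult.assoc)
    qed
    finally show ?thesis .
  qed
  have "Ris (int n - int k - int k) (int k - int k) = rising_dp \<tau> H (int r)"
    by (simp add: n)
  also have "\<dots> = tri_sign r * (\<Sum>J'\<in>?S r. \<Sum>I'\<in>?S r. scal (d I' J') * odd_prod e r (nth_of I')
      * odd_prod f r (nth_of J'))"
    (is "_ = _ * ?U") unfolding rising_dp_H d_def ..
  finally have "Ris (int n - int k - int k) (int k - int k) * D k k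
      = tri_sign r * ?U * ((- 1) ^ k * (\<Sum>J\<in>?S (2 * k). scal (?pc J) * odd_prod f (2 * k) (nth_of J))
        * (\<Sum>I\<in>?S (2 * k). scal (?pb I) * odd_prod e (2 * k) (nth_of I)))"
    unfolding D_def dpow_E_eq dpow_F_eq by (rule arg_cong)
  also have "\<dots>
      = (- 1) ^ k * tri_sign r * (?U * (\<Sum>J\<in>?S (2 * k). scal (?pc J) * odd_prod f (2 * k) (nth_of J))
        * (\<Sum>I\<in>?S (2 * k). scal (?pb I) * odd_prod e (2 * k) (nth_of I)))"
    by (simp only: mult.assoc minus_one_power_left_commute)
  also have "(- 1) ^ k * tri_sign r = (tri_sign n :: 'a exterior)"
    unfolding n by (rule tri_sign_add_even[symmetric])
  also have "?U * (\<Sum>J\<in>?S (2 * k). scal (?pc J) * odd_prod f (2 * k) (nth_of J))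
        * (\<Sum>I\<in>?S (2 * k). scal (?pb I) * odd_prod e (2 * k) (nth_of I))
      = (\<Sum>I\<in>?S (2 * k). \<Sum>J\<in>?S (2 * k). ?U * (scal (?pc J) * odd_prod f (2 * k) (nth_of J))
        * (scal (?pb I) * odd_prod e (2 * k) (nth_of I)))"
    by (subst sum_distrib_left, intro sum.cong refl, subst sum_distrib_left, rule sum_distrib_right)
  also have "\<dots> = (\<Sum>I\<in>?S (2 * k). \<Sum>J\<in>?S (2 * k). scal (sh I * sh J * d ({1..n} - I) ({1..n} - J)
      * ?pc J * ?pb I) * ?top)"
    by (intro sum.cong refl) (simp only: coll[symmetric] sum_distrib_right)
  also have "\<dots> = scal (\<Sum>I\<in>?S (2 * k). \<Sum>J\<in>?S (2 * k). sh I * sh J * d ({1..n} - I) ({1..n} - J)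
      * ?pc J * ?pb I) * ?top"
    by (simp only: scal_sum sum_distrib_right)
  finally show ?thesis unfolding d_def sh_def r_def .
qed

text \<open>
  The hypotheses say that \<open>A i j\<close> is the entry of the block matrix of \<open>a\<close>, \<open>b\<close>, \<open>c\<close> in row \<open>i\<close> and
  column \<open>-j\<close>.
\<close>

theorem pfaffian_normal_form:
  assumes A: "\<And>i j. i \<in> {1..n} \<Longrightarrow> j \<in> {1..n} \<Longrightarrow> A i j = b i j"
      "\<And>i j. i \<in> {1..n} \<Longrightarrow> j \<in> {1..n} \<Longrightarrow> A i (neg_index n j) = a i j"
      "\<And>i j. i \<in> {1..n} \<Longrightarrow> j \<in> {1..n} \<Longrightarrow> A (neg_index n i) j = - a j i"
      "\<And>i j. i \<in> {1..n} \<Longrightarrow> j \<in> {1..n} \<Longrightarrow> A (neg_index n i) (neg_index n j) = - c i j"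
  shows "pfaffian n A = (\<Sum>k = 0..n div 2. \<Sum>I | I \<subseteq> {1..n} \<and> card I = 2 * k. \<Sum>J | J \<subseteq> {1..n} \<and> card J
      = 2 * k.
        of_int (shuffle_sign ({1..n} - I) I) * of_int (shuffle_sign ({1..n} - J) J)
        * col_det (n - 2 * k) (\<lambda>s t. a (nth_of ({1..n} - I) s) (nth_of ({1..n} - J) t)
            + of_nat (n - 2 * k - t) * (if nth_of ({1..n} - I) s
                = nth_of ({1..n} - J) t then 1 else 0))
        * pfaffian k (submat c J J) * pfaffian k (submat b I I))"
    (is "_ = (\<Sum>k = 0..n div 2. ?R k)")
proof -
  let ?\<Omega> = "(1 / 2) *\<^sub>C (\<Sum>i\<in>{1..2 * n}. \<Sum>j\<in>{1..2 * n}. scal (A i j) * gen i * gen j)"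
  have "(\<Sum>i\<in>{1..2 * n}. \<Sum>j\<in>{1..2 * n}. scal (A i j) * gen i * gen j)
    = (\<Sum>i\<in>{1..n}. \<Sum>j\<in>{1..n}. scal (b i j) * (e i * e j))
        + (\<Sum>i\<in>{1..n}. \<Sum>j\<in>{1..n}. scal (- a j i) * (f i * e j))
      + ((\<Sum>i\<in>{1..n}. \<Sum>j\<in>{1..n}. scal (a i j) * (e i * f j))
          + (\<Sum>i\<in>{1..n}. \<Sum>j\<in>{1..n}. scal (- c i j) * (f i * f j)))"
    unfolding sum_atLeast1_atMost_double sum.distrib
    by (intro arg_cong2[of _ _ _ _ "(+)"] sum.cong refl) (simp_all only: A mult.assoc)
  also have "(\<Sum>i\<in>{1..n}. \<Sum>j\<in>{1..n}. scal (- a j i) * (f i * e j)) = H"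
  proof -
    have "scal (- a i j) * (f j * e i) = scal (a i j) * (e i * f j)" for i j
      by (subst gen_anticommute[of "neg_index n j"]) (simp add: scal_minus)
    then show ?thesis unfolding H_def by (subst sum.swap) (simp only:)
  qed
  also have "(\<Sum>i\<in>{1..n}. \<Sum>j\<in>{1..n}. scal (- c i j) * (f i * f j)) = - C"
    by (simp add: C_def scal_minus sum_negf)
  finally have "?\<Omega> = (1 / 2) *\<^sub>C (B + H + (H + - C))"
    by (simp only: B_def[symmetric] H_def[symmetric])
  also have "\<dots> = E + H + F"
  proof -
    have "(1 / 2) *\<^sub>C H + (1 / 2) *\<^sub>C H = (1 / 2 + 1 / 2) *\<^sub>C H"
      by (rule scaleC_add_left[symmetric])
    also have "\<dots> = H" by (simp add: scaleC_one)
    finally have "(1 / 2) *\<^sub>C H + (1 / 2) *\<^sub>C H = H" .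
    then show ?thesis
      by (simp add: E_def F_def scaleC.scale_right_distrib scaleC.scale_right_diff_distrib
          scaleC.scale_minus_left algebra_simps)
  qed
  finally have \<Omega>: "?\<Omega> = E + H + F" .
  have "{K. K \<subseteq> {1..2 * n} \<and> card K = 2 * n} = {{1..2 * n}}"
    using card_subset_eq[of "{1..2 * n}"] by auto
  then have "dpow ?\<Omega> n = scal (pfaffian n (submat A {1..2 * n} {1..2 * n})) * odd_prod gen (2 * n)
      (nth_of {1..2 * n})"
    by (subst quadratic_form_dpow[OF odd_family_gen[of "\<lambda>i. i"]]) simp_all
  also have "pfaffian n (submat A {1..2 * n} {1..2 * n}) = pfaffian n A"
    by (rule pfaffian_cong) (simp only: submat_def nth_of_upto)
  also have "odd_prod gen (2 * n) (nth_of {1..2 * n}) = odd_prod gen (2 * n) (\<lambda>i. i)"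
    by (rule seq_prod_cong) (simp only: nth_of_upto)
  finally have 1: "dpow (E + H + F) n = scal (pfaffian n A) * odd_prod gen (2 * n) (\<lambda>i. i)"
    by (simp only: \<Omega>)
  have "odd_prod gen (n + n) (\<lambda>i. i) = odd_prod e n (\<lambda>i. i) * odd_prod f n (\<lambda>k. n + 1 - k)"
    unfolding seq_prod_add by (intro arg_cong2[of _ _ _ _ "(*)"] seq_prod_cong refl)
        (auto simp: neg_index_def intro: arg_cong[of _ _ gen])
  also have "\<dots> = tri_sign n * (odd_prod e n (\<lambda>i. i) * odd_prod f n (\<lambda>i. i))"
    by (simp only: odd_prod_reverse[OF odd_family_gen] tri_sign_left_commute)
  finally have top: "tri_sign n * (odd_prod e n (\<lambda>i. i) * odd_prod f n (\<lambda>i. i))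
      = odd_prod gen (2 * n) (\<lambda>i. i)"
    by (simp add: mult_2)
  have nt: "Ris (int n - int l - int k) (int k - int l) * D l k
      = (if l = k then Ris (int n - int k - int k) (int k - int k) * D k k else 0)" for l k
  proof (cases "l = k")
    case False
    then show ?thesis by (simp only: normal_term_0[OF False] if_False)
  qed simp
  have "dpow (E + H + F) n = (\<Sum>l\<le>n. \<Sum>k\<le>n. if l = k then Ris (int n - int k - int k) (int k - int k)
      * D k k else 0)"
    unfolding dpow_sum by (intro sum.cong refl nt)
  also have "\<dots> = (\<Sum>k\<le>n. Ris (int n - int k - int k) (int k - int k) * D k k)"
    by (simp add: sum.delta)
  also have "\<dots> = (\<Sum>k = 0..n div 2. Ris (int n - int k - int k) (int k - int k) * D k k)"
    by (rule sum.mono_neutral_right) (auto intro!: rising_dp_neg[THEN arg_cong[of _ _ "\<lambda>x. x * _"],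
        THEN trans])
  also have "\<dots> = (\<Sum>k = 0..n div 2. scal (?R k) * odd_prod gen (2 * n) (\<lambda>i. i))"
  proof (rule sum.cong[OF refl])
    fix k assume "k \<in> {0..n div 2}"
    then have "2 * k \<le> n" by auto
    then show "Ris (int n - int k - int k) (int k - int k) * D k k
        = scal (?R k) * odd_prod gen (2 * n) (\<lambda>i. i)"
      by (simp only: top_degree_term top[symmetric] tri_sign_left_commute)
  qed
  also have "\<dots> = scal (\<Sum>k = 0..n div 2. ?R k) * odd_prod gen (2 * n) (\<lambda>i. i)"
    by (simp only: scal_sum sum_distrib_right)
  finally show ?thesis unfolding 1 by (rule scal_mult_top_inject)
qed

end

theorem theorem4p7:
  fixes n :: nat
  assumes n: "n = CARD('n::finite)"
  shows "pfaffian n (\<lambda>i j. X_entry i (neg_index n j) :: 'n o2n uea) =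
    (\<Sum>k = 0..n div 2.
      \<Sum>I | I \<subseteq> {1..n} \<and> card I = 2 * k.
      \<Sum>J | J \<subseteq> {1..n} \<and> card J = 2 * k.
        let I' = {1..n} - I; J' = {1..n} - J; m = card J' in
        of_int (shuffle_sign I' I) * of_int (shuffle_sign J' J)
        * col_det m (\<lambda>s t. submat a_entry I' J' s t + mat_prod m (submat id_mat I' J') (rho_mat m) s t)
        * pfaffian k (submat c_entry J J)
        * pfaffian k (submat b_entry I I))"
proof -
  interpret orthogonal_relations n a_entry b_entry "c_entry :: nat \<Rightarrow> nat \<Rightarrow> 'n o2n uea"
    unfolding n by (rule orthogonal_relations_entries)
  let ?A = "\<lambda>i j. X_entry i (neg_index n j) :: 'n o2n uea"
  have in2: "i \<in> {1..2 * CARD('n)}" if "i \<in> {1..n}" for i using that n by simp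
  have mat: "submat a_entry I' J' s t + mat_prod m (submat id_mat I' J') (rho_mat m) s t
      = a_entry (nth_of I' s) (nth_of J' t) + of_nat (m - t) * (if nth_of I' s
          = nth_of J' t then 1 else 0 :: 'n o2n uea)"
    if "t \<in> {1..m}" for I' J' s t m
  proof -
    have "mat_prod m (submat id_mat I' J') (rho_mat m) s t
        = (\<Sum>u = 1..m. if u = t then id_mat (nth_of I' s) (nth_of J' t)
            * of_nat (m - t) else 0 :: 'n o2n uea)"
      unfolding mat_prod_def by (rule sum.cong) (auto simp: submat_def rho_mat_def)
    also have "\<dots> = id_mat (nth_of I' s) (nth_of J' t) * of_nat (m - t)"
      using that by (simp only: sum.delta finite_atLeastAtMost if_True)
    finally show ?thesis by (simp add: submat_def id_mat_def)
  qed
  have "pfaffian n ?A = (\<Sum>k = 0..n div 2. \<Sum>I | I \<subseteq> {1..n} \<and> card I = 2 * k. \<Sum>J | J \<subseteq> {1..n} \<and> card J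
      = 2 * k.
        of_int (shuffle_sign ({1..n} - I) I) * of_int (shuffle_sign ({1..n} - J) J)
        * col_det (n - 2 * k) (\<lambda>s t. a_entry (nth_of ({1..n} - I) s) (nth_of ({1..n} - J) t)
            + of_nat (n - 2 * k - t) * (if nth_of ({1..n} - I) s
                = nth_of ({1..n} - J) t then 1 else 0))
        * pfaffian k (submat c_entry J J) * pfaffian k (submat b_entry I I))"
  proof (rule pfaffian_normal_form)
    fix i j assume ij: "i \<in> {1..n}" "j \<in> {1..n}"
    note i = in2[OF ij(1)] and j = in2[OF ij(2)]
    show "?A i j = b_entry i j" by (simp add: b_entry_def n)
    show "?A i (neg_index n j) = a_entry i j"
      using neg_index_neg[OF j] by (simp add: a_entry_def n)
    show "?A (neg_index n i) j = - a_entry j i"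
      using X_entry_neg[OF j i] by (simp add: a_entry_def n)
    show "?A (neg_index n i) (neg_index n j) = - c_entry i j"
      using X_entry_neg[OF neg_index_in[OF j] i] by (simp add: c_entry_def n)
  qed
  also have "\<dots> = (\<Sum>k = 0..n div 2.
      \<Sum>I | I \<subseteq> {1..n} \<and> card I = 2 * k.
      \<Sum>J | J \<subseteq> {1..n} \<and> card J = 2 * k.
        let I' = {1..n} - I; J' = {1..n} - J; m = card J' in
        of_int (shuffle_sign I' I) * of_int (shuffle_sign J' J)
        * col_det m (\<lambda>s t. submat a_entry I' J' s t
            + mat_prod m (submat id_mat I' J') (rho_mat m) s t)
        * pfaffian k (submat c_entry J J)
        * pfaffian k (submat b_entry I I))"
  proof (intro sum.cong refl)
    fix k I J assume "J \<in> {J. J \<subseteq> {1..n} \<and> card J = 2 * k}"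
    then have "card ({1..n} - J) = n - 2 * k"
      by (auto simp: card_Diff_subset finite_subset[of _ "{1..n}"])
    moreover have "col_det m (\<lambda>s t. submat a_entry I' J' s t
        + mat_prod m (submat id_mat I' J') (rho_mat m) s t)
       = col_det m (\<lambda>s t. a_entry (nth_of I' s) (nth_of J' t) + of_nat (m - t) * (if nth_of I' s
           = nth_of J' t then 1 else 0 :: 'n o2n uea))"
      for I' J' m by (rule col_det_cong) (rule mat)
    ultimately show "of_int (shuffle_sign ({1..n} - I) I) * of_int (shuffle_sign ({1..n} - J) J)
        * col_det (n - 2 * k) (\<lambda>s t. a_entry (nth_of ({1..n} - I) s) (nth_of ({1..n} - J) t)
            + of_nat (n - 2 * k - t) * (if nth_of ({1..n} - I) s
                = nth_of ({1..n} - J) t then 1 else 0))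
        * pfaffian k (submat c_entry J J) * pfaffian k (submat b_entry I I)
      = (let I' = {1..n} - I; J' = {1..n} - J; m = card J' in
        of_int (shuffle_sign I' I) * of_int (shuffle_sign J' J)
        * col_det m (\<lambda>s t. submat a_entry I' J' s t
            + mat_prod m (submat id_mat I' J') (rho_mat m) s t)
        * pfaffian k (submat c_entry J J)
        * pfaffian k (submat b_entry I I :: nat \<Rightarrow> nat \<Rightarrow> 'n o2n uea))"
      unfolding Let_def by (simp only:)
  qed
  finally show ?thesis .
qed

end
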